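(* Let $\boldsymbol F=(f_1,\ldots,f_m)$ be a sequence of nonzero polynomials in $R=K[x_1,\ldots,x_n]$. Assume that $\boldsymbol F^{\rm top}$ is cryptographic semi-regular, and put $D=d_{\rm reg}(\langle F^{\rm top}\rangle)\in\mathbb Z_{>0}\cup\{\infty\}$. (1) If $D<\infty$, then, before the step degree first reaches $D$, corresponding S-pairs can be selected in the three Buchberger-like Gröbner basis computations (with the normal selection strategy) for $\langle F^{\rm top}\rangle$, $\langle F^h\rangle$, and $\langle F\rangle$. After a reduction sequence is chosen in any one of them, corresponding sequences can be constructed in the other two; reduction steps that specialize to the identity at $y=0$ are omitted. The resulting remainders, intermediate bases, and leading monomials correspond under the specializations $y=0$ (from $F^h$ to $F^{\rm top}$) and $y=1$ (from $F^h$ to $F$). If $D=\infty$, the same statements hold through every finite step degree. In particular, no degree fall occurs in the indicated part of the affine computation (the computation for $\langle F\rangle$). (2) Assume in addition that $D<\infty$. At the first stage at which the step degree reaches $D$, carry out the affine computation using the sugar strategy and the reduction convention described in the context. Then for every selected affine S-pair of sugar degree $D$, the part of its reduction sequence that preserves the sugar degree lifts to a reduction sequence for the corresponding homogeneous S-pair. Consequently, the leading monomials obtained by the end of sugar degree $D$ generate a monomial ideal containing every monomial of $R$ of degree $D$. If $D\ge\max\{\deg(f):f\in F\}$, then the algorithmic solving degree of the resulting Buchberger-like computation is at most $2D-1$. If, after sugar degree $D$, the sugar strategy is stopped and the polynomials obtained up to that degree are inter-reduced before the computation is continued, then the solving degree in the strict sense is at most $2D-2$.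
   Context: **Notation.** $K$ is a field, $R=K[x_1,\ldots,x_n]$, $R'=R[y]$. $\prec$ is a fixed degree reverse lexicographic (DRL) ordering on $R$; $\prec^h$ is its homogenization on $R'$, i.e. the DRL ordering on $R'$ restricting to $\prec$ on $R$ with $y$ the smallest variable. For $f\in R\smallsetminus\{0\}$, $f^{\rm top}$ is its highest-degree homogeneous component and $f^h\in R'$ its homogenization. $F=\{f_1,\ldots,f_m\}$, $\boldsymbol F^{\rm top}=(f_1^{\rm top},\ldots,f_m^{\rm top})$, $\boldsymbol F^h=(f_1^h,\ldots,f_m^h)$, with $F^{\rm top},F^h$ the corresponding sets; so $f_i^h|_{y=0}=f_i^{\rm top}$, $f_i^h|_{y=1}=f_i$. For a homogeneous ideal $I\subset R$, $d_{\rm reg}(I)$ is the least $d\ge0$ with $I_d=R_d$ ($\infty$ if none). A sequence $\boldsymbol H=(h_1,\ldots,h_m)$ of homogeneous polynomials of degrees $d_1,\ldots,d_m$ in $R$ is $d$-regular if the Hilbert series satisfies $\mathrm{HS}_{R/\langle\boldsymbol H\rangle}(z)\equiv\prod_{j=1}^m(1-z^{d_j})/(1-z)^n\pmod{z^d}$; it is cryptographic semi-regular if it is $d_{\rm reg}(\langle\boldsymbol H\rangle)$-regular (for every positive $d$ if $d_{\rm reg}=\infty$). **Buchberger-like computation.** In $A=R$ (ordering $\prec$) or $A=R'$ (ordering $\prec^h$), a computation maintains a current (intermediate) basis, initially the input generators (distinguished by their indices $i$), and a collection of available S-pairs, initially all pairs of input generators. At each stage a single available S-pair $(g_1,g_2)$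 is selected, and $S(g_1,g_2)=t_1g_1-t_2g_2$, $t_i=\operatorname{lcm}(\operatorname{LM}(g_1),\operatorname{LM}(g_2))/\operatorname{LT}(g_i)$, is formed and reduced by the current basis to a remainder; a nonzero remainder is inserted into the current basis and all new S-pairs involving it are generated. A one-step reduction of $g$ by $h$ eliminates a term $ct$ of $g$ with $\operatorname{LM}(h)\mid t$, replacing $g$ by $g-c\frac{t}{\operatorname{LT}(h)}h$; a remainder is the end of a reduction sequence that admits no further one-step reduction by the current basis. Unnecessary S-pairs may be discarded by criteria depending only on leading monomials; in particular Buchberger's product criterion is applied (pairs with relatively prime leading monomials are discarded before the S-polynomial is formed); discarded pairs are not processed and their degrees are not counted. The degree of an S-pair is $\deg\operatorname{lcm}(\operatorname{LM}(g_1),\operatorname{LM}(g_2))$. The normal selection strategy selects an available S-pair whose lcm is minimal in the monomial ordering; ties and the order of reducers are arbitrary. The step degree is the degree of the selected S-pair. A degree fall occurs at step degree $d$ if a nonzero remainder obtained at step degree $d$ has total degree $<d$. S-pairs $(g_1,g_2)$ in the computation for $\langle F^h\rangle$ and $(g_1|_{y=a},g_2|_{y=a})$ in the computation for $\langle F^h|_{y=a}\rangle$ ($a=0,1$) are called corresponding, and likewise for intermediate polynomials and reduction sequences (termwise specialization, omitting identity steps for $a=0$). **Sugar strategy.** The sugar degree is defined recursively: $\mathrm{sdeg}(f_i)=\deg(f_i)$; $\mathrm{sdeg}(ctg)=\mathrm{sdeg}(g)+\deg(t)$ for a monomial $t$ and $c\in K^\times$; $\mathrm{sdeg}(g+h)=\max\{\mathrm{sdeg}(g),\mathrm{sdeg}(h)\}$.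 Thus a one-step reduction $r\to r'=r-cth$ gives $\mathrm{sdeg}(r')=\max\{\mathrm{sdeg}(r),\mathrm{sdeg}(h)+\deg(t)\}$, and the sugar degree of an S-pair $(g_1,g_2)$ is $\max\{\mathrm{sdeg}(t_1g_1),\mathrm{sdeg}(t_2g_2)\}$. The sugar strategy selects S-pairs of lowest sugar degree first, ties being broken by the normal selection strategy; the step degree is then redefined as the sugar degree of the selected pair. **Reduction convention.** In reducing $S(g_1,g_2)$, reducers which do not change the sugar degree are prioritized as far as possible, giving $S(g_1,g_2)=r_0\to r_1\to\cdots\to r_k\to r_{k+1}\to\cdots\to r_\ell$ with $\mathrm{sdeg}(r_0)=\cdots=\mathrm{sdeg}(r_k)$ and, if $k<\ell$, $\mathrm{sdeg}(r_k)<\mathrm{sdeg}(r_{k+1})$, where $r_\ell$ is a remainder by the current basis. Put $r_{\rm sgr}(g_1,g_2)=r_k$, $r_{\rm fin}(g_1,g_2)=r_\ell$; the part preserving the sugar degree is $r_0\to\cdots\to r_k$. (One may also always stop at $r_{\rm sgr}$.) While S-pairs of sugar degree $D$ are processed, each nonzero $r_{\rm sgr}(g_1,g_2)$ is retained in the current basis, as is the nonzero final remainder if different, and the new S-pairs are generated before the next selection. After all pairs of sugar degree $D$ have been processed, the computation continues from the current basis and only final remainders are inserted. The homogeneous S-pair corresponding to an affine pair $(g_1,g_2)$ of sugar degree $D$ is $(g_1^h,g_2^h)$; the lift of $r_0\to\cdots\to r_k$ is the sequence $r_0^*\to\cdots\to r_k^*$ of homogeneous polynomials of degree $D$ with $r_i^*=y^{D-\deg(r_i)}r_i^h$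 (and $0^*=0$). **Solving degrees.** The algorithmic solving degree is the highest total degree of the polynomials involved in the entire execution; for the computations here it is the maximum of the degrees of the processed S-pairs and of the largest input degree. The solving degree in the strict sense is the highest degree of the nonzero S-polynomials appearing during the computation.
   Formalization: While sugar degree D is processed, S-pairs may be discarded only by criteria valid for the leading monomials of the homogeneous lifts; for D = 1 the strict bound 2D-2 is claimed only for the computation after inter-reduction. Without these two changes the claims fail. *)

theory Defs
  imports
    "HOL-Library.Poly_Mapping"
    "HOL-Library.Option_ord"
    "HOL-Library.Extended_Nat"
    "HOL-Computational_Algebra.Formal_Power_Series"
begin

section \<open>Monomials and polynomials\<close>

text \<open>
  The polynomial ring in the variables \<open>'v\<close> over \<open>'k\<close> is the monoid algebra
  \<open>('v, 'k) mpoly\<close>.  With \<open>'x :: {finite, linorder}\<close>, the ring \<open>R\<close> is \<open>('x, 'k) mpoly\<close>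
  (so \<open>n = card (UNIV :: 'x set)\<close>) and \<open>R' = R[y]\<close> is \<open>('x option, 'k) mpoly\<close>, where \<open>None\<close> is the
  variable \<open>y\<close>.  On \<open>'x option\<close> the order of \<open>Option_ord\<close> makes \<open>None\<close> the smallest variable.
\<close>

type_synonym 'v mon = "'v \<Rightarrow>\<^sub>0 nat"
type_synonym ('v, 'k) mpoly = "('v \<Rightarrow>\<^sub>0 nat) \<Rightarrow>\<^sub>0 'k"

abbreviation lookup :: "('a \<Rightarrow>\<^sub>0 'b::zero) \<Rightarrow> 'a \<Rightarrow> 'b" where
  "lookup \<equiv> Poly_Mapping.lookup"

abbreviation keys :: "('a \<Rightarrow>\<^sub>0 'b::zero) \<Rightarrow> 'a set" where
  "keys \<equiv> Poly_Mapping.keys"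

abbreviation single :: "'a \<Rightarrow> 'b \<Rightarrow> 'a \<Rightarrow>\<^sub>0 'b::zero" where
  "single \<equiv> Poly_Mapping.single"

definition mdeg :: "'v mon \<Rightarrow> nat" where
  "mdeg t = (\<Sum>v\<in>keys t. lookup t v)"

definition mdvd :: "'v mon \<Rightarrow> 'v mon \<Rightarrow> bool" where
  "mdvd s t \<longleftrightarrow> (\<forall>v. lookup s v \<le> lookup t v)"

lift_definition mlcm :: "'v mon \<Rightarrow> 'v mon \<Rightarrow> 'v mon" is "\<lambda>s t v. max (s v) (t v)"
proof -
  fix s t :: "'v \<Rightarrow> nat"
  assume "finite {v. s v \<noteq> 0}" "finite {v. t v \<noteq> 0}"
  then have "finite ({v. s v \<noteq> 0} \<union> {v. t v \<noteq> 0})" by simp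
  then show "finite {v. max (s v) (t v) \<noteq> 0}" by (rule rev_finite_subset) auto
qed

definition mcoprime :: "'v mon \<Rightarrow> 'v mon \<Rightarrow> bool" where
  "mcoprime s t \<longleftrightarrow> (\<forall>v. lookup s v = 0 \<or> lookup t v = 0)"

text \<open>
  Degree reverse lexicographic ordering: among monomials of the same degree, the one with the
  larger exponent at the smallest variable where they differ is the smaller one.  The ordering
  on \<open>'x option\<close> is the homogenization of the one on \<open>'x\<close>.
\<close>

definition drl_less :: "'v::linorder mon \<Rightarrow> 'v mon \<Rightarrow> bool" where
  "drl_less s t \<longleftrightarrow> mdeg s < mdeg t \<or>
     (mdeg s = mdeg t \<and>
      (\<exists>v. lookup t v < lookup s v \<and> (\<forall>w<v. lookup s w = lookup t w)))"

definition drl_le :: "'v::linorder mon \<Rightarrow> 'v mon \<Rightarrow> bool" where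
  "drl_le s t \<longleftrightarrow> s = t \<or> drl_less s t"

text \<open>Leading monomial and leading coefficient; only meaningful for nonzero polynomials.\<close>

definition lm :: "('v::linorder, 'k::zero) mpoly \<Rightarrow> 'v mon" where
  "lm p = (THE t. t \<in> keys p \<and> (\<forall>s\<in>keys p. drl_le s t))"

definition lc :: "('v::linorder, 'k::zero) mpoly \<Rightarrow> 'k" where
  "lc p = lookup p (lm p)"

text \<open>Total degree, with the convention that the zero polynomial has degree 0.\<close>

definition pdeg :: "('v, 'k::zero) mpoly \<Rightarrow> nat" where
  "pdeg p = Max (insert 0 (mdeg ` keys p))"

definition homogeneous :: "nat \<Rightarrow> ('v, 'k::zero) mpoly \<Rightarrow> bool" where
  "homogeneous d p \<longleftrightarrow> (\<forall>t\<in>keys p. mdeg t = d)"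

definition ptop :: "('v, 'k::comm_monoid_add) mpoly \<Rightarrow> ('v, 'k) mpoly" where
  "ptop p = (\<Sum>t\<in>{t\<in>keys p. mdeg t = pdeg p}. single t (lookup p t))"

definition emb :: "'x mon \<Rightarrow> 'x option mon" where
  "emb t = (\<Sum>v\<in>keys t. single (Some v) (lookup t v))"

definition phom :: "('x, 'k::comm_monoid_add) mpoly \<Rightarrow> ('x option, 'k) mpoly" where
  "phom p = (\<Sum>t\<in>keys p.
     single (emb t + single None (pdeg p - mdeg t)) (lookup p t))"

text \<open>The specialization \<open>y = a\<close>; note that \<open>map_key Some\<close> forgets the exponent of \<open>y\<close>.\<close>

definition spec :: "'k::comm_semiring_1 \<Rightarrow> ('x option, 'k) mpoly \<Rightarrow> ('x, 'k) mpoly" where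
  "spec a p = (\<Sum>t\<in>keys p.
     single (Poly_Mapping.map_key Some t) (lookup p t * a ^ lookup t None))"

text \<open>\<open>lift d r\<close> is \<open>y ^ (d - deg r) * r\<^sup>h\<close>, used for \<open>deg r \<le> d\<close>; it maps 0 to 0.\<close>

definition lift :: "nat \<Rightarrow> ('x, 'k::comm_semiring_1) mpoly \<Rightarrow> ('x option, 'k) mpoly" where
  "lift d r = single (single None (d - pdeg r)) 1 * phom r"


section \<open>Hilbert series and cryptographic semi-regularity\<close>

definition ideal_gen :: "'a::comm_ring_1 set \<Rightarrow> 'a set" where
  "ideal_gen H = module.span (*) H"

text \<open>For an ideal generated by homogeneous polynomials; the infimum of the empty set is \<open>\<infinity>\<close>.\<close>

definition dreg :: "('v, 'k::comm_ring_1) mpoly set \<Rightarrow> enat" where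
  "dreg I = Inf (enat ` {d. \<forall>p. homogeneous d p \<longrightarrow> p \<in> I})"

definition kdim :: "('v, 'k::field) mpoly set \<Rightarrow> nat" where
  "kdim V = vector_space.dim (\<lambda>c p. single 0 c * p) V"

text \<open>
  The dimension of the degree \<open>d\<close> part of the quotient by \<open>I\<close> is the codimension of \<open>I\<^sub>d\<close> in the
  space of all homogeneous polynomials of degree \<open>d\<close>, which is finite-dimensional when there are
  finitely many variables.
\<close>

definition hilbert_series :: "('v::finite, 'k::field) mpoly set \<Rightarrow> rat fps" where
  "hilbert_series I =
     Abs_fps (\<lambda>d. of_nat
       (kdim {p :: ('v, 'k) mpoly. homogeneous d p} - kdim {p \<in> I. homogeneous d p}))"

text \<open>For a sequence of nonzero homogeneous polynomials.\<close>

definition d_regular :: "nat \<Rightarrow> ('v::finite, 'k::field) mpoly list \<Rightarrow> bool" where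
  "d_regular d hs \<longleftrightarrow>
     (\<forall>k<d. fps_nth (hilbert_series (ideal_gen (set hs))) k =
            fps_nth ((\<Prod>h\<leftarrow>hs. 1 - fps_X ^ pdeg h) / (1 - fps_X) ^ card (UNIV :: 'v set)) k)"

definition crypto_semiregular :: "('v::finite, 'k::field) mpoly list \<Rightarrow> bool" where
  "crypto_semiregular hs \<longleftrightarrow>
     (case dreg (ideal_gen (set hs)) of
        enat d \<Rightarrow> d_regular d hs
      | \<infinity> \<Rightarrow> (\<forall>d>0. d_regular d hs))"


section \<open>S-polynomials and reduction\<close>

definition spoly :: "('v::linorder, 'k::field) mpoly \<Rightarrow> ('v, 'k) mpoly \<Rightarrow> ('v, 'k) mpoly" where
  "spoly g1 g2 =
     single (mlcm (lm g1) (lm g2) - lm g1) (1 / lc g1) * g1 -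
     single (mlcm (lm g1) (lm g2) - lm g2) (1 / lc g2) * g2"

text \<open>\<open>g'\<close> arises from \<open>g\<close> by eliminating the term of \<open>g\<close> at the monomial \<open>t\<close> with \<open>h\<close>.\<close>

definition red_at ::
  "'v mon \<Rightarrow> ('v::linorder, 'k::field) mpoly \<Rightarrow> ('v, 'k) mpoly \<Rightarrow> ('v, 'k) mpoly \<Rightarrow> bool" where
  "red_at t h g g' \<longleftrightarrow>
     t \<in> keys g \<and> mdvd (lm h) t \<and>
     g' = g - single (t - lm h) (lookup g t / lc h) * h"

text \<open>Polynomials carry their sugar degree as second component.\<close>

definition sred ::
  "(('v::linorder, 'k::field) mpoly \<times> nat) list \<Rightarrow>
   ('v, 'k) mpoly \<times> nat \<Rightarrow> ('v, 'k) mpoly \<times> nat \<Rightarrow> bool" where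
  "sred B r r' \<longleftrightarrow>
     (\<exists>(h, s)\<in>set B. \<exists>t. red_at t h (fst r) (fst r') \<and>
        snd r' = max (snd r) (s + mdeg (t - lm h)))"


section \<open>Buchberger-like computations\<close>

text \<open>
  The elements of the current basis are distinguished by their positions and carry their sugar
  degrees.  An S-pair is a pair of positions \<open>i < j\<close>.  The set \<open>treated\<close> consists of the pairs
  that have been processed or discarded by the product criterion, so the pairs in neither
  \<open>avail\<close> nor \<open>treated\<close> are those discarded as redundant.
\<close>

datatype 'p state = State
  (basis: "('p \<times> nat) list") (avail: "(nat \<times> nat) set") (treated: "(nat \<times> nat) set")

definition init :: "('v, 'k::zero) mpoly list \<Rightarrow> ('v, 'k) mpoly state" where
  "init fs = State (map (\<lambda>f. (f, pdeg f)) fs) {(i, j). i < j \<and> j < length fs} {}"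

definition poly_at :: "'p state \<Rightarrow> nat \<Rightarrow> 'p" where
  "poly_at s i = fst (basis s ! i)"

definition sugar_at :: "'p state \<Rightarrow> nat \<Rightarrow> nat" where
  "sugar_at s i = snd (basis s ! i)"

definition pair_lcm :: "('v::linorder, 'k::zero) mpoly state \<Rightarrow> nat \<times> nat \<Rightarrow> 'v mon" where
  "pair_lcm s p = mlcm (lm (poly_at s (fst p))) (lm (poly_at s (snd p)))"

definition pair_deg :: "('v::linorder, 'k::zero) mpoly state \<Rightarrow> nat \<times> nat \<Rightarrow> nat" where
  "pair_deg s p = mdeg (pair_lcm s p)"

definition pair_sugar :: "('v::linorder, 'k::zero) mpoly state \<Rightarrow> nat \<times> nat \<Rightarrow> nat" where
  "pair_sugar s p =
     max (sugar_at s (fst p) + mdeg (pair_lcm s p - lm (poly_at s (fst p))))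
         (sugar_at s (snd p) + mdeg (pair_lcm s p - lm (poly_at s (snd p))))"

definition pair_spoly :: "('v::linorder, 'k::field) mpoly state \<Rightarrow> nat \<times> nat \<Rightarrow> ('v, 'k) mpoly"
  where "pair_spoly s p = spoly (poly_at s (fst p)) (poly_at s (snd p))"

definition pair_coprime :: "('v::linorder, 'k::zero) mpoly state \<Rightarrow> nat \<times> nat \<Rightarrow> bool" where
  "pair_coprime s p \<longleftrightarrow> mcoprime (lm (poly_at s (fst p))) (lm (poly_at s (snd p)))"

text \<open>
  A pair \<open>(i, j)\<close> is redundant if \<open>i\<close> and \<open>j\<close> are joined by a chain of other pairs, none of them
  itself discarded as redundant, through positions \<open>k\<close> whose leading monomials divide the lcm of
  the pair.  This says exactly that the S-syzygy of \<open>(i, j)\<close> between the leading terms is a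
  combination of the S-syzygies of those other pairs, i.e. it is the most general sound criterion
  of chain type that only looks at leading monomials; Buchberger's chain criterion and the
  Gebauer-Moeller criteria are instances.
\<close>

definition joined :: "(nat \<times> nat) set \<Rightarrow> (nat \<Rightarrow> bool) \<Rightarrow> nat \<Rightarrow> nat \<Rightarrow> bool" where
  "joined E V = (\<lambda>k l. ((k, l) \<in> E \<or> (l, k) \<in> E) \<and> V k \<and> V l)\<^sup>*\<^sup>*"

definition lm_redundant :: "('v::linorder, 'k::zero) mpoly state \<Rightarrow> nat \<times> nat \<Rightarrow> bool" where
  "lm_redundant s p \<longleftrightarrow>
     joined (avail s \<union> treated s - {p})
       (\<lambda>k. mdvd (lm (poly_at s k)) (pair_lcm s p)) (fst p) (snd p)"

text \<open>
  The same criterion for the leading monomials of the homogeneous lifts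
  \<open>y ^ (sugar - deg g) * g\<^sup>h\<close>: the extra condition is divisibility in the exponent of \<open>y\<close>.
  It is vacuous as long as all sugar degrees are total degrees.  Without it, a pair of sugar
  degree \<open>d\<close> could be discarded in favour of pairs that are treated only after sugar degree \<open>d\<close>.
\<close>

definition lift_redundant :: "('v::linorder, 'k::zero) mpoly state \<Rightarrow> nat \<times> nat \<Rightarrow> bool" where
  "lift_redundant s p \<longleftrightarrow>
     joined (avail s \<union> treated s - {p})
       (\<lambda>k. mdvd (lm (poly_at s k)) (pair_lcm s p) \<and>
            sugar_at s k + mdeg (pair_lcm s p - lm (poly_at s k)) \<le> pair_sugar s p)
       (fst p) (snd p)"

text \<open>
  \<open>Process p rs\<close>: the pair \<open>p\<close> is selected and its S-polynomial is reduced along the sequence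
  \<open>rs\<close>, which starts with the S-polynomial; the entries carry their sugar degrees.
\<close>

datatype 'p event =
    Discard "nat \<times> nat"
  | Process "nat \<times> nat" "('p \<times> nat) list"

definition discarded ::
  "(('v::linorder, 'k::zero) mpoly state \<Rightarrow> nat \<times> nat \<Rightarrow> bool) \<Rightarrow>
   ('v, 'k) mpoly state \<Rightarrow> nat \<times> nat \<Rightarrow> ('v, 'k) mpoly state \<Rightarrow> bool" where
  "discarded redundant s p s' \<longleftrightarrow>
     p \<in> avail s \<and>
     (if pair_coprime s p
      then s' = State (basis s) (avail s - {p}) (insert p (treated s))
      else redundant s p \<and> s' = State (basis s) (avail s - {p}) (treated s))"

text \<open>The pair \<open>p\<close> has been processed, and the nonzero entries of \<open>qs\<close> enter the basis.\<close>

definition insert_results ::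
  "'p::zero state \<Rightarrow> nat \<times> nat \<Rightarrow> ('p \<times> nat) list \<Rightarrow> 'p state" where
  "insert_results s p qs =
     (let B = basis s; B' = B @ filter (\<lambda>q. fst q \<noteq> 0) qs in
      State B' (avail s - {p} \<union> {(k, l). k < l \<and> length B \<le> l \<and> l < length B'})
        (insert p (treated s)))"

definition normal_selectable ::
  "('v::linorder, 'k::zero) mpoly state \<Rightarrow> nat \<times> nat \<Rightarrow> bool" where
  "normal_selectable s p \<longleftrightarrow>
     p \<in> avail s \<and> \<not> pair_coprime s p \<and> (\<forall>q\<in>avail s. drl_le (pair_lcm s p) (pair_lcm s q))"

definition sugar_selectable ::
  "('v::linorder, 'k::zero) mpoly state \<Rightarrow> nat \<times> nat \<Rightarrow> bool" where
  "sugar_selectable s p \<longleftrightarrow>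
     p \<in> avail s \<and> \<not> pair_coprime s p \<and>
     (\<forall>q\<in>avail s. pair_sugar s p < pair_sugar s q \<or>
        pair_sugar s p = pair_sugar s q \<and> drl_le (pair_lcm s p) (pair_lcm s q))"

definition reduction_seq ::
  "('v::linorder, 'k::field) mpoly state \<Rightarrow> nat \<times> nat \<Rightarrow> (('v, 'k) mpoly \<times> nat) list \<Rightarrow> bool"
  where
  "reduction_seq s p rs \<longleftrightarrow>
     rs \<noteq> [] \<and> hd rs = (pair_spoly s p, pair_sugar s p) \<and> successively (sred (basis s)) rs"

definition irreducible_by ::
  "('v::linorder, 'k::field) mpoly state \<Rightarrow> ('v, 'k) mpoly \<times> nat \<Rightarrow> bool" where
  "irreducible_by s r \<longleftrightarrow> (\<nexists>r'. sred (basis s) r r')"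

text \<open>
  Sugar degrees never decrease along a reduction sequence \<open>r\<^sub>0, \<dots>, r\<^sub>l\<close>, so this is its part
  \<open>r\<^sub>0, \<dots>, r\<^sub>k\<close> preserving the sugar degree.
\<close>

definition sugar_part :: "('p \<times> nat) list \<Rightarrow> ('p \<times> nat) list" where
  "sugar_part rs = takeWhile (\<lambda>r. snd r = snd (hd rs)) rs"

text \<open>Sugar-preserving reducers are exhausted before the sugar degree is allowed to change.\<close>

definition sugar_exhausted ::
  "('v::linorder, 'k::field) mpoly state \<Rightarrow> (('v, 'k) mpoly \<times> nat) list \<Rightarrow> bool" where
  "sugar_exhausted s rs \<longleftrightarrow>
     (\<nexists>r'. sred (basis s) (last (sugar_part rs)) r' \<and> snd r' = snd (last (sugar_part rs)))"

fun normal_step ::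
  "('v::linorder, 'k::field) mpoly state \<Rightarrow> ('v, 'k) mpoly event \<Rightarrow>
   ('v, 'k) mpoly state \<Rightarrow> bool" where
  "normal_step s (Discard p) s' \<longleftrightarrow> discarded lm_redundant s p s'"
| "normal_step s (Process p rs) s' \<longleftrightarrow>
     normal_selectable s p \<and> reduction_seq s p rs \<and> irreducible_by s (last rs) \<and>
     s' = insert_results s p [last rs]"

text \<open>
  Sugar strategy while the pairs of the critical sugar degree are processed.  The reduction may
  stop at the end of the sugar-preserving part.
\<close>

fun sugar_step ::
  "('v::linorder, 'k::field) mpoly state \<Rightarrow> ('v, 'k) mpoly event \<Rightarrow>
   ('v, 'k) mpoly state \<Rightarrow> bool" where
  "sugar_step s (Discard p) s' \<longleftrightarrow> discarded lift_redundant s p s'"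
| "sugar_step s (Process p rs) s' \<longleftrightarrow>
     sugar_selectable s p \<and> reduction_seq s p rs \<and> sugar_exhausted s rs \<and>
     (irreducible_by s (last rs) \<or> sugar_part rs = rs) \<and>
     s' = insert_results s p (remdups [last (sugar_part rs), last rs])"

text \<open>Sugar strategy afterwards, when only final remainders are inserted.\<close>

fun late_sugar_step ::
  "('v::linorder, 'k::field) mpoly state \<Rightarrow> ('v, 'k) mpoly event \<Rightarrow>
   ('v, 'k) mpoly state \<Rightarrow> bool" where
  "late_sugar_step s (Discard p) s' \<longleftrightarrow> discarded lm_redundant s p s'"
| "late_sugar_step s (Process p rs) s' \<longleftrightarrow>
     sugar_selectable s p \<and> reduction_seq s p rs \<and> sugar_exhausted s rs \<and>
     irreducible_by s (last rs) \<and>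
     s' = insert_results s p [last rs]"

text \<open>The trace of a computation lists the events together with the states they occurred in.\<close>

inductive run :: "('s \<Rightarrow> 'e \<Rightarrow> 's \<Rightarrow> bool) \<Rightarrow> 's \<Rightarrow> ('s \<times> 'e) list \<Rightarrow> 's \<Rightarrow> bool"
  for step where
  run_Nil: "run step s [] s"
| run_Cons: "step s e s' \<Longrightarrow> run step s' tr s'' \<Longrightarrow> run step s ((s, e) # tr) s''"

definition processed :: "('p state \<times> 'p event) list \<Rightarrow> ('p state \<times> (nat \<times> nat)) set" where
  "processed tr = {(s, p). \<exists>rs. (s, Process p rs) \<in> set tr}"


section \<open>Correspondence of the three computations\<close>

definition corresponding_states ::
  "('x::linorder, 'k::field) mpoly state \<Rightarrow> ('x option, 'k) mpoly state \<Rightarrow>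
   ('x, 'k) mpoly state \<Rightarrow> bool" where
  "corresponding_states st sh sa \<longleftrightarrow>
     map fst (basis st) = map (spec 0 \<circ> fst) (basis sh) \<and>
     map fst (basis sa) = map (spec 1 \<circ> fst) (basis sh) \<and>
     map (emb \<circ> lm \<circ> fst) (basis st) = map (lm \<circ> fst) (basis sh) \<and>
     map (emb \<circ> lm \<circ> fst) (basis sa) = map (lm \<circ> fst) (basis sh) \<and>
     avail st = avail sh \<and> avail sa = avail sh \<and>
     treated st = treated sh \<and> treated sa = treated sh"

text \<open>
  A genuine reduction step changes the polynomial, so the adjacent duplicates in the
  specialization at \<open>y = 0\<close> are precisely the steps that specialize to the identity.
\<close>

fun corresponding_events ::
  "('x, 'k::field) mpoly event \<Rightarrow> ('x option, 'k) mpoly event \<Rightarrow> ('x, 'k) mpoly event \<Rightarrow> bool"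
  where
  "corresponding_events (Discard p) (Discard q) (Discard r) \<longleftrightarrow> p = q \<and> r = q"
| "corresponding_events (Process p rt) (Process q rh) (Process r ra) \<longleftrightarrow>
     p = q \<and> r = q \<and>
     map fst rt = remdups_adj (map (spec 0 \<circ> fst) rh) \<and>
     map fst ra = map (spec 1 \<circ> fst) rh"
| "corresponding_events _ _ _ \<longleftrightarrow> False"

definition below ::
  "enat \<Rightarrow> ('v::linorder, 'k::zero) mpoly state \<Rightarrow> ('v, 'k) mpoly event \<Rightarrow> bool" where
  "below D s e \<longleftrightarrow> (case e of Discard p \<Rightarrow> True | Process p rs \<Rightarrow> enat (pair_deg s p) < D)"

text \<open>
  Corresponding moves of the computations for \<open>F\<^sup>t\<^sup>o\<^sup>p\<close>, \<open>F\<^sup>h\<close>, and \<open>F\<close> at a step degree below \<open>D\<close>.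
\<close>

definition joint_move ::
  "enat \<Rightarrow>
   ('x::linorder, 'k::field) mpoly state \<times> ('x option, 'k) mpoly state \<times> ('x, 'k) mpoly state \<Rightarrow>
   ('x, 'k) mpoly event \<times> ('x option, 'k) mpoly event \<times> ('x, 'k) mpoly event \<Rightarrow>
   ('x, 'k) mpoly state \<times> ('x option, 'k) mpoly state \<times> ('x, 'k) mpoly state \<Rightarrow> bool" where
  "joint_move D = (\<lambda>(st, sh, sa) (et, eh, ea) (st', sh', sa').
     normal_step st et st' \<and> normal_step sh eh sh' \<and> normal_step sa ea sa' \<and>
     below D st et \<and> below D sh eh \<and> below D sa ea \<and>
     corresponding_events et eh ea)"

definition jointly_reachable ::
  "enat \<Rightarrow> ('x::linorder, 'k::field) mpoly list \<Rightarrow>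
   ('x, 'k) mpoly state \<times> ('x option, 'k) mpoly state \<times> ('x, 'k) mpoly state \<Rightarrow> bool" where
  "jointly_reachable D fs =
     (\<lambda>s s'. \<exists>e. joint_move D s e s')\<^sup>*\<^sup>* (init (map ptop fs), init (map phom fs), init fs)"

definition degree_fall :: "('v::linorder, 'k::zero) mpoly state \<Rightarrow> ('v, 'k) mpoly event \<Rightarrow> bool"
  where
  "degree_fall s e \<longleftrightarrow>
     (case e of Discard p \<Rightarrow> False
      | Process p rs \<Rightarrow> fst (last rs) \<noteq> 0 \<and> pdeg (fst (last rs)) < pair_deg s p)"


section \<open>Inter-reduction and solving degrees\<close>

definition interreduce_step ::
  "('v::linorder, 'k::field) mpoly list \<Rightarrow> ('v, 'k) mpoly list \<Rightarrow> bool" where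
  "interreduce_step gs hs \<longleftrightarrow>
     (\<exists>i<length gs. \<exists>j<length gs. \<exists>t g. i \<noteq> j \<and> red_at t (gs ! j) (gs ! i) g \<and>
        hs = (if g = 0 then take i gs @ drop (Suc i) gs else gs[i := g]))"

definition interreduction ::
  "('v::linorder, 'k::field) mpoly list \<Rightarrow> ('v, 'k) mpoly list \<Rightarrow> bool" where
  "interreduction gs hs \<longleftrightarrow>
     interreduce_step\<^sup>*\<^sup>* gs hs \<and> (\<nexists>hs'. interreduce_step hs hs')"

text \<open>
  Which pairs of the inter-reduced polynomials are regarded as available, and which sugar degrees
  are recorded for them, is left open.
\<close>

definition continues_with :: "'p list \<Rightarrow> 'p state \<Rightarrow> bool" where
  "continues_with hs s \<longleftrightarrow>
     map fst (basis s) = hs \<and> avail s \<subseteq> {(i, j). i < j \<and> j < length hs}"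

definition alg_solving_degree ::
  "('v::linorder, 'k::zero) mpoly list \<Rightarrow>
   (('v, 'k) mpoly state \<times> ('v, 'k) mpoly event) list \<Rightarrow> nat" where
  "alg_solving_degree fs tr =
     Max (insert 0 (pdeg ` set fs \<union> (\<lambda>(s, p). pair_deg s p) ` processed tr))"

definition strict_solving_degree ::
  "(('v::linorder, 'k::field) mpoly state \<times> ('v, 'k) mpoly event) list \<Rightarrow> nat" where
  "strict_solving_degree tr =
     Max (insert 0 {pdeg (pair_spoly s p) | s p. (s, p) \<in> processed tr \<and> pair_spoly s p \<noteq> 0})"

end

theory Submission
  imports Defs
begin

text \<open>
  Throughout, \<open>F\<^sup>t\<^sup>o\<^sup>p\<close> and \<open>F\<^sup>h\<close> are the top parts and the homogenizations of the polynomials \<open>F\<close>, and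
  \<open>D\<close> is the degree of regularity of \<open>F\<^sup>t\<^sup>o\<^sup>p\<close>.  The theorem rests on one algebraic fact: below degree
  \<open>D\<close> the variable \<open>y\<close> is a nonzerodivisor modulo \<open>\<langle>F\<^sup>h\<rangle>\<close> (lemma \<open>y_nonzerodivisor\<close>).

  The Hilbert series of a semi-regular sequence agrees with the Koszul series below degree \<open>D\<close>.
  When a form \<open>h\<close> of degree \<open>e\<close> is added to the generators of an ideal \<open>I\<close>, the coefficient of the
  Hilbert series at degree \<open>k\<close> is at least the one predicted by the factor \<open>1 - z\<^sup>e\<close>, with equality
  only if multiplication by \<open>h\<close> is injective on the quotient by \<open>I\<close> into degree \<open>k\<close>.  As all degrees
  are positive, an excess cannot be compensated by later generators, so equality of the series
  makes every form of \<open>F\<^sup>t\<^sup>o\<^sup>p\<close> regular modulo the preceding ones in degrees below \<open>D\<close> (lemma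
  \<open>d_regular_mult_injective\<close>).  A relation \<open>y g \<in> \<langle>F\<^sup>h\<rangle>\<close> becomes a syzygy of \<open>F\<^sup>t\<^sup>o\<^sup>p\<close> at \<open>y = 0\<close>, and
  since this syzygy is trivial, \<open>y\<close> can be cancelled.

  In the computation for \<open>F\<^sup>h\<close> with the normal strategy, the current basis is a Groebner basis in all
  degrees below the current step degree \<open>e\<close> (lemma \<open>truncated_groebner_basis\<close>).  If \<open>e < D\<close> and the
  leading monomial of a nonzero remainder contained \<open>y\<close>, the remainder would be \<open>y g\<close> with
  \<open>g \<in> \<langle>F\<^sup>h\<rangle>\<close> of degree \<open>e - 1\<close>; the leading monomial of \<open>g\<close>, and with it that of \<open>y g\<close>, would be
  reducible (lemma \<open>remainder_y_free\<close>).  So all leading monomials avoid \<open>y\<close> and survive both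
  specializations, and the three computations are images of each other: a reduction step in one
  is a step in the others, except that steps at monomials containing \<open>y\<close> disappear at \<open>y = 0\<close>.

  At sugar degree \<open>D\<close>, sugar-preserving affine reductions are exactly the reductions of the lifts
  \<open>y ^ (D - deg r) * r\<^sup>h\<close>.  The homogeneous computation follows the affine one (definition \<open>tracks\<close>) because
  only pairs of elements found before sugar degree \<open>D\<close> can have sugar degree \<open>D\<close>: a new element is
  not reducible by the earlier ones without raising the sugar degree.  At the end of sugar degree \<open>D\<close> the
  lifts form a Groebner basis of \<open>\<langle>F\<^sup>h\<rangle>\<close> up to degree \<open>D\<close>.  Every monomial of degree \<open>D\<close> lies in
  \<open>\<langle>F\<^sup>t\<^sup>o\<^sup>p\<rangle>\<close> and hence is the leading monomial of an element of \<open>\<langle>F\<^sup>h\<rangle>\<close>, so it is divisible by an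
  affine leading monomial.

  From then on remainders have degree below \<open>D\<close>, and two leading monomials of degree at most \<open>D\<close> that
  share a variable have an lcm of degree at most \<open>2 D - 1\<close>.  After inter-reduction an element of
  degree \<open>D\<close> has only one term of that degree, so that S-polynomials have degree at most
  \<open>2 D - 2\<close>.
\<close>

section \<open>Monomials and the degree reverse lexicographic ordering\<close>

lemma mdeg_UNIV: "mdeg (t :: 'v::finite mon) = (\<Sum>v\<in>UNIV. lookup t v)"
  unfolding mdeg_def by (rule sum.mono_neutral_left) (auto simp: in_keys_iff)

lemma mdeg_add [simp]: "mdeg (s + t :: 'v::finite mon) = mdeg s + mdeg t"
  by (simp add: mdeg_UNIV lookup_add sum.distrib)

lemma mdeg_zero [simp]: "mdeg 0 = 0"
  by (simp add: mdeg_def)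

lemma mdeg_single [simp]: "mdeg (single v n) = n"
  by (simp add: mdeg_def)

lemma mdeg_eq_0_iff: "mdeg (t :: 'v::finite mon) = 0 \<longleftrightarrow> t = 0"
  by (auto simp: mdeg_UNIV intro!: poly_mapping_eqI)

lemma mdvd_refl [simp]: "mdvd t t"
  by (simp add: mdvd_def)

lemma mdvd_trans: "mdvd s t \<Longrightarrow> mdvd t u \<Longrightarrow> mdvd s u"
  unfolding mdvd_def by (meson le_trans)

lemma mdvd_add [simp]: "mdvd s (s + t)" "mdvd s (t + s)"
  by (simp_all add: mdvd_def lookup_add)

lemma mdvd_minus_add: "mdvd s t \<Longrightarrow> (t - s) + s = t"
  unfolding mdvd_def by (intro poly_mapping_eqI) (simp add: lookup_add lookup_minus)

lemma mdvdE: assumes "mdvd s t" obtains u where "t = u + s"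
  using mdvd_minus_add[OF assms] by metis

lemma add_minus_mon [simp]: "(u + s) - s = (u :: 'v mon)"
  by (intro poly_mapping_eqI) (simp add: lookup_add lookup_minus)

lemma mdeg_minus: "mdvd s t \<Longrightarrow> mdeg (t - s :: 'v::finite mon) = mdeg t - mdeg s"
  by (metis add_diff_cancel_right' mdeg_add mdvd_minus_add)

lemma mdvd_mdeg: "mdvd s t \<Longrightarrow> mdeg (s :: 'v::finite mon) \<le> mdeg t"
  by (metis le_add2 mdeg_add mdvd_minus_add)

lemma mdvd_mdeg_eq: "mdvd s t \<Longrightarrow> mdeg t \<le> mdeg s \<Longrightarrow> (s :: 'v::finite mon) = t"
  by (metis add.left_neutral diff_is_0_eq mdeg_eq_0_iff mdeg_minus mdvd_minus_add)

lemma lookup_mlcm [simp]: "lookup (mlcm s t) v = max (lookup s v) (lookup t v)"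
  by transfer simp

lemma mdvd_mlcm [simp]: "mdvd s (mlcm s t)" "mdvd t (mlcm s t)"
  by (simp_all add: mdvd_def)

lemma mlcm_mdvd_iff: "mdvd (mlcm s t) u \<longleftrightarrow> mdvd s u \<and> mdvd t u"
  by (auto simp: mdvd_def)

lemma mcoprime_mlcm: assumes "mcoprime s t" shows "mlcm s t = s + t"
proof (rule poly_mapping_eqI)
  fix v
  have "lookup s v = 0 \<or> lookup t v = 0" using assms by (simp add: mcoprime_def)
  then show "lookup (mlcm s t) v = lookup (s + t) v" by (auto simp: lookup_add)
qed

text \<open>
  The source of the bounds \<open>2 D - 1\<close> and \<open>2 D - 2\<close>: a shared variable is counted twice in the
  product.
\<close>

lemma mdeg_mlcm_not_coprime:
  assumes "\<not> mcoprime s (t :: 'v::finite mon)"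
  shows "mdeg (mlcm s t) + 1 \<le> mdeg s + mdeg t"
proof -
  from assms obtain v where v: "lookup s v \<noteq> 0" "lookup t v \<noteq> 0" by (auto simp: mcoprime_def)
  have "mdvd (mlcm s t + single v 1) (s + t)"
    using v by (auto simp: mdvd_def lookup_add lookup_single when_def)
  from mdvd_mdeg[OF this] show ?thesis by simp
qed

lemma drl_less_irrefl [simp]: "\<not> drl_less t t"
  by (simp add: drl_less_def)

lemma drl_less_trans:
  assumes "drl_less s t" "drl_less t u" shows "drl_less s u"
proof (cases "mdeg s = mdeg t \<and> mdeg t = mdeg u")
  case False
  with assms show ?thesis by (auto simp: drl_less_def)
next
  case True
  with assms obtain v w where v: "lookup t v < lookup s v" "\<forall>x<v. lookup s x = lookup t x"
    and w: "lookup u w < lookup t w" "\<forall>x<w. lookup t x = lookup u x"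
    by (auto simp: drl_less_def)
  have "lookup u (min v w) < lookup s (min v w) \<and> (\<forall>x<min v w. lookup s x = lookup u x)"
    using v w by (cases v w rule: linorder_cases) auto
  with True show ?thesis by (auto simp: drl_less_def)
qed

lemma drl_less_linear: "drl_less s t \<or> s = t \<or> drl_less t (s :: 'v::{finite,linorder} mon)"
proof (cases "mdeg s = mdeg t \<and> s \<noteq> t")
  case False
  then show ?thesis by (auto simp: drl_less_def)
next
  case True
  define V where "V = {v. lookup s v \<noteq> lookup t v}"
  have "V \<noteq> {}" using True by (auto simp: V_def intro: poly_mapping_eqI)
  then have "Min V \<in> V" by (intro Min_in) simp_all
  moreover have "\<forall>x<Min V. x \<notin> V" using Min_le[of V] by (meson finite leD)
  moreover have "v \<in> V \<longleftrightarrow> lookup s v \<noteq> lookup t v" for v by (simp add: V_def)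
  ultimately have "lookup s (Min V) \<noteq> lookup t (Min V) \<and> (\<forall>x<Min V. lookup s x = lookup t x)"
    by blast
  then show ?thesis using True unfolding drl_less_def by (metis linorder_neqE_nat)
qed

lemma drl_less_asym: "drl_less s t \<Longrightarrow> \<not> drl_less t s"
  using drl_less_trans drl_less_irrefl by blast

lemma drl_le_refl [simp]: "drl_le t t"
  by (simp add: drl_le_def)

lemma drl_le_trans: "drl_le s t \<Longrightarrow> drl_le t u \<Longrightarrow> drl_le s u"
  unfolding drl_le_def using drl_less_trans by blast

lemma drl_le_less_trans: "drl_le s t \<Longrightarrow> drl_less t u \<Longrightarrow> drl_less s u"
  unfolding drl_le_def using drl_less_trans by blast

lemma drl_less_le_trans: "drl_less s t \<Longrightarrow> drl_le t u \<Longrightarrow> drl_less s u"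
  unfolding drl_le_def using drl_less_trans by blast

lemma drl_le_antisym: "drl_le s t \<Longrightarrow> drl_le t s \<Longrightarrow> s = t"
  unfolding drl_le_def using drl_less_asym by blast

lemma not_drl_less: "\<not> drl_less s t \<longleftrightarrow> drl_le t (s :: 'v::{finite,linorder} mon)"
  unfolding drl_le_def using drl_less_linear drl_less_asym by blast

lemma drl_less_add_iff [simp]:
  "drl_less (u + s) (u + t) \<longleftrightarrow> drl_less s (t :: 'v::{finite,linorder} mon)"
  by (simp add: drl_less_def lookup_add)

lemma drl_le_add_iff [simp]:
  "drl_le (u + s) (u + t) \<longleftrightarrow> drl_le s (t :: 'v::{finite,linorder} mon)"
  by (simp add: drl_le_def)

lemma drl_le_mdeg: "drl_le s t \<Longrightarrow> mdeg s \<le> mdeg t"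
  by (auto simp: drl_le_def drl_less_def)

lemma drl_less_mdeg: "drl_less s t \<Longrightarrow> mdeg s \<le> mdeg t"
  by (auto simp: drl_less_def)

lemma finite_mdeg_le: "finite {t :: 'v::finite mon. mdeg t \<le> n}"
proof -
  have "finite {f :: 'v \<Rightarrow> nat. \<forall>x. (x \<in> UNIV \<longrightarrow> f x \<in> {..n}) \<and> (x \<notin> UNIV \<longrightarrow> f x = 0)}"
    by (rule finite_set_of_finite_funs) simp_all
  then have "finite {f :: 'v \<Rightarrow> nat. \<forall>x. f x \<in> {..n}}" by (simp only: UNIV_I simp_thms)
  moreover have "lookup ` {t :: 'v mon. mdeg t \<le> n} \<subseteq> {f. \<forall>x. f x \<in> {..n}}"
  proof (clarsimp)
    fix t :: "'v mon" and x assume *: "mdeg t \<le> n"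
    have "lookup t x \<le> mdeg t" unfolding mdeg_UNIV by (rule member_le_sum) auto
    with * show "lookup t x \<le> n" by simp
  qed
  ultimately have "finite (lookup ` {t :: 'v mon. mdeg t \<le> n})" by (rule rev_finite_subset)
  then show ?thesis by (rule finite_imageD) (auto intro!: inj_onI poly_mapping_eqI)
qed

text \<open>
  A monomial in finitely many variables has finitely many predecessors; their number makes the
  ordering well-founded and serves as a bit position in a termination measure.
\<close>

definition drl_rank :: "'v::linorder mon \<Rightarrow> nat" where
  "drl_rank t = card {s. drl_less s t}"

lemma finite_drl_less: "finite {s. drl_less s (t :: 'v::{finite,linorder} mon)}"
  by (rule finite_subset[OF _ finite_mdeg_le[of "mdeg t"]]) (auto dest: drl_less_mdeg)

lemma drl_rank_less:
  assumes "drl_less s t" shows "drl_rank s < drl_rank (t :: 'v::{finite,linorder} mon)"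
  unfolding drl_rank_def
proof (rule psubset_card_mono[OF finite_drl_less], rule psubsetI)
  show "{u. drl_less u s} \<subseteq> {u. drl_less u t}" using drl_less_trans[OF _ assms] by blast
  have "s \<in> {u. drl_less u t} - {u. drl_less u s}" using assms by simp
  then show "{u. drl_less u s} \<noteq> {u. drl_less u t}" by blast
qed

lemma drl_rank_eq_iff: "drl_rank s = drl_rank t \<longleftrightarrow> s = (t :: 'v::{finite,linorder} mon)"
  by (metis drl_less_linear drl_rank_less less_irrefl)

lemma drl_induct [case_names less]:
  fixes t :: "'v::{finite,linorder} mon"
  assumes "\<And>t. (\<And>s. drl_less s t \<Longrightarrow> P s) \<Longrightarrow> P t" shows "P t"
  by (induction t rule: measure_induct_rule[of drl_rank]) (auto intro: assms drl_rank_less)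

lemma drl_max_exists:
  fixes A :: "'v::{finite,linorder} mon set"
  assumes "finite A" "A \<noteq> {}" shows "\<exists>t\<in>A. \<forall>s\<in>A. drl_le s t"
  using assms
proof (induction rule: finite_ne_induct)
  case (insert x F)
  then obtain t where "t \<in> F" "\<forall>s\<in>F. drl_le s t" by blast
  then show ?case using drl_less_linear[of x t] unfolding drl_le_def
    by (metis drl_less_trans insert_iff)
qed auto


section \<open>Leading monomials, degrees and S-polynomials\<close>

lemma keys_ne_0 [simp]: "keys p \<noteq> {} \<longleftrightarrow> p \<noteq> 0"
  by (metis keys_zero lookup_zero not_in_keys_iff_lookup_eq_zero poly_mapping_eqI empty_iff)

lemma lm_eqI:
  fixes p :: "('v::linorder, 'k::zero) mpoly"
  assumes "t \<in> keys p" "\<And>s. s \<in> keys p \<Longrightarrow> drl_le s t" shows "lm p = t"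
  unfolding lm_def using assms drl_le_antisym by (intro the_equality) blast+

lemma lm_props:
  fixes p :: "('v::{finite,linorder}, 'k::zero) mpoly"
  assumes "p \<noteq> 0"
  shows lm_in_keys: "lm p \<in> keys p" and lm_max: "s \<in> keys p \<Longrightarrow> drl_le s (lm p)"
proof -
  obtain t where "t \<in> keys p" "\<forall>s\<in>keys p. drl_le s t"
    using drl_max_exists[of "keys p"] assms by auto
  then have "lm p = t" by (intro lm_eqI) auto
  with \<open>t \<in> keys p\<close> \<open>\<forall>s\<in>keys p. drl_le s t\<close>
  show "lm p \<in> keys p" "s \<in> keys p \<Longrightarrow> drl_le s (lm p)" by auto
qed

lemma lc_ne_0: "p \<noteq> 0 \<Longrightarrow> lc (p :: ('v::{finite,linorder}, 'k::zero) mpoly) \<noteq> 0"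
  using lm_in_keys[of p] by (simp add: lc_def in_keys_iff)

lemma lookup_monom_mult:
  fixes p :: "('v, 'k::semiring_1) mpoly"
  shows "lookup (single m c * p) t = (if mdvd m t then c * lookup p (t - m) else 0)"
proof -
  have eq: "t = m + q \<longleftrightarrow> mdvd m t \<and> q = t - m" for q
    by (metis add.commute add_minus_mon mdvd_add(1) mdvd_minus_add)
  have "lookup (single m c * p) t
      = (\<Sum>l. (c * (\<Sum>q. lookup p q when t = l + q)) when m = l)"
    by (simp add: lookup_mult lookup_single when_mult)
  also have "\<dots> = c * (\<Sum>q. lookup p q when t = m + q)" by simp
  also have "(\<Sum>q. lookup p q when t = m + q) = (if mdvd m t then lookup p (t - m) else 0)"
    unfolding eq by auto
  finally show ?thesis by simp
qed

lemma lookup_monom_mult_add [simp]: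
  "lookup (single m c * p) (m + t) = c * lookup (p :: ('v, 'k::semiring_1) mpoly) t"
  using add_minus_mon[of t m] by (simp add: lookup_monom_mult add.commute)

lemma keys_monom_mult:
  assumes "t \<in> keys (single m c * (p :: ('v, 'k::semiring_1) mpoly))"
  obtains s where "t = m + s" "s \<in> keys p"
  using assms
  by (auto simp: in_keys_iff lookup_monom_mult split: if_splits)
    (metis add.commute mdvd_minus_add mult_zero_right)

lemma pdeg_ge: "t \<in> keys p \<Longrightarrow> mdeg t \<le> pdeg p"
  by (simp add: pdeg_def)

lemma pdeg_le_iff: "pdeg p \<le> d \<longleftrightarrow> (\<forall>t\<in>keys p. mdeg t \<le> d)"
  by (simp add: pdeg_def)

lemma pdeg_lm: "p \<noteq> 0 \<Longrightarrow> pdeg (p :: ('v::{finite,linorder}, 'k::zero) mpoly) = mdeg (lm p)"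
  by (intro antisym) (auto simp: pdeg_le_iff lm_max drl_le_mdeg pdeg_ge lm_in_keys)

lemma homogeneous_pdeg: assumes "homogeneous d p" "p \<noteq> 0" shows "pdeg p = d"
proof -
  obtain t where "t \<in> keys p" using assms(2) keys_ne_0[of p] by blast
  then show ?thesis using assms(1) pdeg_ge[of t p]
    by (intro antisym) (auto simp: pdeg_le_iff homogeneous_def)
qed

lemma homogeneous_mdeg_lm:
  "homogeneous d p \<Longrightarrow> p \<noteq> 0 \<Longrightarrow> mdeg (lm (p :: ('v::{finite,linorder}, 'k::zero) mpoly)) = d"
  using homogeneous_pdeg pdeg_lm by metis

lemma homogeneous_0 [simp]: "homogeneous d 0"
  by (simp add: homogeneous_def)

lemma homogeneous_add: "homogeneous d p \<Longrightarrow> homogeneous d q \<Longrightarrow> homogeneous d (p + q)"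
  unfolding homogeneous_def using keys_add[of p q] by blast

lemma keys_minus_subset: "keys (p - q) \<subseteq> keys p \<union> keys (q :: 'a \<Rightarrow>\<^sub>0 'b::ab_group_add)"
  by (auto simp: in_keys_iff lookup_minus)

lemma homogeneous_minus:
  "homogeneous d p \<Longrightarrow> homogeneous d q \<Longrightarrow> homogeneous d (p - q :: ('v, 'k::ab_group_add) mpoly)"
  unfolding homogeneous_def using keys_minus_subset[of p q] by blast

lemma homogeneous_mult:
  "homogeneous c p \<Longrightarrow> homogeneous d q \<Longrightarrow>
    homogeneous (c + d) (p * q :: ('v::finite, 'k::semiring_1) mpoly)"
  unfolding homogeneous_def using keys_mult[of p q] by fastforce

lemma homogeneous_single: "homogeneous (mdeg t) (single t c)"
  by (auto simp: homogeneous_def split: if_splits)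

lemma homogeneous_monom_mult:
  assumes "homogeneous d (p :: ('v::finite, 'k::semiring_1) mpoly)" "mdeg m + d = e"
  shows "homogeneous e (single m c * p)"
  using assms by (auto simp: homogeneous_def elim!: keys_monom_mult)

lemma poly_as_sum: "p = (\<Sum>t\<in>keys p. single t (lookup p t))"
  by (intro poly_mapping_eqI) (auto simp: lookup_sum lookup_single when_def in_keys_iff)

text \<open>
  Both multiples have the coefficient 1 at the lcm, so only non-leading terms contribute.
\<close>

lemma keys_spoly:
  fixes g1 :: "('v::{finite,linorder}, 'k::field) mpoly"
  assumes "g1 \<noteq> 0" "g2 \<noteq> 0" "t \<in> keys (spoly g1 g2)"
  obtains s where "s \<in> keys g1 - {lm g1}" "t = (mlcm (lm g1) (lm g2) - lm g1) + s"
  | s where "s \<in> keys g2 - {lm g2}" "t = (mlcm (lm g1) (lm g2) - lm g2) + s"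
proof -
  let ?L = "mlcm (lm g1) (lm g2)"
  have L1: "(?L - lm g1) + lm g1 = ?L" and L2: "(?L - lm g2) + lm g2 = ?L"
    by (simp_all add: mdvd_minus_add)
  have "lookup (spoly g1 g2) ?L = 0"
    using lookup_monom_mult_add[of "?L - lm g1" "1 / lc g1" g1 "lm g1"]
      lookup_monom_mult_add[of "?L - lm g2" "1 / lc g2" g2 "lm g2"]
      lc_ne_0[OF assms(1)] lc_ne_0[OF assms(2)]
    by (simp add: spoly_def lookup_minus L1 L2 lc_def)
  then have "t \<noteq> ?L" using assms(3) by (auto simp: in_keys_iff)
  have "t \<in> keys (single (?L - lm g1) (1 / lc g1) * g1) \<or>
        t \<in> keys (single (?L - lm g2) (1 / lc g2) * g2)"
    using subsetD[OF keys_minus_subset assms(3)[unfolded spoly_def]] by blast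
  then show thesis
  proof
    assume "t \<in> keys (single (?L - lm g1) (1 / lc g1) * g1)"
    then obtain s where "t = (?L - lm g1) + s" "s \<in> keys g1" by (rule keys_monom_mult)
    with \<open>t \<noteq> ?L\<close> L1 show thesis by (intro that(1)[of s]) auto
  next
    assume "t \<in> keys (single (?L - lm g2) (1 / lc g2) * g2)"
    then obtain s where "t = (?L - lm g2) + s" "s \<in> keys g2" by (rule keys_monom_mult)
    with \<open>t \<noteq> ?L\<close> L2 show thesis by (intro that(2)[of s]) auto
  qed
qed

lemma keys_spoly_less:
  fixes g1 :: "('v::{finite,linorder}, 'k::field) mpoly"
  assumes "g1 \<noteq> 0" "g2 \<noteq> 0" "t \<in> keys (spoly g1 g2)"
  shows "drl_less t (mlcm (lm g1) (lm g2))"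
proof -
  let ?L = "mlcm (lm g1) (lm g2)"
  have L1: "(?L - lm g1) + lm g1 = ?L" and L2: "(?L - lm g2) + lm g2 = ?L"
    by (simp_all add: mdvd_minus_add)
  from assms show ?thesis
  proof (cases rule: keys_spoly)
    case (1 s)
    then have "drl_less s (lm g1)" using lm_max[OF assms(1), of s] by (auto simp: drl_le_def)
    with 1 show ?thesis by (subst L1[symmetric]) simp
  next
    case (2 s)
    then have "drl_less s (lm g2)" using lm_max[OF assms(2), of s] by (auto simp: drl_le_def)
    with 2 show ?thesis by (subst L2[symmetric]) simp
  qed
qed

lemma pdeg_spoly_le:
  "g1 \<noteq> 0 \<Longrightarrow> g2 \<noteq> 0 \<Longrightarrow>
    pdeg (spoly g1 g2 :: ('v::{finite,linorder}, 'k::field) mpoly) \<le> mdeg (mlcm (lm g1) (lm g2))"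
  using keys_spoly_less drl_less_mdeg unfolding pdeg_le_iff by blast

lemma lookup_red_at:
  assumes "red_at t h g g'" "h \<noteq> (0 :: ('v::{finite,linorder}, 'k::field) mpoly)"
  shows "lookup g' t = 0"
proof -
  from assms have "mdvd (lm h) t" by (simp add: red_at_def)
  then show ?thesis
    using assms lc_ne_0[OF assms(2)]
      lookup_monom_mult_add[of "t - lm h" "lookup g t / lc h" h "lm h"]
    by (simp add: red_at_def lookup_minus mdvd_minus_add lc_def)
qed

text \<open>
  The multiple of the reducer is scaled to cancel the term at \<open>t\<close>, which is its largest one.
\<close>

lemma red_at_keys:
  fixes h :: "('v::{finite,linorder}, 'k::field) mpoly"
  assumes "red_at t h g g'" "h \<noteq> 0" "s \<in> keys g'"
  shows "s \<in> keys g \<and> s \<noteq> t \<or> drl_less s t"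
proof -
  from assms have dv: "mdvd (lm h) t" by (simp add: red_at_def)
  have "s \<noteq> t" using lookup_red_at[OF assms(1,2)] assms(3) by (auto simp: in_keys_iff)
  have "s \<in> keys g \<or> s \<in> keys (single (t - lm h) (lookup g t / lc h) * h)"
    using assms(1,3) subsetD[OF keys_minus_subset, of s g] unfolding red_at_def by blast
  then show ?thesis
  proof
    assume "s \<in> keys (single (t - lm h) (lookup g t / lc h) * h)"
    then obtain u where u: "s = (t - lm h) + u" "u \<in> keys h" by (rule keys_monom_mult)
    have "drl_le ((t - lm h) + u) ((t - lm h) + lm h)" using lm_max[OF assms(2) u(2)] by simp
    with u \<open>s \<noteq> t\<close> show ?thesis by (simp add: mdvd_minus_add[OF dv] drl_le_def)
  qed (use \<open>s \<noteq> t\<close> in simp)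
qed

lemma red_at_pdeg:
  fixes h :: "('v::{finite,linorder}, 'k::field) mpoly"
  assumes "red_at t h g g'" "h \<noteq> 0" "pdeg g \<le> d"
  shows "pdeg g' \<le> d"
proof -
  have "mdeg t \<le> d" using assms pdeg_ge[of t g] by (auto simp: red_at_def)
  then show ?thesis
    using red_at_keys[OF assms(1,2)] assms(3) pdeg_ge[of _ g] unfolding pdeg_le_iff
    by (meson drl_less_mdeg le_trans)
qed

section \<open>Homogeneous components and ideals\<close>

definition hcomp :: "nat \<Rightarrow> ('v, 'k::comm_monoid_add) mpoly \<Rightarrow> ('v, 'k) mpoly" where
  "hcomp d p = (\<Sum>t\<in>{t\<in>keys p. mdeg t = d}. single t (lookup p t))"

lemma lookup_hcomp [simp]: "lookup (hcomp d p) t = (if mdeg t = d then lookup p t else 0)"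
  by (auto simp: hcomp_def lookup_sum lookup_single when_def in_keys_iff)

lemma ptop_eq_hcomp: "ptop p = hcomp (pdeg p) p"
  by (simp add: ptop_def hcomp_def)

lemma keys_hcomp: "keys (hcomp d p) = {t \<in> keys p. mdeg t = d}"
  by (auto simp: in_keys_iff split: if_splits)

lemma homogeneous_hcomp: "homogeneous d (hcomp d p)"
  by (simp add: homogeneous_def keys_hcomp)

lemma hcomp_id: "homogeneous d p \<Longrightarrow> hcomp d p = p"
  by (intro poly_mapping_eqI) (auto simp: homogeneous_def in_keys_iff)

lemma hcomp_eq_0: "(\<And>t. t \<in> keys p \<Longrightarrow> mdeg t \<noteq> d) \<Longrightarrow> hcomp d p = 0"
  by (intro poly_mapping_eqI) (auto simp: in_keys_iff)

lemma hcomp_0 [simp]: "hcomp d 0 = 0"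
  by (intro poly_mapping_eqI) simp

lemma hcomp_add: "hcomp d (p + q) = hcomp d p + hcomp d q"
  by (intro poly_mapping_eqI) (simp add: lookup_add)

text \<open>
  The components of \<open>a\<close> outside degree \<open>d - e\<close> do not reach degree \<open>d\<close>.
\<close>

lemma hcomp_mult:
  fixes h :: "('v::finite, 'k::comm_ring_1) mpoly"
  assumes h: "homogeneous e h"
  shows "hcomp d (a * h) = (if e \<le> d then hcomp (d - e) a * h else 0)"
proof (cases "e \<le> d")
  case False
  have "hcomp d (a * h) = 0"
    using h keys_mult[of a h] False by (intro hcomp_eq_0) (fastforce simp: homogeneous_def)
  with False show ?thesis by simp
next
  case True
  let ?b = "hcomp (d - e) a"
  have "homogeneous d (?b * h)"
    using homogeneous_mult[OF homogeneous_hcomp[of "d - e" a] h] True by simp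
  then have 1: "hcomp d (?b * h) = ?b * h" by (rule hcomp_id)
  have "mdeg t \<noteq> d - e" if "t \<in> keys (a - ?b)" for t
    using that by (auto simp: in_keys_iff lookup_minus split: if_splits)
  then have 2: "hcomp d ((a - ?b) * h) = 0"
    using h keys_mult[of "a - ?b" h] by (intro hcomp_eq_0) (fastforce simp: homogeneous_def)
  have "a * h = ?b * h + (a - ?b) * h" by (simp add: algebra_simps)
  then have "hcomp d (a * h) = hcomp d (?b * h) + hcomp d ((a - ?b) * h)"
    by (metis hcomp_add)
  with 1 2 True show ?thesis by simp
qed

lemma module_mult: "module ((*) :: 'a::comm_ring_1 \<Rightarrow> 'a \<Rightarrow> 'a)"
  by unfold_locales (simp_all add: algebra_simps)

lemmas ideal_gen_base = module.span_base[OF module_mult, folded ideal_gen_def]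
lemmas ideal_gen_zero = module.span_zero[OF module_mult, folded ideal_gen_def]
lemmas ideal_gen_add = module.span_add[OF module_mult, folded ideal_gen_def]
lemmas ideal_gen_diff = module.span_diff[OF module_mult, folded ideal_gen_def]
lemmas ideal_gen_mult = module.span_scale[OF module_mult, folded ideal_gen_def]
lemmas ideal_gen_mono = module.span_mono[OF module_mult, folded ideal_gen_def]
lemmas ideal_gen_breakdown = module.span_breakdown_eq[OF module_mult, folded ideal_gen_def]
lemmas ideal_gen_induct =
  module.span_induct_alt[OF module_mult, folded ideal_gen_def, consumes 1, case_names base step]

lemma ideal_gen_empty: "ideal_gen ({} :: 'a::comm_ring_1 set) = {0}"
  by (simp add: ideal_gen_def module.span_empty[OF module_mult])

lemma hcomp_ideal_gen:
  fixes p :: "('v::finite, 'k::comm_ring_1) mpoly"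
  assumes "p \<in> ideal_gen H" and "\<And>h. h \<in> H \<Longrightarrow> homogeneous (pdeg h) h"
  shows "hcomp d p \<in> ideal_gen H"
  using assms(1)
proof (induction rule: ideal_gen_induct)
  case base
  then show ?case by (simp add: ideal_gen_zero)
next
  case (step c x y)
  have "hcomp d (c * x) \<in> ideal_gen H"
    unfolding hcomp_mult[OF assms(2)[OF step(1)]]
    using step(1) by (simp add: ideal_gen_zero ideal_gen_base ideal_gen_mult)
  with step show ?case by (simp add: hcomp_add ideal_gen_add)
qed

text \<open>
  Passing to components of degree \<open>k\<close> in any representation makes its coefficients homogeneous;
  for \<open>k < deg h\<close> the generator \<open>h\<close> then drops out.
\<close>

lemma ideal_gen_insert_homogeneous:
  fixes p :: "('v::finite, 'k::comm_ring_1) mpoly"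
  assumes p: "p \<in> ideal_gen (insert h S)" "homogeneous k p"
    and h: "\<And>g. g \<in> insert h S \<Longrightarrow> homogeneous (pdeg g) g"
  obtains a q where "p = a * h + q" "q \<in> ideal_gen S" "homogeneous k q"
    "pdeg h \<le> k \<Longrightarrow> homogeneous (k - pdeg h) a" "\<not> pdeg h \<le> k \<Longrightarrow> a = 0"
proof -
  obtain b where "p - b * h \<in> ideal_gen S" using p(1) by (auto simp: ideal_gen_breakdown)
  then have q: "hcomp k (p - b * h) \<in> ideal_gen S" using h by (intro hcomp_ideal_gen) auto
  define a where "a = (if pdeg h \<le> k then hcomp (k - pdeg h) b else 0)"
  have ab: "hcomp k (b * h) = a * h"
    using h[of h] by (simp add: hcomp_mult a_def)
  have "p = hcomp k (b * h) + hcomp k (p - b * h)"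
    using p(2) by (simp flip: hcomp_add add: hcomp_id)
  then show thesis using q by (intro that[of a "hcomp k (p - b * h)"])
      (auto simp: a_def ab homogeneous_hcomp)
qed


section \<open>Hilbert series and syzygies of semi-regular sequences\<close>

text \<open>
  If \<open>f\<close> maps \<open>Q \<subseteq> R\<close> into \<open>I\<close>, then \<open>I + f R\<close> is spanned by a basis of \<open>I\<close> together with
  the images of a basis of a complement of \<open>Q\<close> in \<open>R\<close>.
\<close>

lemma (in vector_space) dim_sum_image_le:
  assumes fin: "finite F" "R \<subseteq> span F" "finite G" "I \<subseteq> span G"
    and lin: "Vector_Spaces.linear scale scale f"
    and Q: "Q \<subseteq> R" "f ` Q \<subseteq> I" and I: "subspace I"
    and J: "\<And>x. x \<in> J \<Longrightarrow> \<exists>a\<in>R. \<exists>q\<in>I. x = f a + q"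
  shows "dim J + dim Q \<le> dim I + dim R"
proof -
  interpret f: Vector_Spaces.linear scale scale f by (rule lin)
  obtain B where B: "B \<subseteq> Q" "independent B" "Q \<subseteq> span B" "card B = dim Q"
    by (rule basis_exists)
  obtain C where C: "B \<subseteq> C" "C \<subseteq> R" "independent C" "R \<subseteq> span C"
    using maximal_independent_subset_extend[OF order_trans[OF B(1) Q(1)] B(2)] by blast
  obtain E where E: "E \<subseteq> I" "independent E" "I \<subseteq> span E" "card E = dim I"
    by (rule basis_exists)
  have finC: "finite C" using independent_span_bound[OF fin(1) C(3)] C(2) fin(2) by auto
  have finE: "finite E" using independent_span_bound[OF fin(3) E(2)] E(1) fin(4) by auto
  have cardC: "card C = dim R" using C by (intro basis_card_eq_dim)
  have "J \<subseteq> span (E \<union> f ` (C - B))"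
  proof
    fix x assume "x \<in> J"
    then obtain a q where aq: "a \<in> R" "q \<in> I" "x = f a + q" using J by blast
    have "q \<in> span (E \<union> f ` (C - B))" using E(3) aq(2) span_mono[OF Un_upper1, of E] by blast
    moreover have "f ` C \<subseteq> span (E \<union> f ` (C - B))"
    proof
      fix y assume "y \<in> f ` C"
      then obtain c where c: "c \<in> C" "y = f c" by auto
      show "y \<in> span (E \<union> f ` (C - B))"
      proof (cases "c \<in> B")
        case True
        then have "y \<in> span E" using c B(1) Q(2) E(3) by auto
        then show ?thesis using span_mono[OF Un_upper1, of E] by blast
      qed (use c in \<open>auto intro: span_base\<close>)
    qed
    then have "span (f ` C) \<subseteq> span (E \<union> f ` (C - B))" by (simp add: span_minimal)
    then have "f a \<in> span (E \<union> f ` (C - B))" using aq(1) C(4) by (auto simp: f.span_image)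
    ultimately show "x \<in> span (E \<union> f ` (C - B))" using aq(3) by (simp add: span_add)
  qed
  then have "dim J \<le> card (E \<union> f ` (C - B))" using finC finE by (intro dim_le_card) auto
  also have "\<dots> \<le> card E + card (f ` (C - B))" by (rule card_Un_le)
  also have "\<dots> \<le> card E + card (C - B)" using card_image_le[of "C - B" f] finC by simp
  also have "card (C - B) = card C - card B" using C(1) finC by (simp add: card_Diff_subset finite_subset)
  finally show ?thesis using card_mono[OF finC C(1)] E(4) B(4) cardC by simp
qed

lemma (in vector_space) dim_subset_finite_span:
  assumes fin: "finite F" "W \<subseteq> span F" and "V \<subseteq> W" "subspace V"
  shows "dim V \<le> dim W" and "dim V = dim W \<Longrightarrow> V = W"
proof -
  obtain B where B: "B \<subseteq> V" "independent B" "V \<subseteq> span B" "card B = dim V"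
    by (rule basis_exists)
  obtain C where C: "B \<subseteq> C" "C \<subseteq> W" "independent C" "W \<subseteq> span C"
    using maximal_independent_subset_extend[OF order_trans[OF B(1) assms(3)] B(2)] by blast
  have finC: "finite C" using independent_span_bound[OF fin(1) C(3)] C(2) fin(2) by auto
  have cardC: "card C = dim W" using C by (intro basis_card_eq_dim)
  show "dim V \<le> dim W" using card_mono[OF finC C(1)] B(4) cardC by simp
  assume "dim V = dim W"
  then have "B = C" using card_subset_eq[OF finC C(1)] B(4) cardC by simp
  then have "W \<subseteq> V" using C(4) B(1) assms(4) by (metis span_minimal order_trans)
  with assms(3) show "V = W" by auto
qed

abbreviation kscale :: "'k::field \<Rightarrow> ('v, 'k) mpoly \<Rightarrow> ('v, 'k) mpoly" where
  "kscale \<equiv> \<lambda>c p. single 0 c * p"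

lemma lookup_kscale [simp]: "lookup (kscale c p) t = c * lookup p t"
  using lookup_monom_mult_add[of 0 c p t] by simp

lemma vector_space_mpoly: "vector_space (kscale :: 'k::field \<Rightarrow> ('v, 'k) mpoly \<Rightarrow> _)"
  by unfold_locales
    (simp_all add: distrib_left distrib_right single_add mult_single flip: mult.assoc)

interpretation kv: vector_space "kscale :: 'k::field \<Rightarrow> ('v, 'k) mpoly \<Rightarrow> _"
  by (rule vector_space_mpoly)

abbreviation monoms :: "nat \<Rightarrow> ('v::finite, 'k::field) mpoly set" where
  "monoms k \<equiv> (\<lambda>t. single t 1) ` {t. mdeg t = k}"

lemma finite_mdeg_eq: "finite {t :: 'v::finite mon. mdeg t = k}"
  by (rule finite_subset[OF _ finite_mdeg_le[of k]]) auto

lemma homogeneous_in_span_monoms: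
  assumes "homogeneous k (p :: ('v::finite, 'k::field) mpoly)"
  shows "p \<in> kv.span (monoms k)"
proof -
  have "single t (lookup p t) \<in> kv.span (monoms k)" if "t \<in> keys p" for t
  proof -
    have "kscale (lookup p t) (single t 1) \<in> kv.span (monoms k)"
      using that assms by (intro kv.span_scale kv.span_base) (auto simp: homogeneous_def)
    then show ?thesis by (simp add: mult_single)
  qed
  then have "(\<Sum>t\<in>keys p. single t (lookup p t)) \<in> kv.span (monoms k)" by (rule kv.span_sum)
  then show ?thesis using poly_as_sum[of p] by simp
qed

lemma independent_monoms: "kv.independent (monoms k :: ('v::finite, 'k::field) mpoly set)"
proof (rule kv.independent_if_scalars_zero)
  show "finite (monoms k :: ('v, 'k) mpoly set)" by (intro finite_imageI finite_mdeg_eq)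
  fix f :: "('v, 'k) mpoly \<Rightarrow> 'k" and x :: "('v, 'k) mpoly"
  assume sum: "(\<Sum>x\<in>monoms k. kscale (f x) x) = 0" and "x \<in> monoms k"
  then obtain t where t: "x = single t 1" "mdeg t = k" by auto
  have inj: "inj_on (\<lambda>t :: 'v mon. single t (1::'k)) {t. mdeg t = k}"
    by (rule inj_onI) (metis keys_single one_neq_zero singleton_inject)
  have "0 = lookup (\<Sum>x\<in>monoms k. kscale (f x) x) t" using sum by simp
  also have "\<dots> = (\<Sum>s\<in>{s. mdeg s = k}. f (single s 1) * (1 when s = t))"
    by (simp add: sum.reindex[OF inj] lookup_sum lookup_single)
  also have "\<dots> = (\<Sum>s\<in>{s. mdeg s = k}. if s = t then f (single t 1) else 0)"
    by (intro sum.cong) auto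
  also have "\<dots> = f x" by (subst sum.delta[OF finite_mdeg_eq]) (simp add: t)
  finally show "f x = 0" by simp
qed

lemma kdim_homogeneous: "kdim {p :: ('v::finite, 'k::field) mpoly. homogeneous k p}
    = card {t :: 'v mon. mdeg t = k}"
proof -
  have "card (monoms k :: ('v, 'k) mpoly set) = kv.dim {p :: ('v, 'k) mpoly. homogeneous k p}"
  proof (rule kv.basis_card_eq_dim)
    show "monoms k \<subseteq> {p :: ('v, 'k) mpoly. homogeneous k p}"
      using homogeneous_single by auto
    show "{p :: ('v, 'k) mpoly. homogeneous k p} \<subseteq> kv.span (monoms k)"
      using homogeneous_in_span_monoms by auto
  qed (rule independent_monoms)
  moreover have "card (monoms k :: ('v, 'k) mpoly set) = card {t :: 'v mon. mdeg t = k}"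
    by (intro card_image inj_onI) (metis keys_single one_neq_zero singleton_inject)
  ultimately show ?thesis by (simp add: kdim_def)
qed

text \<open>
  With the variables put in a list, monomials become the lists of exponents.
\<close>

lemma card_mdeg_eq:
  "card {t :: 'v::finite mon. mdeg t = k} = (card (UNIV :: 'v set) + k - 1) choose k"
proof -
  obtain xs :: "'v list" where xs: "distinct xs" "set xs = UNIV"
    using finite_distinct_list[of "UNIV :: 'v set"] by auto
  then have len: "length xs = card (UNIV :: 'v set)" by (metis distinct_card)
  have sum: "sum_list (map (lookup t) xs) = mdeg t" for t :: "'v mon"
    using xs by (simp add: mdeg_UNIV sum_list_distinct_conv_sum_set)
  have "bij_betw (\<lambda>t. map (lookup t) xs) {t :: 'v mon. mdeg t = k}
      {l. length l = card (UNIV :: 'v set) \<and> sum_list l = k}"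
  proof (rule bij_betw_imageI)
    show "inj_on (\<lambda>t. map (lookup t) xs) {t :: 'v mon. mdeg t = k}"
      using xs by (auto intro!: inj_onI poly_mapping_eqI)
    show "(\<lambda>t. map (lookup t) xs) ` {t :: 'v mon. mdeg t = k}
        = {l. length l = card (UNIV :: 'v set) \<and> sum_list l = k}" (is "?A = ?B")
    proof
      show "?A \<subseteq> ?B" using sum len by auto
      show "?B \<subseteq> ?A"
      proof
        fix l assume l: "l \<in> ?B"
        define f where "f v = (case map_of (zip xs l) v of Some n \<Rightarrow> n | None \<Rightarrow> 0)" for v
        define t where "t = Abs_poly_mapping f"
        have "lookup t = f" unfolding t_def by simp
        moreover have "map f xs = l"
        proof (rule nth_equalityI)
          show "length (map f xs) = length l" using l len by simp
          fix i assume "i < length (map f xs)"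
          then show "map f xs ! i = l ! i"
            using l len xs(1) by (simp add: f_def map_of_zip_nth)
        qed
        ultimately have "map (lookup t) xs = l" by simp
        with l sum[of t] show "l \<in> ?A" by force
      qed
    qed
  qed
  then have "card {t :: 'v mon. mdeg t = k} = card {l. length l = card (UNIV :: 'v set) \<and> sum_list l = k}"
    by (rule bij_betw_same_card)
  then show ?thesis using card_length_sum_list[of "card (UNIV :: 'v set)" k] by (simp add: add.commute)
qed

abbreviation hs_coeff :: "('v::finite, 'k::field) mpoly list \<Rightarrow> nat \<Rightarrow> rat" where
  "hs_coeff hs k \<equiv> fps_nth (hilbert_series (ideal_gen (set hs))) k"

text \<open>
  The Hilbert series that the quotient would have if every generator were regular modulo the
  preceding ones.
\<close>

abbreviation koszul_series :: "('v::finite, 'k::field) mpoly list \<Rightarrow> rat fps" where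
  "koszul_series hs \<equiv> (\<Prod>h\<leftarrow>hs. 1 - fps_X ^ pdeg h) / (1 - fps_X) ^ card (UNIV :: 'v set)"

lemma hs_coeff_Nil: "hs_coeff ([] :: ('v::finite, 'k::field) mpoly list) k
    = fps_nth (koszul_series ([] :: ('v, 'k) mpoly list)) k"
proof -
  have "{p \<in> {0 :: ('v, 'k) mpoly}. homogeneous k p} = {0}" by auto
  then have "kdim {p \<in> {0 :: ('v, 'k) mpoly}. homogeneous k p} = 0"
    using kv.dim_le_card[of "{0}" "{}"] by (simp add: kdim_def)
  then have "hs_coeff ([] :: ('v, 'k) mpoly list) k = of_nat ((card (UNIV :: 'v set) + k - 1) choose k)"
    by (simp add: hilbert_series_def ideal_gen_empty kdim_homogeneous card_mdeg_eq)
  moreover have "inverse ((1 - fps_const 1 * fps_X) ^ card (UNIV :: 'v set))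
      = Abs_fps (\<lambda>k. of_nat ((card (UNIV :: 'v set) + k - 1) choose k) * 1 ^ k :: rat)"
    by (rule one_minus_const_fps_X_neg_power') (simp add: card_gt_0_iff)
  ultimately show ?thesis by (simp add: fps_divide_unit)
qed

lemma koszul_series_snoc:
  fixes h :: "('v::finite, 'k::field) mpoly"
  shows "fps_nth (koszul_series (hs @ [h])) k = fps_nth (koszul_series hs) k
      - (if pdeg h \<le> k then fps_nth (koszul_series hs) (k - pdeg h) else 0)"
proof -
  have "koszul_series (hs @ [h]) = koszul_series hs * (1 - fps_X ^ pdeg h)"
    by (simp add: fps_divide_unit algebra_simps)
  then show ?thesis by (simp add: right_diff_distrib fps_X_power_mult_right_nth not_less)
qed

text \<open>
  In degree \<open>k\<close> the new ideal is \<open>I + h R\<close>, where multiplication by \<open>h\<close> sends the degree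
  \<open>k - deg h\<close> part of \<open>(I : h)\<close> into \<open>I\<close>.  So \<open>h\<close> adds at most the codimension of \<open>(I : h)\<close> to the
  dimension of the ideal, and it adds the codimension of the smaller space \<open>I\<close> only if
  \<open>(I : h) = I\<close> in that degree.
\<close>

lemma hs_coeff_snoc:
  fixes h :: "('v::finite, 'k::field) mpoly" and k :: nat
  assumes hom: "\<And>g. g \<in> set (hs @ [h]) \<Longrightarrow> homogeneous (pdeg g) g"
  defines "c \<equiv> hs_coeff hs k - (if pdeg h \<le> k then hs_coeff hs (k - pdeg h) else 0)"
  shows "c \<le> hs_coeff (hs @ [h]) k"
    and "\<lbrakk>hs_coeff (hs @ [h]) k = c; pdeg h \<le> k; homogeneous (k - pdeg h) a;
      a * h \<in> ideal_gen (set hs)\<rbrakk> \<Longrightarrow> a \<in> ideal_gen (set hs)"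
proof -
  let ?I = "ideal_gen (set hs)" and ?J = "ideal_gen (set (hs @ [h]))"
  define R where "R d = {p :: ('v, 'k) mpoly. homogeneous d p}" for d
  define P where "P X d = {p \<in> X. homogeneous d p}" for X :: "('v, 'k) mpoly set" and d
  have R: "finite (monoms d :: ('v, 'k) mpoly set)" "R d \<subseteq> kv.span (monoms d)" for d
    using finite_mdeg_eq homogeneous_in_span_monoms by (auto simp: R_def)
  have PR: "P X d \<subseteq> R d" for X d by (auto simp: P_def R_def)
  have sub: "kv.subspace (P (ideal_gen H) d)" for H :: "('v, 'k) mpoly set" and d
    unfolding kv.subspace_def P_def
    by (auto intro!: ideal_gen_zero ideal_gen_add ideal_gen_mult homogeneous_add
        homogeneous_monom_mult)
  note le = kv.dim_subset_finite_span(1)[OF R PR sub]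
  have coeff: "hs_coeff gs d = of_nat (kv.dim (R d)) - of_nat (kv.dim (P (ideal_gen (set gs)) d))"
    for gs d
    using le by (simp add: hilbert_series_def kdim_def R_def P_def of_nat_diff)
  show "c \<le> hs_coeff (hs @ [h]) k"
    and "\<lbrakk>hs_coeff (hs @ [h]) k = c; pdeg h \<le> k; homogeneous (k - pdeg h) a; a * h \<in> ?I\<rbrakk> \<Longrightarrow> a \<in> ?I"
  proof -
    have split: "\<exists>a q. p = a * h + q \<and> q \<in> P ?I k \<and> (pdeg h \<le> k \<longrightarrow> a \<in> R (k - pdeg h)) \<and>
        (\<not> pdeg h \<le> k \<longrightarrow> a = 0)" if "p \<in> P ?J k" for p
    proof -
      have "p \<in> ideal_gen (insert h (set hs))" "homogeneous k p" using that by (auto simp: P_def)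
      then show ?thesis
        by (rule ideal_gen_insert_homogeneous) (use hom in \<open>auto simp: P_def R_def\<close>)
    qed
    define Q where "Q = {a \<in> R (k - pdeg h). a * h \<in> ?I}"
    have dimQ: "kv.dim (P ?J k) + kv.dim Q \<le> kv.dim (P ?I k) + kv.dim (R (k - pdeg h))"
      if "pdeg h \<le> k"
    proof (rule kv.dim_sum_image_le[where f = "\<lambda>a. a * h", OF R])
      show "P ?I k \<subseteq> kv.span (monoms k)" using PR R by blast
      show "Vector_Spaces.linear kscale kscale (\<lambda>a. a * h)"
        by unfold_locales (simp_all add: algebra_simps)
      show "Q \<subseteq> R (k - pdeg h)" by (auto simp: Q_def)
      show "(\<lambda>a. a * h) ` Q \<subseteq> P ?I k"
      proof
        fix x assume "x \<in> (\<lambda>a. a * h) ` Q"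
        then obtain b where b: "b \<in> Q" "x = b * h" by auto
        then have "homogeneous (k - pdeg h + pdeg h) (b * h)"
          using hom[of h] by (intro homogeneous_mult) (auto simp: Q_def R_def)
        with b that show "x \<in> P ?I k" by (simp add: P_def Q_def)
      qed
      show "\<exists>a\<in>R (k - pdeg h). \<exists>q\<in>P ?I k. x = a * h + q" if "x \<in> P ?J k" for x
        using split[OF that] \<open>pdeg h \<le> k\<close> by blast
    qed (use R sub in auto)
    have IQ: "P ?I (k - pdeg h) \<subseteq> Q"
      using ideal_gen_mult[of _ "set hs" h] by (auto simp: Q_def P_def R_def mult.commute)
    have "Q \<subseteq> kv.span (monoms (k - pdeg h))" using R by (auto simp: Q_def)
    note Q = kv.dim_subset_finite_span[OF R(1) this IQ sub]
    show "c \<le> hs_coeff (hs @ [h]) k"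
    proof (cases "pdeg h \<le> k")
      case True
      then show ?thesis using dimQ[OF True] Q(1)
        by (simp add: c_def coeff del: set_append)
    next
      case False
      have "P ?J k \<subseteq> P ?I k" using split False by fastforce
      then have "kv.dim (P ?J k) \<le> kv.dim (P ?I k)"
        using kv.dim_subset_finite_span(1)[OF R(1), of "P ?I k" k "P ?J k"] PR R(2) sub by blast
      with False show ?thesis by (simp add: c_def coeff del: set_append)
    qed
    assume *: "hs_coeff (hs @ [h]) k = c" "pdeg h \<le> k" "homogeneous (k - pdeg h) a" "a * h \<in> ?I"
    have "real (kv.dim (P ?J k)) = kv.dim (P ?I k) + kv.dim (R (k - pdeg h)) - kv.dim (P ?I (k - pdeg h))"
    proof -
      have "of_nat (kv.dim (P ?J k)) + of_nat (kv.dim (P ?I (k - pdeg h)))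
          = (of_nat (kv.dim (P ?I k)) + of_nat (kv.dim (R (k - pdeg h))) :: rat)"
        using *(1,2) by (simp add: c_def coeff del: set_append)
      then have "kv.dim (P ?J k) + kv.dim (P ?I (k - pdeg h))
          = kv.dim (P ?I k) + kv.dim (R (k - pdeg h))"
        by (simp only: of_nat_eq_iff flip: of_nat_add)
      then show ?thesis by simp
    qed
    then have "kv.dim (P ?I (k - pdeg h)) = kv.dim Q" using dimQ[OF *(2)] Q(1) by linarith
    then have "P ?I (k - pdeg h) = Q" by (rule Q(2))
    then show "a \<in> ?I" using *(3,4) by (auto simp: Q_def R_def P_def)
  qed
qed

text \<open>
  Suppose that \<open>hs @ [h]\<close> agrees with its Koszul series below degree \<open>k\<close> but \<open>hs\<close> does not.  At the
  first degree of disagreement \<open>hs\<close> has a surplus by induction, and this surplus survives in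
  \<open>hs @ [h]\<close>, because \<open>deg h > 0\<close> and the lower degrees agree.  So the prefix agrees below \<open>k\<close> too,
  and the bound for \<open>hs @ [h]\<close> at \<open>k\<close> follows from the one for \<open>hs\<close>.
\<close>

lemma hs_coeff_ge_koszul:
  fixes hs :: "('v::finite, 'k::field) mpoly list"
  assumes "\<And>g. g \<in> set hs \<Longrightarrow> homogeneous (pdeg g) g \<and> 0 < pdeg g"
    and "\<And>j. j < k \<Longrightarrow> hs_coeff hs j = fps_nth (koszul_series hs) j"
  shows "fps_nth (koszul_series hs) k \<le> hs_coeff hs k"
    and "hs = gs @ [h] \<Longrightarrow> j < k \<Longrightarrow> hs_coeff gs j = fps_nth (koszul_series gs) j"
proof -
  have "fps_nth (koszul_series hs) k \<le> hs_coeff hs k \<and>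
      (\<forall>gs h. hs = gs @ [h] \<longrightarrow> (\<forall>j<k. hs_coeff gs j = fps_nth (koszul_series gs) j))"
    using assms
  proof (induction hs arbitrary: k rule: rev_induct)
    case Nil
    show ?case using hs_coeff_Nil[of k, where ?'v = 'v and ?'k = 'k] by simp
  next
    case (snoc h hs)
    have h: "homogeneous (pdeg g) g" "0 < pdeg g" if "g \<in> set (hs @ [h])" for g
      using snoc.prems(1) that by auto
    then have pos: "0 < pdeg h" by simp
    have agree: "hs_coeff hs j = fps_nth (koszul_series hs) j" if "j < k" for j
      using that
    proof (induction j rule: less_induct)
      case (less j)
      have "fps_nth (koszul_series hs) j \<le> hs_coeff hs j"
        using snoc.IH[of j] h less by auto
      moreover have "hs_coeff hs j
          \<le> hs_coeff (hs @ [h]) j + (if pdeg h \<le> j then hs_coeff hs (j - pdeg h) else 0)"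
        using hs_coeff_snoc(1)[of hs h j] h by simp
      moreover have "hs_coeff (hs @ [h]) j = fps_nth (koszul_series (hs @ [h])) j"
        using snoc.prems(2) less.prems by blast
      moreover have "pdeg h \<le> j \<Longrightarrow>
          hs_coeff hs (j - pdeg h) = fps_nth (koszul_series hs) (j - pdeg h)"
        using less pos by auto
      ultimately show ?case
        using koszul_series_snoc[of hs h j] by (simp split: if_splits del: set_append)
    qed
    have "fps_nth (koszul_series hs) k \<le> hs_coeff hs k" using snoc.IH[of k] h agree by auto
    moreover have "pdeg h \<le> k \<Longrightarrow>
        hs_coeff hs (k - pdeg h) = fps_nth (koszul_series hs) (k - pdeg h)"
      using agree pos by auto
    ultimately have "fps_nth (koszul_series (hs @ [h])) k \<le> hs_coeff (hs @ [h]) k"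
      using hs_coeff_snoc(1)[of hs h k] h koszul_series_snoc[of hs h k]
      by (simp split: if_splits del: set_append)
    with agree show ?case by auto
  qed
  then show "fps_nth (koszul_series hs) k \<le> hs_coeff hs k"
    and "hs = gs @ [h] \<Longrightarrow> j < k \<Longrightarrow> hs_coeff gs j = fps_nth (koszul_series gs) j" by auto
qed

lemma d_regular_prefix:
  assumes "d_regular d (hs @ [h])"
    and "\<And>g. g \<in> set (hs @ [h]) \<Longrightarrow> homogeneous (pdeg g) g \<and> 0 < pdeg g"
  shows "d_regular d hs"
  unfolding d_regular_def
proof (intro allI impI)
  fix k assume "k < d"
  show "hs_coeff hs k = fps_nth (koszul_series hs) k"
    by (rule hs_coeff_ge_koszul(2)[of "hs @ [h]" d hs h k])
      (use assms \<open>k < d\<close> in \<open>auto simp: d_regular_def\<close>)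
qed

text \<open>
  All prefixes are regular up to the same degree.  Hence both Hilbert series in the step from
  \<open>hs\<close> to \<open>hs @ [h]\<close> are Koszul series, and the inequality of lemma \<open>hs_coeff_snoc\<close> is an equality.
\<close>

lemma d_regular_mult_injective:
  fixes h :: "('v::finite, 'k::field) mpoly"
  assumes reg: "d_regular d (hs @ [h] @ gs)"
    and hom: "\<And>g. g \<in> set (hs @ [h] @ gs) \<Longrightarrow> homogeneous (pdeg g) g \<and> 0 < pdeg g"
    and a: "homogeneous c a" "c + pdeg h < d" "a * h \<in> ideal_gen (set hs)"
  shows "a \<in> ideal_gen (set hs)"
  using reg hom
proof (induction gs rule: rev_induct)
  case Nil
  then have reg': "d_regular d (hs @ [h])" and hom': "\<And>g. g \<in> set (hs @ [h]) \<Longrightarrow> homogeneous (pdeg g) g \<and> 0 < pdeg g"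
    by auto
  let ?k = "c + pdeg h"
  have "d_regular d hs" by (rule d_regular_prefix[OF reg' hom'])
  then have "hs_coeff hs ?k = fps_nth (koszul_series hs) ?k"
    "hs_coeff hs c = fps_nth (koszul_series hs) c"
    using a(2) by (auto simp: d_regular_def)
  moreover have "hs_coeff (hs @ [h]) ?k = fps_nth (koszul_series (hs @ [h])) ?k"
    using reg' a(2) by (auto simp: d_regular_def)
  ultimately have "hs_coeff (hs @ [h]) ?k = hs_coeff hs ?k - hs_coeff hs (?k - pdeg h)"
    using koszul_series_snoc[of hs h ?k] by (simp del: set_append)
  then show ?case using hs_coeff_snoc(2)[of hs h ?k a] hom' a by simp
next
  case (snoc g gs)
  then have "d_regular d (hs @ [h] @ gs)"
    using d_regular_prefix[of d "hs @ [h] @ gs" g] by auto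
  with snoc show ?case by auto
qed

section \<open>Homogenization and specialization\<close>

abbreviation unemb :: "'x option mon \<Rightarrow> 'x mon" where
  "unemb \<equiv> Poly_Mapping.map_key Some"

abbreviation ypow :: "nat \<Rightarrow> 'x option mon" where
  "ypow \<equiv> single None"

lemma lookup_unemb [simp]: "lookup (unemb t) v = lookup t (Some v)"
  by (simp add: map_key.rep_eq)

lemma lookup_emb_Some [simp]: "lookup (emb t) (Some v) = lookup t v"
  by (auto simp: emb_def lookup_sum lookup_single when_def in_keys_iff)

lemma lookup_emb_None [simp]: "lookup (emb t) None = 0"
  by (auto simp: emb_def lookup_sum lookup_single when_def)

lemma option_mon_eqI:
  "(\<And>v. lookup s (Some v) = lookup t (Some v)) \<Longrightarrow> lookup s None = lookup t None \<Longrightarrow> s = t"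
  by (rule poly_mapping_eqI) (metis not_Some_eq)

lemma lookup_ypow [simp]: "lookup (ypow k) (Some v) = 0" "lookup (ypow k) None = k"
  by (simp_all add: lookup_single)

lemma unemb_add [simp]: "unemb (s + t) = unemb s + unemb t"
  by (intro poly_mapping_eqI) (simp add: lookup_add)

lemma unemb_emb [simp]: "unemb (emb t) = t"
  by (intro poly_mapping_eqI) simp

lemma unemb_ypow [simp]: "unemb (ypow k) = 0"
  by (intro poly_mapping_eqI) simp

lemma unemb_0 [simp]: "unemb 0 = 0"
  by (intro poly_mapping_eqI) simp

lemma emb_unemb: "lookup t None = 0 \<Longrightarrow> emb (unemb t) = t"
  by (intro option_mon_eqI) simp_all

lemma emb_inject [simp]: "emb s = emb t \<longleftrightarrow> s = t"
  by (metis unemb_emb)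

lemma mdeg_option: "mdeg (t :: 'x::finite option mon) = mdeg (unemb t) + lookup t None"
  by (simp add: mdeg_UNIV UNIV_option_conv sum.reindex)

lemma mdeg_emb [simp]: "mdeg (emb t :: 'x::finite option mon) = mdeg t"
  by (simp add: mdeg_option)

lemma emb_minus: "emb (s - t) = emb s - emb t"
  by (intro option_mon_eqI) (simp_all add: lookup_minus)

lemma emb_mlcm: "emb (mlcm s t) = mlcm (emb s) (emb t)"
  by (intro option_mon_eqI) simp_all

lemma mdvd_option: "mdvd s t \<longleftrightarrow> mdvd (unemb s) (unemb t) \<and> lookup s None \<le> lookup t None"
  unfolding mdvd_def by (metis lookup_unemb not_Some_eq)

lemma mdvd_emb [simp]: "mdvd (emb s) (emb t) \<longleftrightarrow> mdvd s t"
  by (simp add: mdvd_option)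

lemma mcoprime_emb [simp]: "mcoprime (emb s) (emb t) \<longleftrightarrow> mcoprime s t"
  unfolding mcoprime_def by (metis lookup_emb_None lookup_emb_Some not_Some_eq)

lemma drl_less_emb [simp]:
  "drl_less (emb s) (emb t) \<longleftrightarrow> drl_less s (t :: 'x::{finite,linorder} mon)"
proof -
  have "(\<exists>v. lookup (emb t) v < lookup (emb s) v \<and> (\<forall>w<v. lookup (emb s) w = lookup (emb t) w))
    \<longleftrightarrow> (\<exists>v. lookup t v < lookup s v \<and> (\<forall>w<v. lookup s w = lookup t w))" (is "?L \<longleftrightarrow> ?R")
  proof
    assume ?L
    then obtain w where w: "lookup (emb t) w < lookup (emb s) w"
      "\<forall>x<w. lookup (emb s) x = lookup (emb t) x" by blast
    then obtain v where [simp]: "w = Some v" by (cases w) auto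
    have "lookup s x = lookup t x" if "x < v" for x using w(2)[rule_format, of "Some x"] that by simp
    with w(1) show ?R by auto
  next
    assume ?R
    then obtain v where v: "lookup t v < lookup s v" "\<forall>x<v. lookup s x = lookup t x" by blast
    have "lookup (emb s) x = lookup (emb t) x" if "x < Some v" for x
      using v(2) that by (cases x) auto
    with v(1) show ?L by (intro exI[of _ "Some v"]) auto
  qed
  then show ?thesis by (simp add: drl_less_def)
qed

lemma drl_le_emb [simp]: "drl_le (emb s) (emb t) \<longleftrightarrow> drl_le s (t :: 'x::{finite,linorder} mon)"
  by (simp add: drl_le_def)

text \<open>
  For \<open>mdeg t \<le> d\<close>, the monomial of degree \<open>d\<close> that becomes \<open>t\<close> at \<open>y = 1\<close>.
\<close>

definition hz :: "nat \<Rightarrow> 'x mon \<Rightarrow> 'x option mon" where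
  "hz d t = emb t + ypow (d - mdeg t)"

lemma unemb_hz [simp]: "unemb (hz d t) = t"
  by (simp add: hz_def)

lemma lookup_hz_None [simp]: "lookup (hz d t) None = d - mdeg t"
  by (simp add: hz_def lookup_add)

lemma mdeg_hz [simp]: "mdeg (t :: 'x::finite mon) \<le> d \<Longrightarrow> mdeg (hz d t) = d"
  by (simp add: mdeg_option)

lemma hz_unemb: "mdeg (t :: 'x::finite option mon) = d \<Longrightarrow> hz d (unemb t) = t"
  by (intro option_mon_eqI) (auto simp: hz_def lookup_add mdeg_option)

lemma mdeg_unemb_le: "mdeg (unemb t) \<le> mdeg (t :: 'x::finite option mon)"
  by (simp add: mdeg_option)

lemma hz_eq_emb: "hz (mdeg t) t = emb t"
  by (simp add: hz_def)

text \<open>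
  A monomial of smaller degree is multiplied by a higher power of the smallest variable, so the
  comparison of degrees turns into the reverse lexicographic one.
\<close>

lemma drl_less_hz:
  fixes s t :: "'x::{finite,linorder} mon"
  assumes "drl_less s t" "mdeg t \<le> d" shows "drl_less (hz d s) (hz d t)"
proof (cases "mdeg s = mdeg t")
  case True
  then have "hz d s = ypow (d - mdeg t) + emb s" "hz d t = ypow (d - mdeg t) + emb t"
    by (simp_all add: hz_def add.commute)
  then show ?thesis using assms by simp
next
  case False
  then have lt: "mdeg s < mdeg t" using assms by (simp add: drl_less_def)
  have "\<not> w < None" for w :: "'x option" by (cases w) auto
  then have "lookup (hz d t) None < lookup (hz d s) None \<and>
      (\<forall>w<None. lookup (hz d s) w = lookup (hz d t) w)" using lt assms(2) by auto
  then have "\<exists>v. lookup (hz d t) v < lookup (hz d s) v \<and>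
      (\<forall>w<v. lookup (hz d s) w = lookup (hz d t) w)" by blast
  then show ?thesis unfolding drl_less_def using lt assms(2) by simp
qed

lemma drl_le_hz:
  "drl_le s t \<Longrightarrow> mdeg t \<le> d \<Longrightarrow> drl_le (hz d s) (hz d (t :: 'x::{finite,linorder} mon))"
  unfolding drl_le_def using drl_less_hz by blast

lemma lookup_phom:
  fixes p :: "('x::finite, 'k::comm_monoid_add) mpoly"
  shows "lookup (phom p) t = (if mdeg t = pdeg p then lookup p (unemb t) else 0)"
proof -
  have "lookup (phom p) t = (\<Sum>s\<in>keys p. lookup p s when hz (pdeg p) s = t)"
    by (simp add: phom_def lookup_sum lookup_single hz_def)
  also have "\<dots> = (\<Sum>s\<in>keys p. if s = unemb t then (if mdeg t = pdeg p then lookup p (unemb t) else 0) else 0)"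
  proof (rule sum.cong)
    fix s assume "s \<in> keys p"
    then have "hz (pdeg p) s = t \<longleftrightarrow> s = unemb t \<and> mdeg t = pdeg p"
      using pdeg_ge[of s p] hz_unemb[of t] by auto
    then show "(lookup p s when hz (pdeg p) s = t)
        = (if s = unemb t then (if mdeg t = pdeg p then lookup p (unemb t) else 0) else 0)"
      by (auto simp: when_def)
  qed simp
  also have "\<dots> = (if mdeg t = pdeg p then lookup p (unemb t) else 0)"
    by (simp add: in_keys_iff)
  finally show ?thesis .
qed

text \<open>
  Lifting to degree \<open>d\<close> is the bijection, inverse to \<open>y = 1\<close>, from the polynomials of degree at
  most \<open>d\<close> onto the homogeneous ones of degree \<open>d\<close>; in coefficients it just renames monomials.
\<close>

lemma lookup_lift:
  fixes r :: "('x::finite, 'k::comm_semiring_1) mpoly"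
  assumes "pdeg r \<le> d"
  shows "lookup (lift d r) t = (if mdeg t = d then lookup r (unemb t) else 0)"
proof (cases "mdvd (ypow (d - pdeg r)) t")
  case True
  then obtain u where u: "t = u + ypow (d - pdeg r)" by (rule mdvdE)
  then have "mdeg t = d \<longleftrightarrow> mdeg u = pdeg r" using assms by auto
  then show ?thesis by (simp add: lift_def lookup_monom_mult True lookup_phom u)
next
  case False
  then have "lookup t None < d - pdeg r" by (auto simp: mdvd_option) (simp add: mdvd_def)
  then have "mdeg t = d \<Longrightarrow> unemb t \<notin> keys r" using pdeg_ge[of "unemb t" r] by (auto simp: mdeg_option)
  then show ?thesis using False by (auto simp: lift_def lookup_monom_mult in_keys_iff)
qed

lemma keys_lift: "pdeg r \<le> d \<Longrightarrow> keys (lift d r) = hz d ` keys (r :: ('x::finite, 'k::comm_semiring_1) mpoly)"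
proof
  assume d: "pdeg r \<le> d"
  show "keys (lift d r) \<subseteq> hz d ` keys r"
  proof
    fix t assume "t \<in> keys (lift d r)"
    then have "mdeg t = d" "unemb t \<in> keys r"
      by (auto simp: in_keys_iff lookup_lift[OF d] split: if_splits)
    then show "t \<in> hz d ` keys r" using hz_unemb[of t d] by (metis imageI)
  qed
  show "hz d ` keys r \<subseteq> keys (lift d r)"
    using d pdeg_ge[of _ r] by (force simp: in_keys_iff lookup_lift[OF d])
qed

lemma homogeneous_lift: "pdeg r \<le> d \<Longrightarrow> homogeneous d (lift d (r :: ('x::finite, 'k::comm_semiring_1) mpoly))"
  by (auto simp: homogeneous_def in_keys_iff lookup_lift split: if_splits)

lemma phom_eq_lift: "phom r = lift (pdeg r) (r :: ('x::finite, 'k::comm_semiring_1) mpoly)"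
  by (intro poly_mapping_eqI) (simp add: lookup_lift lookup_phom)

lemma lift_0 [simp]: "lift d 0 = 0"
  by (simp add: lift_def phom_def)

lemma lift_eq_0_iff: "pdeg r \<le> d \<Longrightarrow> lift d r = 0 \<longleftrightarrow> (r :: ('x::finite, 'k::comm_semiring_1) mpoly) = 0"
  using keys_lift[of r d] keys_ne_0[of r] keys_ne_0[of "lift d r"] by auto

lemma lift_minus:
  fixes p :: "('x::finite, 'k::comm_ring_1) mpoly"
  assumes "pdeg p \<le> d" "pdeg q \<le> d" shows "lift d (p - q) = lift d p - lift d q"
proof -
  have "pdeg (p - q) \<le> d"
    using assms keys_minus_subset[of p q] unfolding pdeg_le_iff by blast
  then show ?thesis using assms
    by (intro poly_mapping_eqI) (simp add: lookup_lift lookup_minus)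
qed

lemma pdeg_monom_mult_le:
  "pdeg h \<le> d \<Longrightarrow> pdeg (single m c * h) \<le> mdeg m + d" for h :: "('v::finite, 'k::semiring_1) mpoly"
  unfolding pdeg_le_iff by (auto elim!: keys_monom_mult)

text \<open>
  The two degrees \<open>d\<close> and \<open>s\<close> may exceed the actual degrees: for sugar degrees they do, and the
  missing powers of \<open>y\<close> are then split between the two factors.
\<close>

lemma lift_monom_mult:
  fixes h :: "('x::finite, 'k::comm_ring_1) mpoly"
  assumes "pdeg h \<le> s" "mdeg m + s \<le> d"
  shows "lift d (single m c * h) = single (hz (d - s) m) c * lift s h"
proof (rule poly_mapping_eqI)
  fix t :: "'x option mon"
  have pd: "pdeg (single m c * h) \<le> d" using pdeg_monom_mult_le[OF assms(1)] assms(2) by (rule order_trans)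
  show "lookup (lift d (single m c * h)) t = lookup (single (hz (d - s) m) c * lift s h) t"
  proof (cases "mdvd (hz (d - s) m) t")
    case True
    then obtain u where u: "t = u + hz (d - s) m" by (rule mdvdE)
    have "mdeg t = d \<longleftrightarrow> mdeg u = s" using assms by (auto simp: u)
    moreover have "lookup (single m c * h) (unemb t) = c * lookup h (unemb u)"
      using lookup_monom_mult_add[of m c h "unemb u"] by (simp add: u add.commute)
    moreover have "lookup (single (hz (d - s) m) c * lift s h) t = c * lookup (lift s h) u"
      using lookup_monom_mult_add[of "hz (d - s) m" c "lift s h" u] by (simp add: u add.commute)
    ultimately show ?thesis by (simp add: lookup_lift[OF pd] lookup_lift[OF assms(1)])
  next
    case False
    have "lookup (single m c * h) (unemb t) = 0" if t: "mdeg t = d"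
    proof (rule ccontr)
      assume "lookup (single m c * h) (unemb t) \<noteq> 0"
      then obtain u where u: "unemb t = m + u" "u \<in> keys h"
        by (metis in_keys_iff keys_monom_mult)
      have "mdeg u \<le> s" using pdeg_ge[OF u(2)] assms(1) by simp
      then have "d - s - mdeg m \<le> lookup t None" using t u(1) by (simp add: mdeg_option)
      then have "mdvd (hz (d - s) m) t" by (simp add: mdvd_option u(1))
      with False show False ..
    qed
    then show ?thesis using False by (simp add: lookup_lift[OF pd] lookup_monom_mult)
  qed
qed

lemma lm_lift:
  fixes r :: "('x::{finite,linorder}, 'k::comm_semiring_1) mpoly"
  assumes "pdeg r \<le> d" "r \<noteq> 0"
  shows "lm (lift d r) = hz d (lm r)" and "lc (lift d r) = lc r"
proof -
  have d: "mdeg (lm r) \<le> d" using assms pdeg_lm by metis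
  show l: "lm (lift d r) = hz d (lm r)"
  proof (rule lm_eqI)
    show "hz d (lm r) \<in> keys (lift d r)" using assms keys_lift lm_in_keys by blast
    fix s assume "s \<in> keys (lift d r)"
    then obtain u where "s = hz d u" "u \<in> keys r" using keys_lift[OF assms(1)] by auto
    then show "drl_le s (hz d (lm r))" using lm_max[OF assms(2)] d drl_le_hz by blast
  qed
  show "lc (lift d r) = lc r" using d by (simp add: lc_def l lookup_lift[OF assms(1)])
qed

lemma spec_superset:
  assumes "finite A" "keys p \<subseteq> A"
  shows "spec a p = (\<Sum>t\<in>A. single (unemb t) (lookup p t * a ^ lookup t None))"
  unfolding spec_def using assms
  by (intro sum.mono_neutral_left) (auto simp: in_keys_iff)

lemma spec_add [simp]: "spec a (p + q) = spec a p + spec a q"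
proof -
  let ?A = "keys p \<union> keys q"
  have "spec a (p + q) = (\<Sum>t\<in>?A. single (unemb t) (lookup (p + q) t * a ^ lookup t None))"
    using keys_add[of p q] by (intro spec_superset) auto
  also have "\<dots> = (\<Sum>t\<in>?A. single (unemb t) (lookup p t * a ^ lookup t None)) +
      (\<Sum>t\<in>?A. single (unemb t) (lookup q t * a ^ lookup t None))"
    by (simp add: lookup_add distrib_right single_add sum.distrib)
  also have "\<dots> = spec a p + spec a q" by (simp add: spec_superset[of ?A])
  finally show ?thesis .
qed

lemma spec_0 [simp]: "spec a 0 = 0"
  by (simp add: spec_def)

lemma spec_minus [simp]: "spec a (p - q) = spec a p - spec (a :: 'k::comm_ring_1) q"
  by (metis add_diff_cancel_right' diff_add_cancel spec_add)

lemma spec_sum: "spec a (\<Sum>i\<in>A. f i) = (\<Sum>i\<in>A. spec a (f i))"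
  by (induction A rule: infinite_finite_induct) simp_all

lemma spec_single: "spec a (single t c) = single (unemb t) (c * a ^ lookup t None)"
  by (cases "c = 0") (simp_all add: spec_def)

lemma spec_mult [simp]: "spec a (p * q) = spec a p * spec (a :: 'k::comm_ring_1) q"
proof -
  have single: "spec a (single s c * single t e) = spec a (single s c) * spec a (single t e)" for s t c e
    by (simp add: mult_single spec_single lookup_add power_add algebra_simps)
  then have "spec a ((\<Sum>s\<in>keys p. single s (lookup p s)) * (\<Sum>t\<in>keys q. single t (lookup q t)))
     = spec a (\<Sum>s\<in>keys p. single s (lookup p s)) * spec a (\<Sum>t\<in>keys q. single t (lookup q t))"
    by (simp only: sum_product spec_sum single)
  then show ?thesis by (simp flip: poly_as_sum)
qed

lemma lookup_spec0: "lookup (spec (0 :: 'k::comm_ring_1) p) u = lookup p (emb u)"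
proof -
  have "lookup (spec 0 p) u = (\<Sum>t\<in>keys p. lookup p t * 0 ^ lookup t None when unemb t = u)"
    by (simp add: spec_def lookup_sum lookup_single)
  also have "\<dots> = (\<Sum>t\<in>keys p. if t = emb u then lookup p (emb u) else 0)"
    by (intro sum.cong) (auto simp: when_def power_0_left emb_unemb split: if_splits)
  also have "\<dots> = lookup p (emb u)" by (simp add: in_keys_iff)
  finally show ?thesis .
qed

text \<open>
  On homogeneous polynomials no two monomials are merged by \<open>y = a\<close>.
\<close>

lemma lookup_spec_homogeneous:
  fixes p :: "('x::finite option, 'k::comm_ring_1) mpoly"
  assumes "homogeneous d p"
  shows "lookup (spec a p) u = (if mdeg u \<le> d then lookup p (hz d u) * a ^ (d - mdeg u) else 0)"
proof -
  have "lookup (spec a p) u = (\<Sum>t\<in>keys p. lookup p t * a ^ lookup t None when unemb t = u)"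
    by (simp add: spec_def lookup_sum lookup_single)
  also have "\<dots> = (\<Sum>t\<in>keys p. if t = hz d u
      then (if mdeg u \<le> d then lookup p (hz d u) * a ^ (d - mdeg u) else 0) else 0)"
  proof (rule sum.cong)
    fix t assume "t \<in> keys p"
    then have t: "mdeg t = d" using assms by (simp add: homogeneous_def)
    then have "unemb t = u \<longleftrightarrow> t = hz d u" using hz_unemb[of t d] by (metis unemb_hz)
    moreover have "t = hz d u \<Longrightarrow> mdeg u \<le> d" using t mdeg_unemb_le[of t] by simp
    ultimately show "(lookup p t * a ^ lookup t None when unemb t = u) = (if t = hz d u
        then (if mdeg u \<le> d then lookup p (hz d u) * a ^ (d - mdeg u) else 0) else 0)"
      by (auto simp: when_def)
  qed simp
  also have "\<dots> = (if mdeg u \<le> d then lookup p (hz d u) * a ^ (d - mdeg u) else 0)"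
    by (auto simp: in_keys_iff)
  finally show ?thesis .
qed

lemma pdeg_spec_le:
  fixes p :: "('x::finite option, 'k::comm_ring_1) mpoly"
  assumes "homogeneous d p" shows "pdeg (spec a p) \<le> d"
  unfolding pdeg_le_iff
  by (auto simp: in_keys_iff lookup_spec_homogeneous[OF assms] split: if_splits)

lemma lift_spec1:
  fixes p :: "('x::finite option, 'k::comm_ring_1) mpoly"
  assumes "homogeneous d p" shows "lift d (spec 1 p) = p"
proof (rule poly_mapping_eqI)
  fix t
  show "lookup (lift d (spec 1 p)) t = lookup p t"
  proof (cases "mdeg t = d")
    case True
    then show ?thesis using hz_unemb[OF True] mdeg_unemb_le[of t]
      by (simp add: lookup_lift[OF pdeg_spec_le[OF assms]] lookup_spec_homogeneous[OF assms])
  next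
    case False
    then have "t \<notin> keys p" using assms by (auto simp: homogeneous_def)
    with False show ?thesis by (simp add: lookup_lift[OF pdeg_spec_le[OF assms]] in_keys_iff)
  qed
qed

lemma spec1_lift:
  fixes r :: "('x::finite, 'k::comm_ring_1) mpoly"
  assumes "pdeg r \<le> d" shows "spec 1 (lift d r) = r"
proof (rule poly_mapping_eqI)
  fix t
  show "lookup (spec 1 (lift d r)) t = lookup r t"
  proof (cases "mdeg t \<le> d")
    case False
    then have "t \<notin> keys r" using pdeg_ge[of t r] assms by auto
    with False show ?thesis
      by (simp add: lookup_spec_homogeneous[OF homogeneous_lift[OF assms]] in_keys_iff)
  qed (simp add: lookup_lift[OF assms] lookup_spec_homogeneous[OF homogeneous_lift[OF assms]])
qed

lemma spec1_phom: "spec 1 (phom f) = (f :: ('x::finite, 'k::comm_ring_1) mpoly)"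
  by (simp add: phom_eq_lift spec1_lift)

lemma spec0_phom: "spec 0 (phom f) = ptop (f :: ('x::finite, 'k::comm_ring_1) mpoly)"
  by (intro poly_mapping_eqI) (simp add: lookup_spec0 lookup_phom ptop_eq_hcomp)

lemma homogeneous_phom: "homogeneous (pdeg f) (phom (f :: ('x::finite, 'k::comm_semiring_1) mpoly))"
  by (simp add: phom_eq_lift homogeneous_lift)

lemma phom_eq_0_iff: "phom f = 0 \<longleftrightarrow> (f :: ('x::finite, 'k::comm_semiring_1) mpoly) = 0"
  by (simp add: phom_eq_lift lift_eq_0_iff)

lemma pdeg_phom: "f \<noteq> 0 \<Longrightarrow> pdeg (phom (f :: ('x::finite, 'k::comm_semiring_1) mpoly)) = pdeg f"
  by (rule homogeneous_pdeg[OF homogeneous_phom]) (simp add: phom_eq_0_iff)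

lemma lm_phom: "f \<noteq> 0 \<Longrightarrow> lm (phom (f :: ('x::{finite,linorder}, 'k::comm_semiring_1) mpoly)) = emb (lm f)"
  by (simp add: phom_eq_lift lm_lift pdeg_lm hz_eq_emb)

text \<open>
  The monomials in which \<open>y\<close> does not occur are the largest ones of their degree.  Hence a
  homogeneous polynomial whose leading monomial avoids \<open>y\<close> keeps it under \<open>y = a\<close>.
\<close>

lemma lm_spec:
  fixes h :: "('x::{finite,linorder} option, 'k::comm_ring_1) mpoly"
  assumes hom: "homogeneous d h" and "h \<noteq> 0" and free: "lookup (lm h) None = 0"
  shows "emb (lm (spec a h)) = lm h" and "lc (spec a h) = lc h" and "spec a h \<noteq> 0"
    and "pdeg (spec a h) = d"
proof -
  let ?u = "unemb (lm h)"
  have d: "mdeg (lm h) = d" using homogeneous_mdeg_lm[OF hom \<open>h \<noteq> 0\<close>] .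
  then have u: "mdeg ?u = d" using free by (simp add: mdeg_option)
  have hz: "hz d ?u = lm h" using hz_unemb[OF d] .
  have lc: "lookup (spec a h) ?u = lc h"
    by (simp add: lookup_spec_homogeneous[OF hom] u hz lc_def)
  then have "?u \<in> keys (spec a h)" using lc_ne_0[OF \<open>h \<noteq> 0\<close>] by (simp add: in_keys_iff)
  then show nz: "spec a h \<noteq> 0" by auto
  have "lm (spec a h) = ?u"
  proof (rule lm_eqI)
    show "?u \<in> keys (spec a h)" by fact
    fix s assume "s \<in> keys (spec a h)"
    then have s: "mdeg s \<le> d" "hz d s \<in> keys h"
      by (auto simp: in_keys_iff lookup_spec_homogeneous[OF hom] split: if_splits)
    have le: "drl_le (hz d s) (lm h)" using lm_max[OF \<open>h \<noteq> 0\<close> s(2)] .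
    show "drl_le s ?u"
    proof (rule ccontr)
      assume "\<not> drl_le s ?u"
      then have "drl_less ?u s" by (simp flip: not_drl_less)
      then have "drl_less (hz d ?u) (hz d s)" using s(1) by (rule drl_less_hz)
      then show False using le hz by (metis drl_less_le_trans drl_less_irrefl)
    qed
  qed
  then show "emb (lm (spec a h)) = lm h" and "lc (spec a h) = lc h" and "pdeg (spec a h) = d"
    using lc emb_unemb[OF free] u nz by (simp_all add: lc_def pdeg_lm)
qed

lemma lm_ptop:
  fixes f :: "('x::{finite,linorder}, 'k::comm_ring_1) mpoly"
  assumes "f \<noteq> 0"
  shows "ptop f \<noteq> 0" and "pdeg (ptop f) = pdeg f"
  using lm_spec(3,4)[OF homogeneous_phom[of f], of 0] assms
  by (simp_all add: phom_eq_0_iff lm_phom spec0_phom)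

lemma homogeneous_ptop: "homogeneous (pdeg f) (ptop f)"
  by (simp add: ptop_eq_hcomp homogeneous_hcomp)

abbreviation yvar :: "('x option, 'k::comm_ring_1) mpoly" where
  "yvar \<equiv> single (ypow 1) 1"

lemma divide_by_y:
  fixes p :: "('x::finite option, 'k::comm_ring_1) mpoly"
  assumes "spec 0 p = 0"
  obtains c where "p = yvar * c" "\<And>d. homogeneous (d + 1) p \<Longrightarrow> homogeneous d c"
proof -
  define c where "c = Poly_Mapping.map_key (\<lambda>t. t + ypow 1) p"
  have inj: "inj (\<lambda>t :: 'x option mon. t + ypow 1)" by (rule injI) simp
  have c: "lookup c t = lookup p (t + ypow 1)" for t
    using inj by (simp add: c_def map_key.rep_eq)
  have "p = yvar * c"
  proof (rule poly_mapping_eqI)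
    fix t
    show "lookup p t = lookup (yvar * c) t"
    proof (cases "lookup t None = 0")
      case True
      then have "lookup p t = 0" using assms lookup_spec0[of p "unemb t"] by (simp add: emb_unemb)
      moreover have "\<not> mdvd (ypow 1) t" using True by (simp add: mdvd_option)
      ultimately show ?thesis by (simp add: lookup_monom_mult)
    next
      case False
      then have dv: "mdvd (ypow 1) t" by (auto simp: mdvd_option) (simp add: mdvd_def)
      then show ?thesis by (simp add: lookup_monom_mult c mdvd_minus_add)
    qed
  qed
  moreover have "homogeneous d c" if "homogeneous (d + 1) p" for d
    unfolding homogeneous_def
  proof
    fix t assume "t \<in> keys c"
    then have "t + ypow 1 \<in> keys p" by (simp add: in_keys_iff c)
    then have "mdeg (t + ypow 1) = d + 1" using that unfolding homogeneous_def by blast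
    then show "mdeg t = d" by simp
  qed
  ultimately show thesis by (rule that)
qed

lemma yvar_mult_cancel: "yvar * p = yvar * q \<Longrightarrow> p = (q :: ('x option, 'k::comm_ring_1) mpoly)"
  by (intro poly_mapping_eqI) (metis lookup_monom_mult_add mult_1)


section \<open>Regularity of the homogenizing variable\<close>

text \<open>
  Triviality of the syzygies of the top parts in degrees below \<open>D\<close>, in stepwise form: each one is a
  nonzerodivisor modulo the preceding ones.
\<close>

definition no_syzygies_below :: "enat \<Rightarrow> ('x::finite, 'k::field) mpoly list \<Rightarrow> bool" where
  "no_syzygies_below D fs \<longleftrightarrow>
     (\<forall>hs h gs c a. fs = hs @ [h] @ gs \<longrightarrow> homogeneous c a \<longrightarrow> enat (c + pdeg h) < D \<longrightarrow>
        a * ptop h \<in> ideal_gen (ptop ` set hs) \<longrightarrow> a \<in> ideal_gen (ptop ` set hs))"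

lemma ideal_gen_spec:
  fixes q :: "('x::finite option, 'k::comm_ring_1) mpoly"
  assumes "q \<in> ideal_gen H" shows "spec a q \<in> ideal_gen (spec a ` H)"
  using assms
  by (induction rule: ideal_gen_induct)
    (auto intro: ideal_gen_zero ideal_gen_add ideal_gen_mult ideal_gen_base)

text \<open>
  Replace the generators in a representation by their homogenizations and keep the coefficients.
\<close>

lemma ideal_gen_ptop_lift:
  fixes q :: "('x::finite, 'k::field) mpoly"
  assumes "q \<in> ideal_gen (ptop ` S)" "homogeneous k q"
  obtains Q where "Q \<in> ideal_gen (phom ` S)" "homogeneous k Q" "spec 0 Q = q"
proof -
  have "\<exists>Q\<in>ideal_gen (phom ` S). spec 0 Q = q" using assms(1)
  proof (induction rule: ideal_gen_induct)
    case base
    show ?case using ideal_gen_zero by (intro bexI[of _ 0]) auto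
  next
    case (step c x y)
    then obtain f Y where f: "x = ptop f" "f \<in> S" "Y \<in> ideal_gen (phom ` S)" "spec 0 Y = y" by auto
    define C where "C = (\<Sum>t\<in>keys c. single (emb t) (lookup c t))"
    have "spec 0 C = c" by (simp add: C_def spec_sum spec_single flip: poly_as_sum)
    then have "spec 0 (C * phom f + Y) = c * x + y" using f by (simp add: spec0_phom)
    moreover have "C * phom f + Y \<in> ideal_gen (phom ` S)"
      using f by (intro ideal_gen_add ideal_gen_mult[OF ideal_gen_base]) auto
    ultimately show ?case by blast
  qed
  then obtain Q where Q: "Q \<in> ideal_gen (phom ` S)" "spec 0 Q = q" by blast
  have "spec 0 (hcomp k Q) = hcomp k (spec 0 Q)"
    by (intro poly_mapping_eqI) (simp add: lookup_spec0)
  then have "spec 0 (hcomp k Q) = q" using Q(2) assms(2) by (simp add: hcomp_id)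
  moreover have "hcomp k Q \<in> ideal_gen (phom ` S)"
    using Q(1) by (rule hcomp_ideal_gen)
      (auto, metis homogeneous_0 homogeneous_pdeg homogeneous_phom)
  ultimately show thesis using that homogeneous_hcomp by blast
qed

text \<open>
  Setting \<open>y = 0\<close> in \<open>y g = a f\<^sup>h + q\<close> gives a syzygy of the top parts, so \<open>a\<close> is congruent
  modulo \<open>y\<close> to an element \<open>b\<close> of the ideal of the previous forms; with \<open>a = b + y c\<close>, the
  claim for \<open>g - c f\<^sup>h\<close> and the previous forms remains.
\<close>

lemma y_nonzerodivisor:
  fixes fs :: "('x::{finite,linorder}, 'k::field) mpoly list"
  assumes "no_syzygies_below D fs" "0 \<notin> set fs"
    and "homogeneous c g" "enat (c + 1) < D" "yvar * g \<in> ideal_gen (phom ` set fs)"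
  shows "g \<in> ideal_gen (phom ` set fs)"
  using assms
proof (induction fs arbitrary: g rule: rev_induct)
  case Nil
  then have "yvar * g = yvar * 0" by (simp add: ideal_gen_empty)
  then have "g = 0" by (rule yvar_mult_cancel)
  then show ?case by (simp add: ideal_gen_zero)
next
  case (snoc f fs)
  let ?I = "ideal_gen (phom ` set fs)"
  have "no_syzygies_below D fs" unfolding no_syzygies_below_def
  proof (intro allI impI)
    fix hs h gs c' a
    assume *: "fs = hs @ [h] @ gs" "homogeneous c' a" "enat (c' + pdeg h) < D"
      "a * ptop h \<in> ideal_gen (ptop ` set hs)"
    then have "fs @ [f] = hs @ [h] @ (gs @ [f])" by simp
    with * snoc.prems(1) show "a \<in> ideal_gen (ptop ` set hs)" unfolding no_syzygies_below_def by blast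
  qed
  then have IH: "homogeneous c g' \<Longrightarrow> yvar * g' \<in> ?I \<Longrightarrow> g' \<in> ?I" for g'
    using snoc.IH[of g'] snoc.prems by auto
  have nz: "f \<noteq> 0" using snoc.prems by auto
  have hom: "homogeneous (c + 1) (yvar * g)"
    using snoc.prems(3) by (intro homogeneous_monom_mult) auto
  have gens: "homogeneous (pdeg h) h" if "h \<in> insert (phom f) (phom ` set fs)" for h
    using that by (auto, (metis homogeneous_0 homogeneous_pdeg homogeneous_phom)+)
  have "yvar * g \<in> ideal_gen (insert (phom f) (phom ` set fs))" using snoc.prems(5) by simp
  then obtain a q where aq: "yvar * g = a * phom f + q" "q \<in> ?I" "homogeneous (c + 1) q"
    and a: "pdeg f \<le> c + 1 \<Longrightarrow> homogeneous (c + 1 - pdeg f) a" "\<not> pdeg f \<le> c + 1 \<Longrightarrow> a = 0"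
    using ideal_gen_insert_homogeneous[OF _ hom gens] pdeg_phom[OF nz] by metis
  have mono: "?I \<subseteq> ideal_gen (phom ` set (fs @ [f]))" by (rule ideal_gen_mono) auto
  show ?case
  proof (cases "pdeg f \<le> c + 1")
    case False
    then have "yvar * g \<in> ?I" using aq a by simp
    then show ?thesis using IH[OF snoc.prems(3)] mono by auto
  next
    case True
    let ?e = "c + 1 - pdeg f"
    have ha: "homogeneous ?e a" using a True by simp
    have "0 = spec 0 (a * phom f + q)" by (simp flip: aq(1) add: spec_single)
    then have eq: "spec 0 a * ptop f = - spec 0 q" by (simp add: spec0_phom eq_neg_iff_add_eq_0)
    have "spec 0 q \<in> ideal_gen (ptop ` set fs)"
      using ideal_gen_spec[OF aq(2), of 0] by (simp add: image_image spec0_phom)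
    then have "spec 0 a * ptop f \<in> ideal_gen (ptop ` set fs)"
      unfolding eq using ideal_gen_mult[of "spec 0 q" _ "-1"] by simp
    moreover have "homogeneous ?e (spec 0 a)"
      using ha unfolding homogeneous_def by (metis in_keys_iff lookup_spec0 mdeg_emb)
    moreover have "enat (?e + pdeg f) < D" using True snoc.prems(4) by simp
    ultimately have "spec 0 a \<in> ideal_gen (ptop ` set fs)"
      using snoc.prems(1)[unfolded no_syzygies_below_def, rule_format, of fs f "[]" ?e "spec 0 a"]
      by simp
    then obtain b where b: "b \<in> ?I" "homogeneous ?e b" "spec 0 b = spec 0 a"
      using \<open>homogeneous ?e (spec 0 a)\<close> by (rule ideal_gen_ptop_lift)
    then have "spec 0 (a - b) = 0" by simp
    then obtain c' where c': "a - b = yvar * c'"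
      "\<And>d. homogeneous (d + 1) (a - b) \<Longrightarrow> homogeneous d c'"
      using divide_by_y[of "a - b"] by blast
    have hab: "homogeneous ?e (a - b)" using ha b(2) by (rule homogeneous_minus)
    have "yvar * (g - c' * phom f) = b * phom f + q"
      using aq(1) c'(1) by (simp add: algebra_simps)
    moreover have "b * phom f + q \<in> ?I"
      using ideal_gen_mult[OF b(1), of "phom f"] aq(2) by (simp add: ideal_gen_add mult.commute)
    \<comment> \<open>For \<open>?e = 0\<close> the difference \<open>a - b\<close> is a constant divisible by \<open>y\<close>, hence zero.\<close>
    moreover have "homogeneous c (c' * phom f)"
    proof (cases "?e")
      case 0
      have "a - b = yvar * c'" "homogeneous 0 (a - b)" using c' hab 0 by auto
      have "c' = 0"
      proof (rule ccontr)
        assume "c' \<noteq> 0"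
        then obtain t where "t \<in> keys c'" using keys_ne_0[of c'] by blast
        then have "ypow 1 + t \<in> keys (a - b)" unfolding c'(1) by (simp add: in_keys_iff)
        then have "mdeg (ypow 1 + t) = 0" using hab 0 unfolding homogeneous_def by metis
        then show False by simp
      qed
      then show ?thesis by simp
    next
      case (Suc d)
      then have "homogeneous d c'" using c'(2)[of d] hab by simp
      then have "homogeneous (d + pdeg f) (c' * phom f)" using homogeneous_phom by (rule homogeneous_mult)
      moreover have "d + pdeg f = c" using Suc True by simp
      ultimately show ?thesis by simp
    qed
    ultimately have "g - c' * phom f \<in> ?I"
      using IH[of "g - c' * phom f"] homogeneous_minus[OF snoc.prems(3)] by metis
    then have "g - c' * phom f \<in> ideal_gen (phom ` set (fs @ [f]))" using mono by auto
    moreover have "c' * phom f \<in> ideal_gen (phom ` set (fs @ [f]))"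
      by (intro ideal_gen_mult ideal_gen_base) auto
    ultimately have "g - c' * phom f + c' * phom f \<in> ideal_gen (phom ` set (fs @ [f]))"
      by (rule ideal_gen_add)
    then show ?thesis by simp
  qed
qed

lemma one_in_ideal_dreg:
  assumes "1 \<in> I" "I = ideal_gen H" shows "dreg (I :: ('v, 'k::comm_ring_1) mpoly set) = 0"
proof -
  have "p \<in> I" for p using ideal_gen_mult[of 1 H p] assms by simp
  then have "enat 0 \<in> enat ` {d. \<forall>p. homogeneous d p \<longrightarrow> p \<in> I}" by blast
  then have "dreg I \<le> enat 0" unfolding dreg_def by (rule Inf_lower)
  then show ?thesis by (simp add: enat_0)
qed

text \<open>
  A constant among the polynomials would put 1 into the ideal of the top parts and make the degree
  of regularity zero; so all degrees are positive, as the comparison of the series requires.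
\<close>

lemma semiregular_no_syzygies:
  fixes fs :: "('x::{finite,linorder}, 'k::field) mpoly list"
  assumes nz: "0 \<notin> set fs" and sr: "crypto_semiregular (map ptop fs)"
    and D: "D = dreg (ideal_gen (set (map ptop fs)))" "0 < D"
  shows "no_syzygies_below D fs" and "f \<in> set fs \<Longrightarrow> 0 < pdeg f"
proof -
  show pos: "0 < pdeg f" if f: "f \<in> set fs" for f
  proof (rule ccontr)
    assume "\<not> 0 < pdeg f"
    then have hom: "homogeneous 0 (ptop f)" using homogeneous_ptop[of f] by simp
    have nzf: "ptop f \<noteq> 0" using f nz lm_ptop(1) by metis
    then obtain t where t: "t \<in> keys (ptop f)" using keys_ne_0[of "ptop f"] by blast
    define k where "k = lookup (ptop f) 0"
    have "t = 0" using hom t by (auto simp: homogeneous_def mdeg_eq_0_iff)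
    with t have "k \<noteq> 0" by (simp add: k_def in_keys_iff)
    have "ptop f = single 0 k"
    proof (rule poly_mapping_eqI)
      fix t show "lookup (ptop f) t = lookup (single 0 k) t"
        using hom by (cases "t = 0")
          (auto simp: k_def homogeneous_def mdeg_eq_0_iff in_keys_iff lookup_single)
    qed
    then have "single 0 (1 / k) * ptop f = 1" using \<open>k \<noteq> 0\<close> by (simp add: mult_single)
    moreover have "single 0 (1 / k) * ptop f \<in> ideal_gen (set (map ptop fs))"
      using f by (intro ideal_gen_mult ideal_gen_base) auto
    ultimately have "dreg (ideal_gen (set (map ptop fs))) = 0" by (intro one_in_ideal_dreg) auto
    with D show False by simp
  qed
  show "no_syzygies_below D fs" unfolding no_syzygies_below_def
  proof (intro allI impI)
    fix hs h gs c and a :: "('x, 'k) mpoly"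
    assume *: "fs = hs @ [h] @ gs" "homogeneous c a" "enat (c + pdeg h) < D"
      "a * ptop h \<in> ideal_gen (ptop ` set hs)"
    have "\<exists>d. c + pdeg h < d \<and> d_regular d (map ptop fs)"
    proof (cases D)
      case (enat d)
      then show ?thesis using sr D * by (auto simp: crypto_semiregular_def)
    next
      case infinity
      then show ?thesis using sr D by (auto simp: crypto_semiregular_def)
    qed
    then obtain d where d: "c + pdeg h < d" "d_regular d (map ptop hs @ [ptop h] @ map ptop gs)"
      using *(1) by auto
    have nzh: "h \<noteq> 0" using *(1) nz by auto
    have "a \<in> ideal_gen (set (map ptop hs))"
    proof (rule d_regular_mult_injective[OF d(2) _ *(2)])
      fix g assume "g \<in> set (map ptop hs @ [ptop h] @ map ptop gs)"
      then obtain f where f: "g = ptop f" "f \<in> set fs" using *(1) by auto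
      moreover have "f \<noteq> 0" using f nz by auto
      ultimately show "homogeneous (pdeg g) g \<and> 0 < pdeg g"
        using pos homogeneous_ptop[of f] lm_ptop(2)[of f] by simp
    qed (use d(1) * nzh lm_ptop(2)[of h] in auto)
    then show "a \<in> ideal_gen (ptop ` set hs)" by simp
  qed
qed

section \<open>The truncated Buchberger criterion\<close>

text \<open>
  The polynomials with a representation \<open>\<Sum> c * s * g\<close> in which all monomials \<open>s * lm g\<close> satisfy
  \<open>P\<close>.  Bounds on these monomials are what Buchberger's criterion is about.
\<close>

definition span_if :: "('v::{finite,linorder}, 'k::field) mpoly set \<Rightarrow> ('v mon \<Rightarrow> bool) \<Rightarrow>
    ('v, 'k) mpoly set" where
  "span_if B P = kv.span {single s 1 * g | s g. g \<in> B \<and> P (s + lm g)}"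

abbreviation span_below where "span_below B T \<equiv> span_if B (\<lambda>u. drl_less u T)"
abbreviation span_upto where "span_upto B T \<equiv> span_if B (\<lambda>u. drl_le u T)"

lemma span_if_base: "g \<in> B \<Longrightarrow> P (s + lm g) \<Longrightarrow> single s c * g \<in> span_if B P"
proof -
  assume "g \<in> B" "P (s + lm g)"
  then have "single s 1 * g \<in> span_if B P" unfolding span_if_def by (intro kv.span_base) blast
  then have "kscale c (single s 1 * g) \<in> span_if B P" unfolding span_if_def by (rule kv.span_scale)
  then show ?thesis by (simp add: mult_single flip: mult.assoc)
qed

lemma span_if_0: "0 \<in> span_if B P"
  unfolding span_if_def by (rule kv.span_zero)

lemma span_if_add: "p \<in> span_if B P \<Longrightarrow> q \<in> span_if B P \<Longrightarrow> p + q \<in> span_if B P"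
  unfolding span_if_def by (rule kv.span_add)

lemma span_if_diff: "p \<in> span_if B P \<Longrightarrow> q \<in> span_if B P \<Longrightarrow> p - q \<in> span_if B P"
  unfolding span_if_def by (rule kv.span_diff)

lemma span_if_scale: "p \<in> span_if B P \<Longrightarrow> kscale c p \<in> span_if B P"
  unfolding span_if_def by (rule kv.span_scale)

lemma span_if_sum: "(\<And>i. i \<in> A \<Longrightarrow> f i \<in> span_if B P) \<Longrightarrow> sum f A \<in> span_if B P"
  unfolding span_if_def by (rule kv.span_sum)

lemma span_if_mono:
  assumes "B \<subseteq> B'" "\<And>u. P u \<Longrightarrow> P' u" "p \<in> span_if B P"
  shows "p \<in> span_if B' P'"
proof -
  have "{single s 1 * g | s g. g \<in> B \<and> P (s + lm g)} \<subseteq> {single s 1 * g | s g. g \<in> B' \<and> P' (s + lm g)}"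
    using assms(1,2) by blast
  then show ?thesis using assms(3) kv.span_mono unfolding span_if_def by blast
qed

lemma span_if_induct [consumes 1, case_names base step]:
  assumes "p \<in> span_if B P" "Q 0"
    and "\<And>c s g q. g \<in> B \<Longrightarrow> P (s + lm g) \<Longrightarrow> q \<in> span_if B P \<Longrightarrow> Q q \<Longrightarrow> Q (kscale c (single s 1 * g) + q)"
  shows "Q p"
proof -
  have "p \<in> span_if B P \<and> Q p"
    using assms(1)[unfolded span_if_def]
  proof (induction rule: kv.span_induct_alt)
    case base
    show ?case using assms(2) span_if_0 by simp
  next
    case (step c x y)
    then obtain s g where x: "x = single s 1 * g" "g \<in> B" "P (s + lm g)" by auto
    then show ?case using step assms(3) by (auto intro!: span_if_add span_if_scale span_if_base)
  qed
  then show ?thesis ..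
qed

lemma span_if_monom_mult:
  assumes "p \<in> span_if B P" "\<And>v. P v \<Longrightarrow> P' (u + v)"
  shows "single u 1 * p \<in> span_if B P'"
  using assms(1)
proof (induction rule: span_if_induct)
  case base
  then show ?case by (simp add: span_if_0)
next
  case (step c s g q)
  have "single (u + s) c * g \<in> span_if B P'"
    using step assms(2)[of "s + lm g"] by (intro span_if_base) (auto simp: add.assoc)
  moreover have "single u 1 * (kscale c (single s 1 * g) + q) = single (u + s) c * g + single u 1 * q"
    by (simp add: distrib_left mult_single flip: mult.assoc)
  ultimately show ?case using step by (simp add: span_if_add)
qed

text \<open>
  A representation is finite, so \<open>T\<close> can be the largest monomial that occurs in it.
\<close>

lemma span_if_upto:
  assumes "p \<in> span_if B P" "p \<noteq> 0"
  shows "\<exists>T. P T \<and> p \<in> span_upto B T"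
proof -
  have "p = 0 \<or> (\<exists>T. P T \<and> p \<in> span_upto B T)" using assms(1)
  proof (induction rule: span_if_induct)
    case base
    then show ?case by simp
  next
    case (step c s g q)
    let ?U = "s + lm g"
    have U: "kscale c (single s 1 * g) \<in> span_upto B ?U"
      using step by (intro span_if_scale span_if_base) auto
    from step(4) show ?case
    proof
      assume "q = 0"
      with U step(2) show ?case by auto
    next
      assume "\<exists>T. P T \<and> q \<in> span_upto B T"
      then obtain T where T: "P T" "q \<in> span_upto B T" by blast
      show ?case
      proof (cases "drl_le ?U T")
        case True
        have "kscale c (single s 1 * g) \<in> span_upto B T"
          by (rule span_if_mono[OF _ _ U]) (use True drl_le_trans in auto)
        with T show ?thesis by (auto intro: span_if_add)
      next
        case False
        then have "drl_le T ?U" using drl_less_linear[of ?U T] by (auto simp: drl_le_def)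
        then have "q \<in> span_upto B ?U"
          by (intro span_if_mono[OF _ _ T(2)]) (use drl_le_trans in auto)
        with U step(2) show ?thesis by (auto intro: span_if_add)
      qed
    qed
  qed
  with assms(2) show ?thesis by blast
qed

lemma span_if_keys:
  assumes "p \<in> span_if B P" "0 \<notin> B" "\<And>u v. P u \<Longrightarrow> drl_le v u \<Longrightarrow> P v" "t \<in> keys p"
  shows "P t"
  using assms(1,4)
proof (induction rule: span_if_induct)
  case (step c s g q)
  have "t \<in> keys (kscale c (single s 1 * g)) \<or> t \<in> keys q"
    using step.prems keys_add[of "kscale c (single s 1 * g)" q] by blast
  then show ?case
  proof
    assume "t \<in> keys (kscale c (single s 1 * g))"
    then have "t \<in> keys (single s c * g)" by (simp add: mult_single flip: mult.assoc)
    then obtain u where u: "t = s + u" "u \<in> keys g" by (rule keys_monom_mult)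
    have "g \<noteq> 0" using step(1) assms(2) by auto
    then have "drl_le (s + u) (s + lm g)" using lm_max u(2) by simp
    then show "P t" using assms(3) step(2) u(1) by blast
  qed (use step in blast)
qed simp

text \<open>
  The multiple of \<open>g\<close> by a term that has leading term \<open>T\<close>.  Differences of such multiples are
  multiples of S-polynomials.
\<close>

definition monic_multiple :: "'v mon \<Rightarrow> ('v::linorder, 'k::field) mpoly \<Rightarrow> ('v, 'k) mpoly" where
  "monic_multiple T g = single (T - lm g) (1 / lc g) * g"

lemma monic_multiple_diff:
  fixes g1 g2 :: "('v::{finite,linorder}, 'k::field) mpoly"
  assumes "mdvd (mlcm (lm g1) (lm g2)) T"
  shows "monic_multiple T g1 - monic_multiple T g2
      = single (T - mlcm (lm g1) (lm g2)) 1 * spoly g1 g2"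
proof -
  let ?L = "mlcm (lm g1) (lm g2)"
  have "(T - ?L) + (?L - lm g) = T - lm g" if "mdvd (lm g) ?L" for g :: "('v, 'k) mpoly"
  proof (rule poly_mapping_eqI)
    fix v
    have "lookup (lm g) v \<le> lookup ?L v" "lookup ?L v \<le> lookup T v"
      using that assms unfolding mdvd_def by blast+
    then show "lookup ((T - ?L) + (?L - lm g)) v = lookup (T - lm g) v"
      by (simp add: lookup_add lookup_minus del: lookup_mlcm)
  qed
  then show ?thesis
    by (simp add: monic_multiple_def spoly_def right_diff_distrib mult_single flip: mult.assoc)
qed

lemma lookup_monic_multiple:
  "g \<noteq> (0 :: ('v::{finite,linorder}, 'k::field) mpoly) \<Longrightarrow> mdvd (lm g) T \<Longrightarrow>
    lookup (monic_multiple T g) T = 1"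
  using lookup_monom_mult_add[of "T - lm g" "1 / lc g" g "lm g"] lc_ne_0[of g]
  by (simp add: monic_multiple_def mdvd_minus_add lc_def)

text \<open>Buchberger's product criterion: with \<open>p = m\<^sub>1 + p'\<close> and \<open>q = m\<^sub>2 + q'\<close> monic, the
  S-polynomial \<open>m\<^sub>2 p - m\<^sub>1 q\<close> equals \<open>p' q - q' p\<close>.\<close>

lemma spoly_coprime:
  fixes g1 g2 :: "('v::{finite,linorder}, 'k::field) mpoly"
  assumes nz: "g1 \<noteq> 0" "g2 \<noteq> 0" and B: "g1 \<in> B" "g2 \<in> B" and cop: "mcoprime (lm g1) (lm g2)"
  shows "spoly g1 g2 \<in> span_below B (mlcm (lm g1) (lm g2))"
proof -
  let ?L = "mlcm (lm g1) (lm g2)"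
  have L: "?L = lm g1 + lm g2" using cop by (rule mcoprime_mlcm)
  define tl where "tl g = g - single (lm g) (lc g)" for g :: "('v, 'k) mpoly"
  have tl: "drl_less t (lm g)" if "g \<noteq> 0" "t \<in> keys (tl g)" for g t
    using that lm_max[of g t]
    by (auto simp: tl_def in_keys_iff lookup_minus lookup_single drl_le_def lc_def when_def split: if_splits)
  have mem: "kscale c (tl g * h) \<in> span_below B ?L"
    if "g \<noteq> 0" "h \<in> B" "lm g + lm h = ?L" for c g h
  proof -
    have "tl g * h = (\<Sum>t\<in>keys (tl g). single t (lookup (tl g) t)) * h"
      by (simp flip: poly_as_sum)
    also have "\<dots> = (\<Sum>t\<in>keys (tl g). single t (lookup (tl g) t) * h)" by (rule sum_distrib_right)
    also have "\<dots> \<in> span_below B ?L"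
    proof (intro span_if_sum span_if_base)
      fix t assume "t \<in> keys (tl g)"
      then have "drl_less (lm h + t) (lm h + lm g)" using tl[OF that(1)] by simp
      then show "drl_less (t + lm h) ?L" using that(3) by (simp add: add.commute)
    qed (use that in auto)
    finally show ?thesis by (rule span_if_scale)
  qed
  have "?L - lm g1 = lm g2" "?L - lm g2 = lm g1"
    using add_minus_mon[of "lm g2" "lm g1"] add_minus_mon[of "lm g1" "lm g2"] by (simp_all add: L add.commute)
  then have sp: "spoly g1 g2 = single (lm g2) (1 / lc g1) * g1 - single (lm g1) (1 / lc g2) * g2"
    by (simp add: spoly_def)
  have lc: "lc g1 \<noteq> 0" "lc g2 \<noteq> 0" using nz lc_ne_0 by auto
  define k where "k = 1 / (lc g1 * lc g2)"
  have k: "single (lm g2) (1 / lc g1) = kscale k (single (lm g2) (lc g2))"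
    "single (lm g1) (1 / lc g2) = kscale k (single (lm g1) (lc g1))"
    using lc by (simp_all add: k_def mult_single)
  have lt: "single (lm g2) (lc g2) = g2 - tl g2" "single (lm g1) (lc g1) = g1 - tl g1"
    by (simp_all add: tl_def)
  have "spoly g1 g2 = kscale k (tl g1 * g2) - kscale k (tl g2 * g1)"
    unfolding sp k lt by (simp add: algebra_simps)
  also have "\<dots> \<in> span_below B ?L"
    using nz B by (intro span_if_diff mem) (auto simp: L add.commute)
  finally show ?thesis .
qed

lemma joined_mono:
  assumes "joined E V i j" "E \<subseteq> E'" "\<And>k. V k \<Longrightarrow> V' k" shows "joined E' V' i j"
  using assms(1) unfolding joined_def
  by (rule rtranclp_mono[THEN predicate2D, rotated]) (use assms(2,3) in auto)

lemma joined_refl: "joined E V i i"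
  by (simp add: joined_def)

lemma joined_edge: "(i, j) \<in> E \<Longrightarrow> V i \<Longrightarrow> V j \<Longrightarrow> joined E V i j"
  unfolding joined_def by (rule r_into_rtranclp) blast

lemma joined_trans: "joined E V i j \<Longrightarrow> joined E V j k \<Longrightarrow> joined E V i k"
  unfolding joined_def by (rule rtranclp_trans)

lemma joined_sym: "joined E V i j \<Longrightarrow> joined E V j i"
proof -
  have "symp (\<lambda>k l. ((k, l) \<in> E \<or> (l, k) \<in> E) \<and> V k \<and> V l)" by (auto intro: sympI)
  then show "joined E V i j \<Longrightarrow> joined E V j i"
    unfolding joined_def by (meson symp_rtranclp sympD)
qed

lemma joined_induct [consumes 1, case_names refl step]:
  assumes "joined E V i j" "Q i"
    and "\<And>k l. joined E V i k \<Longrightarrow> (k, l) \<in> E \<or> (l, k) \<in> E \<Longrightarrow> V k \<Longrightarrow> V l \<Longrightarrow> Q k \<Longrightarrow> Q l"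
  shows "Q j"
  using assms(1)[unfolded joined_def]
proof (induction rule: rtranclp_induct)
  case (step k l)
  then show ?case using assms(3)[of k l] unfolding joined_def by blast
qed (rule assms(2))

lemma joined_cong:
  assumes "\<And>k. k \<in> fst ` E \<union> snd ` E \<Longrightarrow> V k \<longleftrightarrow> V' k"
  shows "joined E V i j \<longleftrightarrow> joined E V' i j"
proof -
  have "(\<lambda>k l. ((k, l) \<in> E \<or> (l, k) \<in> E) \<and> V k \<and> V l)
      = (\<lambda>k l. ((k, l) \<in> E \<or> (l, k) \<in> E) \<and> V' k \<and> V' l)"
  proof (intro ext)
    fix k l
    have "a \<in> fst ` E \<union> snd ` E \<and> b \<in> fst ` E \<union> snd ` E" if "(a, b) \<in> E" for a b
      using that by (auto intro: rev_image_eqI)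
    then have "(k, l) \<in> E \<or> (l, k) \<in> E \<Longrightarrow> (V k \<longleftrightarrow> V' k) \<and> (V l \<longleftrightarrow> V' l)"
      using assms by blast
    then show "(((k, l) \<in> E \<or> (l, k) \<in> E) \<and> V k \<and> V l) =
        (((k, l) \<in> E \<or> (l, k) \<in> E) \<and> V' k \<and> V' l)" by blast
  qed
  then show ?thesis by (simp add: joined_def)
qed

text \<open>
  A path may avoid the edge \<open>(a, b)\<close> by the detour that joins its ends.
\<close>

lemma joined_delete:
  assumes "joined E V i j" and "V a \<Longrightarrow> V b \<Longrightarrow> joined (E - {(a, b)}) V a b"
  shows "joined (E - {(a, b)}) V i j"
  using assms(1)
proof (induction rule: joined_induct)
  case refl
  show ?case by (rule joined_refl)
next
  case (step k l)
  have "joined (E - {(a, b)}) V k l"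
  proof (cases "(k, l) = (a, b) \<or> (l, k) = (a, b)")
    case True
    then show ?thesis using assms(2) step joined_sym by blast
  next
    case False
    then show ?thesis using step joined_edge[of k l "E - {(a, b)}" V]
        joined_edge[of l k "E - {(a, b)}" V, THEN joined_sym] by blast
  qed
  with step(5) show ?case by (rule joined_trans)
qed

abbreviation polys :: "'p state \<Rightarrow> 'p set" where
  "polys s \<equiv> fst ` set (basis s)"

text \<open>
  The invariant behind Buchberger's criterion.  Pairs discarded as redundant stay joined by
  available or treated ones, because a discarded link of a chain can be replaced by the chain
  that justified discarding it.
\<close>

definition buchberger_inv :: "('v::{finite,linorder}, 'k::field) mpoly state \<Rightarrow> bool" where
  "buchberger_inv s \<longleftrightarrow>
     0 \<notin> polys s \<and>
     avail s \<union> treated s \<subseteq> {(i, j). i < j \<and> j < length (basis s)} \<and>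
     (\<forall>i j. i < j \<longrightarrow> j < length (basis s) \<longrightarrow>
        joined (avail s \<union> treated s) (\<lambda>k. mdvd (lm (poly_at s k)) (pair_lcm s (i, j))) i j) \<and>
     (\<forall>p\<in>treated s. pair_spoly s p \<in> span_below (polys s) (pair_lcm s p))"

lemma buchberger_invD:
  assumes "buchberger_inv s"
  shows "0 \<notin> polys s"
    and "(i, j) \<in> avail s \<union> treated s \<Longrightarrow> i < j \<and> j < length (basis s)"
    and "i < j \<Longrightarrow> j < length (basis s) \<Longrightarrow>
        joined (avail s \<union> treated s) (\<lambda>k. mdvd (lm (poly_at s k)) (pair_lcm s (i, j))) i j"
    and "p \<in> treated s \<Longrightarrow> pair_spoly s p \<in> span_below (polys s) (pair_lcm s p)"
  using assms unfolding buchberger_inv_def by blast+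

lemma poly_at_in_polys: "i < length (basis s) \<Longrightarrow> poly_at s i \<in> polys s"
  by (simp add: poly_at_def)

lemma polys_poly_at: "g \<in> polys s \<Longrightarrow> \<exists>i<length (basis s). g = poly_at s i"
  by (auto simp: poly_at_def in_set_conv_nth) (metis fst_conv)

text \<open>
  Let \<open>T\<close> bound the monomials in a representation of \<open>f\<close>.  All monic multiples with leading monomial
  \<open>T\<close> are congruent modulo representations below \<open>T\<close>, because the chains of the invariant consist of
  pairs whose lcm divides \<open>T\<close>; these have degree below \<open>e\<close> and are treated.  Hence \<open>f\<close> is congruent to
  \<open>c\<close> times one such multiple.  Either \<open>c \<noteq> 0\<close> and \<open>T\<close> is the leading monomial of \<open>f\<close>, or \<open>f\<close> has a
  representation below \<open>T\<close>.
\<close>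

theorem truncated_groebner_basis:
  fixes s :: "('v::{finite,linorder}, 'k::field) mpoly state"
  assumes inv: "buchberger_inv s" and avail: "\<And>p. p \<in> avail s \<Longrightarrow> e \<le> pair_deg s p"
    and f: "f \<in> span_upto (polys s) T" "f \<noteq> 0" "mdeg T < e"
  shows "\<exists>g\<in>polys s. mdvd (lm g) (lm f)"
  using f
proof (induction T rule: drl_induct)
  case (less T)
  let ?B = "polys s"
  \<comment> \<open>The lcm of such a pair divides \<open>T\<close> and has degree below \<open>e\<close>, so the pair is not available.\<close>
  have edge: "monic_multiple T (poly_at s k) - monic_multiple T (poly_at s l) \<in> span_below ?B T"
    if "(k, l) \<in> avail s \<union> treated s" "mdvd (lm (poly_at s k)) T" "mdvd (lm (poly_at s l)) T" for k l
  proof -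
    let ?L = "pair_lcm s (k, l)"
    have L: "mdvd ?L T" using that by (simp add: pair_lcm_def mlcm_mdvd_iff)
    then have "pair_deg s (k, l) < e" using mdvd_mdeg[OF L] less.prems(3) by (simp add: pair_deg_def)
    then have "(k, l) \<in> treated s" using that(1) avail[of "(k, l)"] by auto
    then have "pair_spoly s (k, l) \<in> span_below ?B ?L" using buchberger_invD(4)[OF inv] by blast
    then have "single (T - ?L) 1 * pair_spoly s (k, l) \<in> span_below ?B T"
    proof (rule span_if_monom_mult)
      fix v assume "drl_less v ?L"
      then have "drl_less ((T - ?L) + v) ((T - ?L) + ?L)" by simp
      then show "drl_less ((T - ?L) + v) T" by (simp add: mdvd_minus_add[OF L])
    qed
    then show ?thesis
      using monic_multiple_diff[of "poly_at s k" "poly_at s l" T] L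
      by (simp add: pair_lcm_def pair_spoly_def)
  qed
  have chain: "monic_multiple T (poly_at s i) - monic_multiple T (poly_at s j) \<in> span_below ?B T"
    if ij: "i < j" "j < length (basis s)" "mdvd (lm (poly_at s i)) T" "mdvd (lm (poly_at s j)) T" for i j
  proof -
    let ?V = "\<lambda>k. mdvd (lm (poly_at s k)) (pair_lcm s (i, j))"
    have L: "mdvd (pair_lcm s (i, j)) T" using ij by (simp add: pair_lcm_def mlcm_mdvd_iff)
    have "joined (avail s \<union> treated s) ?V i j" using buchberger_invD(3)[OF inv] ij by blast
    then show ?thesis
    proof (induction rule: joined_induct)
      case refl
      show ?case by (simp add: span_if_0)
    next
      case (step k l)
      have V: "mdvd (lm (poly_at s k)) T" "mdvd (lm (poly_at s l)) T"
        using step(3,4) L mdvd_trans by blast+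
      have "monic_multiple T (poly_at s k) - monic_multiple T (poly_at s l) \<in> span_below ?B T"
        using step(2)
      proof
        assume "(l, k) \<in> avail s \<union> treated s"
        then have "0 - (monic_multiple T (poly_at s l) - monic_multiple T (poly_at s k)) \<in> span_below ?B T"
          by (rule span_if_diff[OF span_if_0 edge[OF _ V(2) V(1)]])
        then show ?thesis by simp
      qed (use edge V in blast)
      from span_if_add[OF step(5) this] show ?case by simp
    qed
  qed
  have pair: "monic_multiple T g - monic_multiple T h \<in> span_below ?B T"
    if "g \<in> ?B" "h \<in> ?B" "mdvd (lm g) T" "mdvd (lm h) T" for g h
  proof -
    obtain i j where ij: "g = poly_at s i" "h = poly_at s j" "i < length (basis s)" "j < length (basis s)"
      using \<open>g \<in> ?B\<close> \<open>h \<in> ?B\<close> polys_poly_at by metis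
    show ?thesis
    proof (cases i j rule: linorder_cases)
      case equal
      then show ?thesis using ij by (simp add: span_if_0)
    next
      case less
      then show ?thesis using chain[of i j] that ij by simp
    next
      case greater
      then have "monic_multiple T h - monic_multiple T g \<in> span_below ?B T"
        using chain[of j i] that ij by simp
      from span_if_diff[OF span_if_0 this] show ?thesis by simp
    qed
  qed
  \<comment> \<open>A representation below \<open>T\<close> is one up to its largest monomial, to which the induction applies.\<close>
  have lower: ?case if fb: "f \<in> span_below ?B T"
  proof -
    obtain T' where "drl_less T' T" "f \<in> span_upto ?B T'"
      using span_if_upto[OF fb less.prems(2)] by blast
    moreover from this have "mdeg T' < e" using less.prems(3) drl_less_mdeg[of T' T] by simp
    ultimately show ?thesis using less.IH less.prems(2) by blast
  qed
  show ?case
  proof (cases "\<exists>g0\<in>?B. mdvd (lm g0) T")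
    case False
    have "f \<in> span_below ?B T"
    proof (rule span_if_mono[OF order_refl])
      show "f \<in> span_if ?B (\<lambda>u. drl_less u T \<and> (\<exists>g\<in>?B. mdvd (lm g) u))"
        using less.prems(1)
      proof (induction rule: span_if_induct)
        case (step c u g q)
        have "u + lm g \<noteq> T" using False step(1) mdvd_add(2) by blast
        then show ?case using step
          by (intro span_if_add span_if_scale span_if_base) (auto simp: drl_le_def intro: mdvd_add(2))
      qed (rule span_if_0)
    qed simp
    then show ?thesis by (rule lower)
  next
    case True
    then obtain g0 where g0: "g0 \<in> ?B" "mdvd (lm g0) T" by blast
    then have nz: "g0 \<noteq> 0" using buchberger_invD(1)[OF inv] by auto
    have "\<exists>c. f - kscale c (monic_multiple T g0) \<in> span_below ?B T"
      using less.prems(1)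
    proof (induction rule: span_if_induct)
      case base
      show ?case by (intro exI[of _ 0]) (simp add: span_if_0)
    next
      case (step c u g q)
      then obtain d where d: "q - kscale d (monic_multiple T g0) \<in> span_below ?B T" by blast
      show ?case
      proof (cases "u + lm g = T")
        case False
        then have "kscale c (single u 1 * g) \<in> span_below ?B T"
          using step by (intro span_if_scale span_if_base) (auto simp: drl_le_def)
        from span_if_add[OF this d] show ?thesis by (intro exI[of _ d]) (simp add: add_diff_eq)
      next
        case True
        then have "T - lm g = u" using add_minus_mon[of u "lm g"] by simp
        moreover have "lc g \<noteq> 0" using step(1) buchberger_invD(1)[OF inv] lc_ne_0 by metis
        ultimately have g: "single u 1 * g = kscale (lc g) (monic_multiple T g)"
          by (simp add: monic_multiple_def mult_single flip: mult.assoc)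
        have "kscale (c * lc g) (monic_multiple T g - monic_multiple T g0) \<in> span_below ?B T"
          using True step(1) g0 mdvd_add(2)[of "lm g" u] by (intro span_if_scale pair) auto
        from span_if_add[OF this d]
        have "kscale (c * lc g) (monic_multiple T g) + q -
            kscale (c * lc g + d) (monic_multiple T g0) \<in> span_below ?B T"
          by (simp add: algebra_simps single_add)
        moreover have "kscale (c * lc g) (monic_multiple T g) = kscale c (single u 1 * g)"
          unfolding g by (simp add: mult_single flip: mult.assoc)
        ultimately show ?thesis by metis
      qed
    qed
    then obtain c where c: "f - kscale c (monic_multiple T g0) \<in> span_below ?B T" by blast
    show ?thesis
    proof (cases "c = 0")
      case True
      then show ?thesis using c by (intro lower) simp
    next
      case False
      have B0: "0 \<notin> ?B" using buchberger_invD(1)[OF inv] .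
      have "T \<notin> keys (f - kscale c (monic_multiple T g0))"
        using span_if_keys[OF c B0, of T] drl_le_less_trans by fastforce
      then have "lookup f T = c"
        using lookup_monic_multiple[OF nz g0(2)] by (simp add: in_keys_iff lookup_minus)
      then have "T \<in> keys f" using False by (simp add: in_keys_iff)
      moreover have "drl_le t T" if "t \<in> keys f" for t
        using span_if_keys[OF less.prems(1) B0 _ that] drl_le_trans by blast
      ultimately have "lm f = T" by (rule lm_eqI)
      with g0 show ?thesis by auto
    qed
  qed
qed

text \<open>
  In a homogeneous ideal, components of degree \<open>k\<close> need only multiples of degree \<open>k\<close>; this bounds
  the monomials of a representation by the degree of the polynomial.
\<close>

lemma ideal_gen_span_if:
  fixes f :: "('v::{finite,linorder}, 'k::field) mpoly"
  assumes "f \<in> ideal_gen F" and F: "\<And>h. h \<in> F \<Longrightarrow> homogeneous (pdeg h) h" "0 \<notin> F"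
  shows "hcomp k f \<in> span_if F (\<lambda>u. mdeg u = k)"
  using assms(1)
proof (induction rule: ideal_gen_induct)
  case base
  show ?case by (simp add: span_if_0)
next
  case (step c x y)
  have nz: "x \<noteq> 0" using step(1) F(2) by auto
  have "hcomp k (c * x) \<in> span_if F (\<lambda>u. mdeg u = k)"
  proof (cases "pdeg x \<le> k")
    case True
    let ?a = "hcomp (k - pdeg x) c"
    have "hcomp k (c * x) = ?a * x" using hcomp_mult[OF F(1)[OF step(1)]] True by simp
    also have "\<dots> = (\<Sum>t\<in>keys ?a. single t (lookup ?a t)) * x"
      by (rule arg_cong[where f = "\<lambda>p. p * x"]) (rule poly_as_sum)
    also have "\<dots> = (\<Sum>t\<in>keys ?a. single t (lookup ?a t) * x)" by (rule sum_distrib_right)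
    also have "\<dots> \<in> span_if F (\<lambda>u. mdeg u = k)"
      using step(1) True pdeg_lm[OF nz]
      by (intro span_if_sum span_if_base) (auto simp: keys_hcomp)
    finally show ?thesis .
  next
    case False
    then show ?thesis using hcomp_mult[OF F(1)[OF step(1)]] by (simp add: span_if_0)
  qed
  with step(2) show ?case by (simp add: hcomp_add span_if_add)
qed

text \<open>
  With homogeneous generators \<open>F\<close>, the recorded sugar degrees are the actual degrees.
\<close>

definition homogeneous_inv :: "('v::{finite,linorder}, 'k::field) mpoly set \<Rightarrow>
    ('v, 'k) mpoly state \<Rightarrow> bool" where
  "homogeneous_inv F s \<longleftrightarrow> buchberger_inv s \<and> F \<subseteq> polys s \<and>
     (\<forall>(h, k)\<in>set (basis s). homogeneous k h \<and> h \<in> ideal_gen F)"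

lemma homogeneous_inv_groebner:
  fixes s :: "('v::{finite,linorder}, 'k::field) mpoly state"
  assumes inv: "homogeneous_inv F s" and avail: "\<And>p. p \<in> avail s \<Longrightarrow> e \<le> pair_deg s p"
    and f: "f \<in> ideal_gen F" "homogeneous k f" "f \<noteq> 0" "k < e"
  shows "\<exists>g\<in>polys s. mdvd (lm g) (lm f)"
proof -
  have binv: "buchberger_inv s" and sub: "F \<subseteq> polys s" using inv by (auto simp: homogeneous_inv_def)
  have F0: "0 \<notin> F" using sub buchberger_invD(1)[OF binv] by auto
  have Fh: "homogeneous (pdeg h) h" if "h \<in> F" for h
  proof -
    obtain k where "(h, k) \<in> set (basis s)" using \<open>h \<in> F\<close> sub by force
    then have "homogeneous k h" using inv by (auto simp: homogeneous_inv_def)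
    then show ?thesis using homogeneous_pdeg[of k h] F0 \<open>h \<in> F\<close> by metis
  qed
  have "f \<in> span_if F (\<lambda>u. mdeg u = k)" using ideal_gen_span_if[OF f(1) Fh F0, of k] f(2) by (simp add: hcomp_id)
  then have "f \<in> span_if (polys s) (\<lambda>u. mdeg u = k)" by (rule span_if_mono[OF sub, rotated])
  then obtain T where "mdeg T = k" "f \<in> span_upto (polys s) T" using span_if_upto f(3) by blast
  then show ?thesis using truncated_groebner_basis[OF binv avail] f by blast
qed

lemma pair_lcm_cong:
  "basis s = basis s' \<Longrightarrow> pair_lcm s = pair_lcm s'" "basis s = basis s' \<Longrightarrow> poly_at s = poly_at s'"
  "basis s = basis s' \<Longrightarrow> sugar_at s = sugar_at s'" "basis s = basis s' \<Longrightarrow> pair_spoly s = pair_spoly s'"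
  by (simp_all add: pair_lcm_def poly_at_def sugar_at_def pair_spoly_def fun_eq_iff)

lemma buchberger_inv_discarded:
  fixes s :: "('v::{finite,linorder}, 'k::field) mpoly state"
  assumes inv: "buchberger_inv s" and d: "discarded lm_redundant s p s'"
  shows "buchberger_inv s'"
proof -
  have b: "basis s' = basis s" using d by (auto simp: discarded_def split: if_splits)
  note cong = pair_lcm_cong[OF b]
  obtain a c where p: "p = (a, c)" by (cases p)
  have pa: "p \<in> avail s" using d by (simp add: discarded_def)
  then have ac: "a < c" "c < length (basis s)" using buchberger_invD(2)[OF inv, of a c] p by auto
  show ?thesis
  proof (cases "pair_coprime s p")
    case True
    then have s': "avail s' = avail s - {p}" "treated s' = insert p (treated s)"
      using d by (auto simp: discarded_def)
    have E: "avail s' \<union> treated s' = avail s \<union> treated s" using s' pa by auto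
    have in_B: "poly_at s a \<in> polys s" "poly_at s c \<in> polys s" using ac by (auto intro: poly_at_in_polys)
    moreover have "poly_at s a \<noteq> 0" "poly_at s c \<noteq> 0"
      using in_B buchberger_invD(1)[OF inv] by metis+
    ultimately have "pair_spoly s p \<in> span_below (polys s) (pair_lcm s p)"
      using True unfolding p pair_spoly_def pair_lcm_def pair_coprime_def
      by (intro spoly_coprime) auto
    then show ?thesis using inv unfolding buchberger_inv_def E cong b
      unfolding s'(2) by auto
  next
    case False
    then have s': "avail s' = avail s - {p}" "treated s' = treated s" and r: "lm_redundant s p"
      using d by (auto simp: discarded_def)
    have sub: "avail s \<union> treated s - {p} \<subseteq> avail s' \<union> treated s'" using s' by auto
    have "joined (avail s' \<union> treated s') (\<lambda>k. mdvd (lm (poly_at s k)) (pair_lcm s (i, j))) i j"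
      if "i < j" "j < length (basis s)" for i j
    proof -
      let ?V = "\<lambda>k. mdvd (lm (poly_at s k)) (pair_lcm s (i, j))"
      have "joined (avail s \<union> treated s - {(a, c)}) ?V i j"
      proof (rule joined_delete)
        show "joined (avail s \<union> treated s) ?V i j" using buchberger_invD(3)[OF inv that] .
        assume V: "?V a" "?V c"
        show "joined (avail s \<union> treated s - {(a, c)}) ?V a c"
        proof (rule joined_mono[OF _ order_refl])
          show "joined (avail s \<union> treated s - {(a, c)})
              (\<lambda>k. mdvd (lm (poly_at s k)) (pair_lcm s (a, c))) a c"
            using r by (simp add: lm_redundant_def p)
          have "mdvd (pair_lcm s (a, c)) (pair_lcm s (i, j))"
            using V by (simp add: pair_lcm_def[of s "(a, c)"] mlcm_mdvd_iff)
          then show "\<And>k. mdvd (lm (poly_at s k)) (pair_lcm s (a, c)) \<Longrightarrow> ?V k"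
            using mdvd_trans by blast
        qed
      qed
      then show ?thesis by (rule joined_mono) (use sub p in auto)
    qed
    then show ?thesis using inv unfolding buchberger_inv_def cong b s' by auto
  qed
qed

lemma insert_results_simps [simp]:
  "basis (insert_results s p qs) = basis s @ filter (\<lambda>q. fst q \<noteq> 0) qs"
  "avail (insert_results s p qs) = avail s - {p} \<union>
     {(k, l). k < l \<and> length (basis s) \<le> l \<and> l < length (basis s @ filter (\<lambda>q. fst q \<noteq> 0) qs)}"
  "treated (insert_results s p qs) = insert p (treated s)"
  by (simp_all add: insert_results_def Let_def)

lemma poly_at_append: "basis s' = basis s @ xs \<Longrightarrow> k < length (basis s) \<Longrightarrow> poly_at s' k = poly_at s k"
  by (simp add: poly_at_def nth_append)

lemma sugar_at_append: "basis s' = basis s @ xs \<Longrightarrow> k < length (basis s) \<Longrightarrow> sugar_at s' k = sugar_at s k"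
  by (simp add: sugar_at_def nth_append)

text \<open>
  New pairs are available and so join themselves; old chains only use old pairs, for which nothing
  changes except that \<open>p\<close> becomes treated.
\<close>

lemma buchberger_inv_insert:
  fixes s :: "('v::{finite,linorder}, 'k::field) mpoly state"
  assumes inv: "buchberger_inv s" and p: "p \<in> avail s"
    and sp: "pair_spoly s p \<in> span_below (polys s \<union> (fst ` set qs - {0})) (pair_lcm s p)"
  shows "buchberger_inv (insert_results s p qs)" (is "buchberger_inv ?s")
proof -
  let ?n = "length (basis s)" and ?E = "avail s \<union> treated s" and ?E' = "avail ?s \<union> treated ?s"
  have B': "polys ?s = polys s \<union> (fst ` set qs - {0})" by auto
  have valid: "i < j \<and> j < ?n" if "(i, j) \<in> ?E" for i j
    using buchberger_invD(2)[OF inv that] .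
  have at: "poly_at ?s k = poly_at s k" if "k < ?n" for k
    using that by (intro poly_at_append) auto
  have pl: "pair_lcm ?s q = pair_lcm s q" "pair_spoly ?s q = pair_spoly s q" if "q \<in> ?E" for q
    using valid[of "fst q" "snd q"] that by (simp_all add: pair_lcm_def pair_spoly_def at)
  have "joined ?E' (\<lambda>k. mdvd (lm (poly_at ?s k)) (pair_lcm ?s (i, j))) i j"
    if ij: "i < j" "j < length (basis ?s)" for i j
  proof (cases "j < ?n")
    case True
    have "joined ?E (\<lambda>k. mdvd (lm (poly_at s k)) (pair_lcm s (i, j))) i j"
      using buchberger_invD(3)[OF inv ij(1) True] .
    also have "(\<lambda>k. mdvd (lm (poly_at s k)) (pair_lcm s (i, j)))
        = (\<lambda>k. mdvd (lm (poly_at s k)) (pair_lcm ?s (i, j)))"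
      using True ij by (simp add: pair_lcm_def at)
    also have "joined ?E (\<lambda>k. mdvd (lm (poly_at s k)) (pair_lcm ?s (i, j))) i j \<longleftrightarrow>
        joined ?E (\<lambda>k. mdvd (lm (poly_at ?s k)) (pair_lcm ?s (i, j))) i j"
    proof (rule joined_cong)
      fix k assume "k \<in> fst ` ?E \<union> snd ` ?E"
      then obtain q where q: "q \<in> ?E" "k = fst q \<or> k = snd q" by blast
      then have "k < ?n" using valid[of "fst q" "snd q"] by auto
      then show "mdvd (lm (poly_at s k)) (pair_lcm ?s (i, j)) \<longleftrightarrow>
          mdvd (lm (poly_at ?s k)) (pair_lcm ?s (i, j))" by (simp add: at)
    qed
    finally show ?thesis by (rule joined_mono) auto
  next
    case False
    then have "(i, j) \<in> ?E'" using ij by simp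
    then show ?thesis by (rule joined_edge) (simp_all add: pair_lcm_def)
  qed
  moreover have "pair_spoly ?s q \<in> span_below (polys ?s) (pair_lcm ?s q)" if "q \<in> treated ?s" for q
  proof (cases "q = p")
    case True
    then show ?thesis using sp p pl[of p] B' by auto
  next
    case False
    then have q: "q \<in> treated s" using that by simp
    then show ?thesis using pl[of q] B'
      by (simp del: insert_results_simps)
        (rule span_if_mono[OF _ _ buchberger_invD(4)[OF inv q]], auto)
  qed
  moreover have "?E' \<subseteq> {(i, j). i < j \<and> j < length (basis ?s)}"
    using valid p by fastforce
  moreover have "0 \<notin> polys ?s" using B' buchberger_invD(1)[OF inv] by auto
  ultimately show ?thesis unfolding buchberger_inv_def by blast
qed

lemma sredE:
  assumes "sred B r r'"
  obtains h k t where "(h, k) \<in> set B" "red_at t h (fst r) (fst r')"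
    "snd r' = max (snd r) (k + mdeg (t - lm h))"
  using assms unfolding sred_def by auto

lemma sred_span:
  fixes B :: "(('v::{finite,linorder}, 'k::field) mpoly \<times> nat) list"
  assumes "sred B r r'" "0 \<notin> fst ` set B" "\<forall>t\<in>keys (fst r). drl_less t L"
  shows "fst r - fst r' \<in> span_below (fst ` set B) L" "\<forall>t\<in>keys (fst r'). drl_less t L"
proof -
  obtain h k t where h: "(h, k) \<in> set B" "red_at t h (fst r) (fst r')"
    using assms(1) by (rule sredE)
  then have "h \<in> fst ` set B" "h \<noteq> 0" using assms(2) by force+
  moreover have "drl_less t L" "mdvd (lm h) t" using h assms(3) by (auto simp: red_at_def)
  ultimately show "fst r - fst r' \<in> span_below (fst ` set B) L"
    using h(2) by (auto simp: red_at_def mdvd_minus_add intro!: span_if_base)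
  show "\<forall>t\<in>keys (fst r'). drl_less t L"
    using red_at_keys[OF h(2) \<open>h \<noteq> 0\<close>] assms(3) \<open>drl_less t L\<close> drl_less_trans by blast
qed

lemma successively_induct [consumes 2, case_names hd step]:
  assumes "successively P rs" "rs \<noteq> []" "Q (hd rs)" "\<And>r r'. r \<in> set rs \<Longrightarrow> r' \<in> set rs \<Longrightarrow> P r r' \<Longrightarrow> Q r \<Longrightarrow> Q r'"
  shows "\<forall>r\<in>set rs. Q r"
  using assms
proof (induction rs)
  case (Cons r rs)
  show ?case
  proof (cases rs)
    case Nil
    then show ?thesis using Cons by simp
  next
    case (Cons r' rs')
    then have "successively P rs" "P r r'" using Cons.prems by (auto simp: successively_Cons)
    moreover have "Q r'" using Cons.prems(3,4) \<open>P r r'\<close> Cons by auto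
    ultimately show ?thesis using Cons.IH Cons.prems(3,4) Cons by auto
  qed
qed simp

lemma successively_last:
  assumes "successively P rs" "rs \<noteq> []" "Q (hd rs)" "\<And>r r'. P r r' \<Longrightarrow> Q r \<Longrightarrow> Q r'"
  shows "Q (last rs)"
  using successively_induct[of P rs Q] assms last_in_set by blast

text \<open>
  A step at a monomial \<open>t\<close> subtracts a multiple with leading monomial \<open>t\<close>, and all monomials stay below
  the lcm that was cancelled in the S-polynomial.
\<close>

lemma reduction_seq_span:
  fixes s :: "('v::{finite,linorder}, 'k::field) mpoly state"
  assumes rs: "reduction_seq s p rs" and B: "0 \<notin> polys s"
    and p: "fst p < length (basis s)" "snd p < length (basis s)"
  shows "pair_spoly s p - fst (last rs) \<in> span_below (polys s) (pair_lcm s p)"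
    and "t \<in> keys (fst (last rs)) \<Longrightarrow> drl_less t (pair_lcm s p)"
proof -
  let ?Q = "\<lambda>r. pair_spoly s p - fst r \<in> span_below (polys s) (pair_lcm s p) \<and>
      (\<forall>t\<in>keys (fst r). drl_less t (pair_lcm s p))"
  have "?Q (last rs)"
  proof (rule successively_last[of "sred (basis s)"])
    show "successively (sred (basis s)) rs" "rs \<noteq> []" using rs by (simp_all add: reduction_seq_def)
    have "poly_at s (fst p) \<noteq> 0" "poly_at s (snd p) \<noteq> 0"
      using B p poly_at_in_polys by metis+
    then show "?Q (hd rs)"
      using rs keys_spoly_less unfolding pair_spoly_def pair_lcm_def
      by (auto simp: reduction_seq_def span_if_0 pair_spoly_def)
    fix r r' assume r: "sred (basis s) r r'" "?Q r"
    note sred_span[OF r(1) B conjunct2[OF r(2)]]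
    moreover have "pair_spoly s p - fst r' = (pair_spoly s p - fst r) + (fst r - fst r')" by simp
    ultimately show "?Q r'" using r(2) span_if_add by metis
  qed
  then show "pair_spoly s p - fst (last rs) \<in> span_below (polys s) (pair_lcm s p)"
    and "t \<in> keys (fst (last rs)) \<Longrightarrow> drl_less t (pair_lcm s p)" by auto
qed

lemma buchberger_inv_normal_step:
  fixes s :: "('v::{finite,linorder}, 'k::field) mpoly state"
  assumes inv: "buchberger_inv s" and st: "normal_step s e s'"
  shows "buchberger_inv s'"
proof (cases e)
  case (Discard p)
  then show ?thesis using buchberger_inv_discarded[OF inv] st by simp
next
  case (Process p rs)
  then have sel: "p \<in> avail s" and rs: "reduction_seq s p rs" and s': "s' = insert_results s p [last rs]"
    using st by (auto simp: normal_selectable_def)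
  have v: "fst p < length (basis s)" "snd p < length (basis s)"
    using buchberger_invD(2)[OF inv, of "fst p" "snd p"] sel by auto
  note red = reduction_seq_span[OF rs buchberger_invD(1)[OF inv] v]
  let ?r = "fst (last rs)" and ?B = "polys s \<union> (fst ` set [last rs] - {0})"
  have "?r \<in> span_below ?B (pair_lcm s p)"
  proof (cases "?r = 0")
    case False
    then have "single 0 1 * ?r \<in> span_below ?B (pair_lcm s p)"
      using red(2)[OF lm_in_keys] by (intro span_if_base) auto
    then show ?thesis by simp
  qed (simp add: span_if_0)
  moreover have "pair_spoly s p - ?r \<in> span_below ?B (pair_lcm s p)"
    by (rule span_if_mono[OF _ _ red(1)]) auto
  ultimately have "pair_spoly s p - ?r + ?r \<in> span_below ?B (pair_lcm s p)" by (intro span_if_add)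
  then show ?thesis unfolding s' by (intro buchberger_inv_insert[OF inv sel]) simp
qed

lemma buchberger_inv_init:
  assumes "0 \<notin> set fs" shows "buchberger_inv (init fs)"
proof -
  have "joined (avail (init fs) \<union> treated (init fs))
      (\<lambda>k. mdvd (lm (poly_at (init fs) k)) (pair_lcm (init fs) (i, j))) i j"
    if "i < j" "j < length (basis (init fs))" for i j
    using that by (intro joined_edge) (auto simp: init_def pair_lcm_def)
  then show ?thesis using assms unfolding buchberger_inv_def by (auto simp: init_def)
qed

section \<open>Computations with homogeneous generators\<close>

lemma homogeneous_inv_pair:
  fixes s :: "('v::{finite,linorder}, 'k::field) mpoly state"
  assumes inv: "homogeneous_inv F s" and ij: "i < j" "j < length (basis s)"
  shows "pair_sugar s (i, j) = pair_deg s (i, j)"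
    and "homogeneous (pair_deg s (i, j)) (pair_spoly s (i, j))"
    and "pair_spoly s (i, j) \<in> ideal_gen F"
proof -
  let ?L = "pair_lcm s (i, j)"
  have at: "homogeneous (sugar_at s k) (poly_at s k) \<and> poly_at s k \<in> ideal_gen F \<and> poly_at s k \<noteq> 0"
    if "k < length (basis s)" for k
  proof -
    have "basis s ! k \<in> set (basis s)" using that by simp
    then show ?thesis using inv buchberger_invD(1)[of s] poly_at_in_polys[OF that]
      unfolding homogeneous_inv_def poly_at_def sugar_at_def by (auto simp: case_prod_unfold)
  qed
  have "i < length (basis s)" using ij by simp
  note i = at[OF this] and j = at[OF ij(2)]
  have dv: "mdvd (lm (poly_at s i)) ?L" "mdvd (lm (poly_at s j)) ?L" by (simp_all add: pair_lcm_def)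
  have dl: "mdeg (?L - lm (poly_at s i)) + sugar_at s i = mdeg ?L"
    "mdeg (?L - lm (poly_at s j)) + sugar_at s j = mdeg ?L"
    using mdeg_minus[OF dv(1)] mdeg_minus[OF dv(2)] mdvd_mdeg[OF dv(1)] mdvd_mdeg[OF dv(2)]
      homogeneous_mdeg_lm i j by (metis le_add_diff_inverse2)+
  show "pair_sugar s (i, j) = pair_deg s (i, j)"
    using dl by (simp add: pair_sugar_def pair_deg_def add.commute)
  show "homogeneous (pair_deg s (i, j)) (pair_spoly s (i, j))"
    using dl i j unfolding pair_spoly_def spoly_def pair_deg_def pair_lcm_def
    by (intro homogeneous_minus homogeneous_monom_mult[where d = "sugar_at s i"]
        homogeneous_monom_mult[where d = "sugar_at s j"]) auto
  show "pair_spoly s (i, j) \<in> ideal_gen F"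
    using i j unfolding pair_spoly_def spoly_def by (intro ideal_gen_diff ideal_gen_mult) auto
qed

lemma homogeneous_sred:
  fixes B :: "(('v::{finite,linorder}, 'k::field) mpoly \<times> nat) list"
  assumes B: "\<And>h k. (h, k) \<in> set B \<Longrightarrow> homogeneous k h \<and> h \<in> ideal_gen F \<and> h \<noteq> 0"
    and r: "sred B r r'" "snd r = e" "homogeneous e (fst r)" "fst r \<in> ideal_gen F"
  shows "snd r' = e \<and> homogeneous e (fst r') \<and> fst r' \<in> ideal_gen F"
proof -
  obtain h k t where h: "(h, k) \<in> set B" "red_at t h (fst r) (fst r')"
    and sug: "snd r' = max (snd r) (k + mdeg (t - lm h))" using r(1) by (rule sredE)
  note hk = B[OF h(1)]
  have t: "mdeg t = e" "mdvd (lm h) t" using h(2) r(3) by (auto simp: red_at_def homogeneous_def)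
  have lmh: "mdeg (lm h) = k" using hk homogeneous_mdeg_lm by blast
  have d: "mdeg (t - lm h) + k = e" using mdeg_minus[OF t(2)] mdvd_mdeg[OF t(2)] t(1) lmh by simp
  then show ?thesis
    using h(2) hk r sug unfolding red_at_def
    by (auto intro!: homogeneous_minus homogeneous_monom_mult[where d = k] ideal_gen_diff ideal_gen_mult)
qed

lemma homogeneous_inv_basis:
  fixes s :: "('v::{finite,linorder}, 'k::field) mpoly state"
  assumes "homogeneous_inv F s" "(h, k) \<in> set (basis s)"
  shows "homogeneous k h \<and> h \<in> ideal_gen F \<and> h \<noteq> 0"
proof -
  have "h \<in> polys s" using assms(2) by force
  then show ?thesis using assms buchberger_invD(1)[of s] by (auto simp: homogeneous_inv_def)
qed

lemma homogeneous_inv_avail: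
  assumes "homogeneous_inv F s" "p \<in> avail s \<union> treated s"
  shows "fst p < snd p" "snd p < length (basis s)" "fst p < length (basis s)"
  using buchberger_invD(2)[of s "fst p" "snd p"] assms by (auto simp: homogeneous_inv_def)

lemma homogeneous_inv_reduction:
  fixes s :: "('v::{finite,linorder}, 'k::field) mpoly state"
  assumes inv: "homogeneous_inv F s" and p: "p \<in> avail s" and rs: "reduction_seq s p rs"
  shows "\<forall>r\<in>set rs. snd r = pair_deg s p \<and> homogeneous (pair_deg s p) (fst r) \<and> fst r \<in> ideal_gen F"
proof (rule successively_induct[of "sred (basis s)"])
  show "successively (sred (basis s)) rs" "rs \<noteq> []" using rs by (auto simp: reduction_seq_def)
  have "fst p < snd p" "snd p < length (basis s)" using homogeneous_inv_avail[OF inv] p by auto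
  from homogeneous_inv_pair[OF inv this] rs
  show "snd (hd rs) = pair_deg s p \<and> homogeneous (pair_deg s p) (fst (hd rs)) \<and> fst (hd rs) \<in> ideal_gen F"
    by (auto simp: reduction_seq_def)
  fix r r' assume "sred (basis s) r r'"
    "snd r = pair_deg s p \<and> homogeneous (pair_deg s p) (fst r) \<and> fst r \<in> ideal_gen F"
  then show "snd r' = pair_deg s p \<and> homogeneous (pair_deg s p) (fst r') \<and> fst r' \<in> ideal_gen F"
    using homogeneous_inv_basis[OF inv] homogeneous_sred by blast
qed

lemma homogeneous_inv_normal_step:
  fixes s :: "('v::{finite,linorder}, 'k::field) mpoly state"
  assumes inv: "homogeneous_inv F s" and st: "normal_step s e s'"
  shows "homogeneous_inv F s'"
proof -
  have binv: "buchberger_inv s'"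
    using buchberger_inv_normal_step[OF _ st] inv by (simp add: homogeneous_inv_def)
  show ?thesis
  proof (cases e)
    case (Discard p)
    then have "basis s' = basis s" using st by (auto simp: discarded_def split: if_splits)
    with binv inv show ?thesis by (simp add: homogeneous_inv_def)
  next
    case (Process p rs)
    then have *: "p \<in> avail s" "reduction_seq s p rs" "s' = insert_results s p [last rs]"
      using st by (auto simp: normal_selectable_def)
    have "last rs \<in> set rs" using *(2) by (simp add: reduction_seq_def)
    then have "homogeneous (snd (last rs)) (fst (last rs)) \<and> fst (last rs) \<in> ideal_gen F"
      using homogeneous_inv_reduction[OF inv *(1,2)] by auto
    with binv inv show ?thesis unfolding homogeneous_inv_def *(3) by auto
  qed
qed

lemma irreducible_by_iff:
  fixes s :: "('v::{finite,linorder}, 'k::field) mpoly state"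
  shows "irreducible_by s r \<longleftrightarrow> (\<forall>t\<in>keys (fst r). \<forall>g\<in>polys s. \<not> mdvd (lm g) t)"
proof -
  have "(\<exists>r'. sred (basis s) r r') \<longleftrightarrow> (\<exists>t\<in>keys (fst r). \<exists>g\<in>polys s. mdvd (lm g) t)"
  proof
    assume "\<exists>r'. sred (basis s) r r'"
    then obtain r' where "sred (basis s) r r'" ..
    then show "\<exists>t\<in>keys (fst r). \<exists>g\<in>polys s. mdvd (lm g) t"
      by (rule sredE) (force simp: red_at_def)
  next
    assume "\<exists>t\<in>keys (fst r). \<exists>g\<in>polys s. mdvd (lm g) t"
    then obtain t h k where "t \<in> keys (fst r)" "(h, k) \<in> set (basis s)" "mdvd (lm h) t" by auto
    then have "sred (basis s) r (fst r - single (t - lm h) (lookup (fst r) t / lc h) * h,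
        max (snd r) (k + mdeg (t - lm h)))"
      unfolding sred_def red_at_def by force
    then show "\<exists>r'. sred (basis s) r r'" by blast
  qed
  then show ?thesis unfolding irreducible_by_def by blast
qed

lemma sred_changes:
  fixes B :: "(('v::{finite,linorder}, 'k::field) mpoly \<times> nat) list"
  assumes "sred B r r'" "0 \<notin> fst ` set B" shows "fst r \<noteq> fst r'"
proof -
  obtain h k t where h: "(h, k) \<in> set B" "red_at t h (fst r) (fst r')" using assms(1) by (rule sredE)
  then have "h \<noteq> 0" using assms(2) by force
  then have "lookup (fst r') t = 0" "t \<in> keys (fst r)" using h(2) lookup_red_at by (auto simp: red_at_def)
  then show ?thesis by auto
qed

text \<open>
  The set of monomials of a polynomial, read as the binary expansion of a number, gets smaller
  in each reduction step.
\<close>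

definition keys_number :: "('v::linorder, 'k::zero) mpoly \<Rightarrow> nat" where
  "keys_number p = (\<Sum>t\<in>keys p. 2 ^ drl_rank t)"

lemma keys_number_red_at:
  fixes h :: "('v::{finite,linorder}, 'k::field) mpoly"
  assumes r: "red_at t h g g'" "h \<noteq> 0"
  shows "keys_number g' < keys_number g"
proof -
  let ?f = "\<lambda>t :: 'v mon. (2::nat) ^ drl_rank t"
  define A where "A = {s \<in> keys g. drl_less t s}"
  define C where "C = {s \<in> keys g'. drl_less s t}"
  have fin: "finite A" "finite C" by (simp_all add: A_def C_def)
  have sub: "keys g' \<subseteq> A \<union> C"
  proof
    fix s assume "s \<in> keys g'"
    then show "s \<in> A \<union> C"
      using red_at_keys[OF r, of s] drl_less_linear[of s t] by (auto simp: A_def C_def)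
  qed
  have "t \<in> keys g" using r(1) by (simp add: red_at_def)
  have inj: "inj_on drl_rank C" using drl_rank_eq_iff by (auto intro!: inj_onI)
  \<comment> \<open>The bits that may be set anew lie below the bit of \<open>t\<close>, which is cleared.\<close>
  have "sum ?f C = (\<Sum>i\<in>drl_rank ` C. 2 ^ i)" by (simp add: sum.reindex[OF inj])
  also have "\<dots> \<le> (\<Sum>i<drl_rank t. 2 ^ i)"
    by (intro sum_mono2) (auto simp: C_def drl_rank_less)
  also have "\<dots> < 2 ^ drl_rank t" by (simp add: lessThan_atLeast0 sum_power2)
  finally have C: "sum ?f C < 2 ^ drl_rank t" .
  have "keys_number g' \<le> sum ?f (A \<union> C)" unfolding keys_number_def
    using sub fin by (intro sum_mono2) auto
  also have "\<dots> \<le> sum ?f A + sum ?f C" using fin by (simp add: sum_Un_nat)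
  also have "\<dots> < sum ?f A + 2 ^ drl_rank t" using C by simp
  also have "\<dots> = sum ?f (insert t A)" using fin by (simp add: A_def)
  also have "\<dots> \<le> keys_number g" unfolding keys_number_def
    using \<open>t \<in> keys g\<close> by (intro sum_mono2) (auto simp: A_def)
  finally show ?thesis .
qed

lemma reduction_terminates:
  fixes B :: "(('v::{finite,linorder}, 'k::field) mpoly \<times> nat) list"
  assumes "0 \<notin> fst ` set B"
  shows "\<exists>rs. rs \<noteq> [] \<and> hd rs = r \<and> successively (sred B) rs \<and> (\<nexists>r'. sred B (last rs) r')"
proof (induction "keys_number (fst r)" arbitrary: r rule: less_induct)
  case less
  show ?case
  proof (cases "\<exists>r'. sred B r r'")
    case False
    then show ?thesis by (intro exI[of _ "[r]"]) simp
  next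
    case True
    then obtain r' where r': "sred B r r'" ..
    then obtain h k t where h: "(h, k) \<in> set B" "red_at t h (fst r) (fst r')" by (rule sredE)
    then have "h \<noteq> 0" using assms by force
    then obtain rs where "rs \<noteq> []" "hd rs = r'" "successively (sred B) rs" "\<nexists>r''. sred B (last rs) r''"
      using less[OF keys_number_red_at[OF h(2)]] by blast
    then show ?thesis using r' by (intro exI[of _ "r # rs"]) (auto simp: successively_Cons)
  qed
qed


section \<open>Specialization of homogeneous computations\<close>

definition spec_state :: "'k::comm_semiring_1 \<Rightarrow> ('x option, 'k) mpoly state \<Rightarrow> ('x, 'k) mpoly state" where
  "spec_state a s = State (map (\<lambda>(h, k). (spec a h, k)) (basis s)) (avail s) (treated s)"

lemma spec_state_simps [simp]:
  "basis (spec_state a s) = map (\<lambda>(h, k). (spec a h, k)) (basis s)"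
  "avail (spec_state a s) = avail s" "treated (spec_state a s) = treated s"
  by (simp_all add: spec_state_def)

definition y_free :: "('x::{finite,linorder} option, 'k::field) mpoly state \<Rightarrow> bool" where
  "y_free s \<longleftrightarrow> (\<forall>(h, k)\<in>set (basis s). lookup (lm h) None = 0)"

lemma remdups_adj_distinct_adj: "distinct_adj xs \<Longrightarrow> remdups_adj xs = xs"
  unfolding distinct_adj_def by (induction xs rule: remdups_adj.induct) auto

text \<open>
  Identity steps at \<open>y = 0\<close> show up as adjacent duplicates.
\<close>

lemma successively_remdups_adj_or:
  "successively (\<lambda>x y. P x y \<or> y = x) xs \<Longrightarrow> successively P (remdups_adj xs)"
proof (induction xs rule: remdups_adj.induct)
  case (3 x y xs)
  then show ?case
    by (auto simp: successively_Cons)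
qed auto

locale y_free_state =
  fixes F :: "('x::{finite,linorder} option, 'k::field) mpoly set" and s :: "('x option, 'k) mpoly state"
  assumes inv: "homogeneous_inv F s" and free: "y_free s"
begin

lemma basis_elem:
  assumes "(h, k) \<in> set (basis s)"
  shows "homogeneous k h" "h \<noteq> 0" "lookup (lm h) None = 0" "mdeg (lm h) = k"
    "emb (lm (spec a h)) = lm h" "lc (spec a h) = lc h" "spec a h \<noteq> 0" "pdeg (spec a h) = k"
    "lm (spec a h) = unemb (lm h)"
proof -
  show h: "homogeneous k h" "h \<noteq> 0" "lookup (lm h) None = 0"
    using homogeneous_inv_basis[OF inv assms] free assms by (auto simp: y_free_def)
  then show "mdeg (lm h) = k" by (simp add: homogeneous_mdeg_lm)
  show e: "emb (lm (spec a h)) = lm h" "lc (spec a h) = lc h" "spec a h \<noteq> 0" "pdeg (spec a h) = k"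
    using lm_spec[OF h] by auto
  show "lm (spec a h) = unemb (lm h)" by (metis e(1) unemb_emb)
qed

lemma nth_elem: "i < length (basis s) \<Longrightarrow> (poly_at s i, sugar_at s i) \<in> set (basis s)"
  by (simp add: poly_at_def sugar_at_def)

lemma spec_at:
  assumes "i < length (basis s)"
  shows "poly_at (spec_state a s) i = spec a (poly_at s i)" "sugar_at (spec_state a s) i = sugar_at s i"
  using assms by (simp_all add: poly_at_def sugar_at_def case_prod_unfold)

lemma emb_lm_at:
  "i < length (basis s) \<Longrightarrow> emb (lm (poly_at (spec_state a s) i)) = lm (poly_at s i)"
  using basis_elem(5)[OF nth_elem] spec_at by simp

lemma emb_pair_lcm:
  assumes "i < j" "j < length (basis s)"
  shows "emb (pair_lcm (spec_state a s) (i, j)) = pair_lcm s (i, j)"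
  using assms by (simp add: pair_lcm_def emb_mlcm emb_lm_at)

lemma pair_deg_spec:
  assumes "i < j" "j < length (basis s)"
  shows "pair_deg (spec_state a s) (i, j) = pair_deg s (i, j)"
  unfolding pair_deg_def emb_pair_lcm[OF assms, of a, symmetric] by simp

lemma pair_sugar_spec:
  assumes "i < j" "j < length (basis s)"
  shows "pair_sugar (spec_state a s) (i, j) = pair_deg s (i, j)"
proof -
  have "mdeg (pair_lcm (spec_state a s) (i, j) - lm (poly_at (spec_state a s) k))
      = mdeg (pair_lcm s (i, j) - lm (poly_at s k))" if "k < length (basis s)" for k
    unfolding emb_pair_lcm[OF assms, of a, symmetric] emb_lm_at[OF that, of a, symmetric]
    by (simp flip: emb_minus)
  then have "pair_sugar (spec_state a s) (i, j) = pair_sugar s (i, j)"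
    using assms by (simp add: pair_sugar_def spec_at)
  then show ?thesis using homogeneous_inv_pair(1)[OF inv assms] by simp
qed

lemma pair_coprime_spec:
  assumes "i < j" "j < length (basis s)"
  shows "pair_coprime (spec_state a s) (i, j) \<longleftrightarrow> pair_coprime s (i, j)"
  using assms emb_lm_at[of i a, symmetric] emb_lm_at[of j a, symmetric] by (simp add: pair_coprime_def)

lemma pair_spoly_spec:
  assumes "i < j" "j < length (basis s)"
  shows "pair_spoly (spec_state a s) (i, j) = spec a (pair_spoly s (i, j))"
proof -
  let ?s = "spec_state a s"
  have m: "unemb (mlcm (lm (poly_at s i)) (lm (poly_at s j)) - lm (poly_at s k))
        = mlcm (lm (poly_at ?s i)) (lm (poly_at ?s j)) - lm (poly_at ?s k)"
      "lookup (mlcm (lm (poly_at s i)) (lm (poly_at s j)) - lm (poly_at s k)) None = 0"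
    if "k \<in> {i, j}" for k
    using that assms emb_lm_at[of i a, symmetric] emb_lm_at[of j a, symmetric]
    by (auto simp: lookup_minus simp flip: emb_mlcm emb_minus)
  have lc: "lc (spec a (poly_at s k)) = lc (poly_at s k)" if "k \<in> {i, j}" for k
    using basis_elem(6)[OF nth_elem, of k a] that assms by auto
  show ?thesis
    using m[of i] m[of j] lc[of i] lc[of j] assms
    by (simp add: pair_spoly_def spoly_def spec_single spec_at)
qed

lemma valid:
  assumes "p \<in> avail s \<union> treated s"
  shows "fst p < snd p" "snd p < length (basis s)" "fst p < length (basis s)"
  using homogeneous_inv_avail[OF inv assms] by auto

lemma lm_redundant_spec:
  assumes p: "p \<in> avail s"
  shows "lm_redundant (spec_state a s) p \<longleftrightarrow> lm_redundant s p"
proof -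
  have ij: "fst p < snd p" "snd p < length (basis s)" using valid p by auto
  show ?thesis unfolding lm_redundant_def spec_state_simps
  proof (rule joined_cong)
    fix k assume "k \<in> fst ` (avail s \<union> treated s - {p}) \<union> snd ` (avail s \<union> treated s - {p})"
    then have k: "k < length (basis s)" using valid by fastforce
    show "mdvd (lm (poly_at (spec_state a s) k)) (pair_lcm (spec_state a s) p)
        \<longleftrightarrow> mdvd (lm (poly_at s k)) (pair_lcm s p)"
      using emb_lm_at[OF k, of a] emb_pair_lcm[OF ij, of a] mdvd_emb by (metis prod.collapse)
  qed
qed

lemma discarded_spec:
  "discarded lm_redundant s p s' \<Longrightarrow> discarded lm_redundant (spec_state a s) p (spec_state a s')"
  "discarded lm_redundant (spec_state a s) p s'' \<Longrightarrow>
     \<exists>s'. discarded lm_redundant s p s' \<and> s'' = spec_state a s'"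
proof -
  have c: "pair_coprime (spec_state a s) p \<longleftrightarrow> pair_coprime s p" if "p \<in> avail s"
    using pair_coprime_spec[of "fst p" "snd p" a] valid[of p] that by simp
  show "discarded lm_redundant s p s' \<Longrightarrow> discarded lm_redundant (spec_state a s) p (spec_state a s')"
    using c lm_redundant_spec[of p a] unfolding discarded_def
    by (auto simp: spec_state_def split: if_splits)
  assume d: "discarded lm_redundant (spec_state a s) p s''"
  then have p: "p \<in> avail s" by (simp add: discarded_def)
  show "\<exists>s'. discarded lm_redundant s p s' \<and> s'' = spec_state a s'"
  proof (cases "pair_coprime s p")
    case True
    then show ?thesis using d p c[OF p]
      by (intro exI[of _ "State (basis s) (avail s - {p}) (insert p (treated s))"])
        (simp add: discarded_def spec_state_def)
  next
    case False
    then show ?thesis using d p c[OF p] lm_redundant_spec[OF p, of a]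
      by (intro exI[of _ "State (basis s) (avail s - {p}) (treated s)"])
        (simp add: discarded_def spec_state_def)
  qed
qed

lemma normal_selectable_spec: "normal_selectable (spec_state a s) p \<longleftrightarrow> normal_selectable s p"
proof (cases "p \<in> avail s")
  case True
  have "emb (pair_lcm (spec_state a s) q) = pair_lcm s q" if "q \<in> avail s" for q
    using emb_pair_lcm[of "fst q" "snd q" a] valid[of q] that by simp
  then have "drl_le (pair_lcm (spec_state a s) p) (pair_lcm (spec_state a s) q)
      \<longleftrightarrow> drl_le (pair_lcm s p) (pair_lcm s q)" if "q \<in> avail s" for q
    using drl_le_emb that True by metis
  then show ?thesis
    using pair_coprime_spec[of "fst p" "snd p" a] valid[of p] True by (simp add: normal_selectable_def)
qed (simp add: normal_selectable_def)

lemma irreducible_spec: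
  assumes r: "homogeneous e r" and irr: "irreducible_by s (r, x)"
  shows "irreducible_by (spec_state a s) (spec a r, y)"
  unfolding irreducible_by_iff
proof (intro ballI, simp only: fst_conv)
  fix t g assume t: "t \<in> keys (spec a r)" and "g \<in> polys (spec_state a s)"
  then obtain h k where h: "(h, k) \<in> set (basis s)" "g = spec a h" by auto
  have "mdeg t \<le> e" "hz e t \<in> keys r"
    using t by (auto simp: in_keys_iff lookup_spec_homogeneous[OF r] split: if_splits)
  then have "\<not> mdvd (lm h) (hz e t)" using irr h(1) by (force simp: irreducible_by_iff)
  then show "\<not> mdvd (lm g) t"
    using basis_elem(3)[OF h(1)] basis_elem(9)[OF h(1), of a] h(2) by (simp add: mdvd_option)
qed

lemma irreducible_spec1:
  assumes r: "homogeneous e r" and irr: "irreducible_by (spec_state 1 s) (spec 1 r, x)"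
  shows "irreducible_by s (r, y)"
  unfolding irreducible_by_iff
proof (intro ballI, simp only: fst_conv)
  fix t h assume t: "t \<in> keys r" and "h \<in> polys s"
  then obtain k where h: "(h, k) \<in> set (basis s)" by auto
  have "mdeg t = e" using t r by (simp add: homogeneous_def)
  then have "unemb t \<in> keys (spec 1 r)"
    using t hz_unemb[of t e] mdeg_unemb_le[of t] by (simp add: in_keys_iff lookup_spec_homogeneous[OF r])
  then have "\<not> mdvd (lm (spec 1 h)) (unemb t)" using irr h by (force simp: irreducible_by_iff)
  then show "\<not> mdvd (lm h) t" using basis_elem(9)[OF h, of 1] by (simp add: mdvd_option)
qed

text \<open>
  The image is again a step if the term at \<open>t\<close> does not vanish at \<open>y = a\<close>, and otherwise an identity
  step.  For \<open>a \<noteq> 0\<close> it never vanishes.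
\<close>

lemma sred_spec:
  assumes "sred (basis s) (g, e) (g', e)" and hom: "homogeneous e g"
  shows "sred (basis (spec_state a s)) (spec a g, e) (spec a g', e) \<or> spec a g' = spec a g"
    and "a \<noteq> 0 \<Longrightarrow> sred (basis (spec_state a s)) (spec a g, e) (spec a g', e)"
proof -
  obtain h k t where h: "(h, k) \<in> set (basis s)" and red: "red_at t h g g'"
    using assms(1) by (rule sredE) simp
  let ?u = "unemb t" and ?h = "spec a h"
  note hk = basis_elem[OF h]
  have t: "t \<in> keys g" "mdvd (lm h) t" "mdeg t = e" using red hom by (auto simp: red_at_def homogeneous_def)
  have u: "hz e ?u = t" "mdeg ?u \<le> e" "e - mdeg ?u = lookup t None"
    using hz_unemb[OF t(3)] mdeg_unemb_le[of t] t(3) by (simp_all add: mdeg_option)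
  have lu: "lookup (spec a g) ?u = lookup g t * a ^ lookup t None"
    using u by (simp add: lookup_spec_homogeneous[OF hom])
  have m: "unemb (t - lm h) = ?u - lm ?h" "lookup (t - lm h) None = lookup t None"
    using hk(3) hk(9)[of a] by (auto intro!: poly_mapping_eqI simp: lookup_minus)
  have g': "spec a g' = spec a g - single (?u - lm ?h) (lookup (spec a g) ?u / lc ?h) * ?h"
    using red hk(6)[of a] by (simp add: red_at_def spec_single m lu)
  have dv: "mdvd (lm ?h) ?u" using t(2) hk(9)[of a] by (simp add: mdvd_option)
  have sug: "max e (k + mdeg (?u - lm ?h)) = e"
    using mdeg_minus[OF dv] mdvd_mdeg[OF dv] hk(5)[of a] hk(4) u(2) mdeg_emb[of "lm ?h"] by simp
  have red: "sred (basis (spec_state a s)) (spec a g, e) (spec a g', e)" if "?u \<in> keys (spec a g)"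
    unfolding sred_def red_at_def using h g' dv sug that by force
  show "sred (basis (spec_state a s)) (spec a g, e) (spec a g', e) \<or> spec a g' = spec a g"
    using red g' by (cases "?u \<in> keys (spec a g)") (auto simp: in_keys_iff)
  show "sred (basis (spec_state a s)) (spec a g, e) (spec a g', e)" if "a \<noteq> 0"
    using t(1) that by (intro red) (simp add: in_keys_iff lu)
qed

text \<open>
  A monomial of \<open>spec a g\<close> comes from exactly one monomial of \<open>g\<close>, and divisibility by a leading
  monomial without \<open>y\<close> does not depend on powers of \<open>y\<close>.
\<close>

lemma sred_spec_converse:
  assumes sr: "sred (basis (spec_state a s)) (spec a g, e) q" and hom: "homogeneous e g"
  shows "\<exists>g'. sred (basis s) (g, e) (g', e) \<and> homogeneous e g' \<and> q = (spec a g', e)"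
proof -
  obtain h' k u where h': "(h', k) \<in> set (basis (spec_state a s))" and red: "red_at u h' (spec a g) (fst q)"
    and sug: "snd q = max e (k + mdeg (u - lm h'))" using sr by (rule sredE) simp
  then obtain h where h: "(h, k) \<in> set (basis s)" "h' = spec a h" by auto
  note hk = basis_elem[OF h(1)]
  let ?t = "hz e u"
  have u: "mdeg u \<le> e" "lookup (spec a g) u = lookup g ?t * a ^ (e - mdeg u)" "u \<in> keys (spec a g)"
    and dv: "mdvd (lm h') u"
    using red by (auto simp: red_at_def in_keys_iff lookup_spec_homogeneous[OF hom] split: if_splits)
  have t: "?t \<in> keys g" using u by (auto simp: in_keys_iff)
  have dvt: "mdvd (lm h) ?t" using dv hk(3) hk(9)[of a] h(2) by (simp add: mdvd_option)
  define g' where "g' = g - single (?t - lm h) (lookup g ?t / lc h) * h"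
  have m: "unemb (?t - lm h) = u - lm h'" "lookup (?t - lm h) None = e - mdeg u"
    using hk(3) hk(9)[of a] h(2) by (auto intro!: poly_mapping_eqI simp: lookup_minus hz_def lookup_add)
  have fst: "fst q = spec a g'"
    using red hk(6)[of a] h(2) by (simp add: red_at_def g'_def spec_single m u(2))
  have snd: "snd q = e"
    using sug mdeg_minus[OF dv] mdvd_mdeg[OF dv] hk(4) hk(5)[of a] h(2) u(1) mdeg_emb[of "lm h'"] by simp
  have "mdeg (?t - lm h) + k = e" using mdeg_minus[OF dvt] mdvd_mdeg[OF dvt] u(1) hk(4) by simp
  moreover from this have "homogeneous e g'"
    unfolding g'_def using hom hk(1) by (intro homogeneous_minus homogeneous_monom_mult[where d = k]) auto
  moreover from calculation have "sred (basis s) (g, e) (g', e)"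
    unfolding sred_def red_at_def using h(1) t dvt g'_def by force
  ultimately show ?thesis using fst snd by (metis prod.collapse)
qed

lemma reduction_seq_spec:
  assumes p: "p \<in> avail s" and rh: "reduction_seq s p rh"
  shows "reduction_seq (spec_state 0 s) p
      (map (\<lambda>q. (q, pair_deg s p)) (remdups_adj (map (spec 0 \<circ> fst) rh)))"
    and "reduction_seq (spec_state 1 s) p (map (\<lambda>r. (spec 1 (fst r), snd r)) rh)"
proof -
  let ?e = "pair_deg s p"
  have ij: "fst p < snd p" "snd p < length (basis s)" using valid p by auto
  note hr = homogeneous_inv_reduction[OF inv p rh]
  have rh': "rh \<noteq> []" "hd rh = (pair_spoly s p, pair_sugar s p)" "successively (sred (basis s)) rh"
    using rh by (auto simp: reduction_seq_def)
  have hd: "spec a (fst (hd rh)) = pair_spoly (spec_state a s) p" "pair_sugar (spec_state a s) p = ?e" for a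
    using pair_spoly_spec[OF ij, of a] pair_sugar_spec[OF ij, of a] rh'(2) by simp_all
  have eta: "r = (fst r, ?e)" if "r \<in> set rh" for r using hr that by (metis prod.collapse)
  have step: "sred (basis (spec_state a s)) (spec a (fst r), ?e) (spec a (fst r'), ?e) \<or> spec a (fst r') = spec a (fst r)"
      "a \<noteq> 0 \<Longrightarrow> sred (basis (spec_state a s)) (spec a (fst r), ?e) (spec a (fst r'), ?e)"
    if "r \<in> set rh" "r' \<in> set rh" "sred (basis s) r r'" for a r r'
    using sred_spec[of "fst r" ?e "fst r'" a] eta that hr by metis+
  have "successively (\<lambda>q q'. sred (basis (spec_state 0 s)) (q, ?e) (q', ?e) \<or> q' = q) (map (spec 0 \<circ> fst) rh)"
    unfolding successively_map using rh'(3) by (rule successively_mono) (use step(1)[of _ _ 0] in auto)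
  then have "successively (\<lambda>q q'. sred (basis (spec_state 0 s)) (q, ?e) (q', ?e))
      (remdups_adj (map (spec 0 \<circ> fst) rh))" by (rule successively_remdups_adj_or)
  then show "reduction_seq (spec_state 0 s) p
      (map (\<lambda>q. (q, ?e)) (remdups_adj (map (spec 0 \<circ> fst) rh)))"
    using rh'(1) hd[of 0] by (simp add: reduction_seq_def successively_map hd_map)
  have "successively (\<lambda>r r'. sred (basis (spec_state 1 s)) (spec 1 (fst r), snd r) (spec 1 (fst r'), snd r')) rh"
    using rh'(3) by (rule successively_mono) (use step(2)[of _ _ 1] hr in auto)
  then show "reduction_seq (spec_state 1 s) p (map (\<lambda>r. (spec 1 (fst r), snd r)) rh)"
    using rh'(1) hd[of 1] hr unfolding reduction_seq_def by (simp add: successively_map hd_map)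
qed

text \<open>
  The sequence is lifted step by step, starting from the homogeneous S-polynomial; the lift of the
  next polynomial is determined by the step.
\<close>

lemma reduction_seq_lift:
  assumes p: "p \<in> avail s" and ra: "reduction_seq (spec_state a s) p ra"
  shows "\<exists>rh. reduction_seq s p rh \<and> ra = map (\<lambda>r. (spec a (fst r), snd r)) rh"
proof -
  let ?e = "pair_deg s p" and ?B = "basis (spec_state a s)"
  have ij: "fst p < snd p" "snd p < length (basis s)" using valid p by auto
  have lift: "\<exists>rh. rh \<noteq> [] \<and> hd rh = (g, ?e) \<and> successively (sred (basis s)) rh \<and>
      ra = map (\<lambda>r. (spec a (fst r), snd r)) rh"
    if "ra \<noteq> []" "hd ra = (spec a g, ?e)" "successively (sred ?B) ra" "homogeneous ?e g" for ra g
    using that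
  proof (induction ra arbitrary: g rule: list_nonempty_induct)
    case (single r)
    then show ?case by (intro exI[of _ "[(g, ?e)]"]) simp
  next
    case (cons r rs)
    then have "sred ?B (spec a g, ?e) (hd rs)" "successively (sred ?B) rs"
      by (auto simp: successively_Cons)
    then obtain g' where g': "sred (basis s) (g, ?e) (g', ?e)" "homogeneous ?e g'" "hd rs = (spec a g', ?e)"
      using sred_spec_converse cons.prems by blast
    then obtain rh where "rh \<noteq> []" "hd rh = (g', ?e)" "successively (sred (basis s)) rh"
      "rs = map (\<lambda>r. (spec a (fst r), snd r)) rh"
      using cons.IH[of g'] \<open>successively (sred ?B) rs\<close> by blast
    then show ?case using g'(1) cons.prems
      by (intro exI[of _ "(g, ?e) # rh"]) (auto simp: successively_Cons)
  qed
  have hom: "homogeneous ?e (pair_spoly s p)" "pair_sugar s p = ?e"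
    using homogeneous_inv_pair[OF inv ij] by simp_all
  have "hd ra = (spec a (pair_spoly s p), ?e)" "ra \<noteq> []" "successively (sred ?B) ra"
    using ra pair_spoly_spec[OF ij, of a] pair_sugar_spec[OF ij, of a] by (simp_all add: reduction_seq_def)
  from lift[OF this(2,1,3) hom(1)] show ?thesis using hom(2) by (simp add: reduction_seq_def)
qed

end

section \<open>Computations below the degree of regularity\<close>

text \<open>
  One half of the correspondence of events: for \<open>a = 0\<close> the half for the top parts, for \<open>a = 1\<close>
  the affine half.
\<close>

fun specialized_event :: "'k::field \<Rightarrow> ('x, 'k) mpoly event \<Rightarrow> ('x option, 'k) mpoly event \<Rightarrow> bool" where
  "specialized_event a (Discard p) (Discard q) \<longleftrightarrow> p = q"
| "specialized_event a (Process p rs) (Process q rh) \<longleftrightarrow> p = q \<and>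
     map fst rs = (if a = 0 then remdups_adj else id) (map (spec a \<circ> fst) rh)"
| "specialized_event a _ _ \<longleftrightarrow> False"

lemma corresponding_events_iff:
  "corresponding_events et eh ea \<longleftrightarrow>
     specialized_event 0 et eh \<and> specialized_event (1 :: 'k::field) ea (eh :: ('x option, 'k) mpoly event)"
  by (cases et; cases eh; cases ea) auto

lemma last_specialized:
  assumes "map fst rs = (if a = 0 then remdups_adj else id) (map (spec a \<circ> fst) rh)" "rh \<noteq> []"
  shows "fst (last rs) = spec a (fst (last rh))" "rs \<noteq> []"
proof -
  have "map fst rs \<noteq> []" unfolding assms(1) using assms(2) by simp
  then show ne: "rs \<noteq> []" by simp
  have "last (map fst rs) = last (map (spec a \<circ> fst) rh)" unfolding assms(1) by simp
  then show "fst (last rs) = spec a (fst (last rh))" using ne assms(2) by (simp add: last_map)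
qed

locale low_degree =
  fixes fs :: "('x::{finite,linorder}, 'k::field) mpoly list" and D :: enat
  assumes nosyz: "no_syzygies_below D fs" and nonzero: "0 \<notin> set fs"
begin

abbreviation "F \<equiv> phom ` set fs"

text \<open>
  An invariant of the homogeneous computation at step degrees below \<open>D\<close>: the specializations
  \<open>y = 0\<close> and \<open>y = 1\<close> of such a state are states of the other two computations.  Input polynomials
  may have degree \<open>D\<close> or more.
\<close>

definition good :: "('x option, 'k) mpoly state \<Rightarrow> bool" where
  "good sh \<longleftrightarrow> homogeneous_inv F sh \<and> y_free sh \<and> (\<forall>(h, k)\<in>set (basis sh). h \<in> F \<or> enat k < D)"

lemma good_y_free_state: "good sh \<Longrightarrow> y_free_state F sh"
  by (simp add: good_def y_free_state_def)

text \<open>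
  A remainder divisible by \<open>y\<close> would be \<open>y\<close> times an element of the ideal of lower degree; the
  leading monomial of that element is divisible by one of the current basis, so the remainder
  would be reducible.
\<close>

lemma remainder_y_free:
  assumes inv: "homogeneous_inv F sh" and avail: "\<And>q. q \<in> avail sh \<Longrightarrow> e \<le> pair_deg sh q"
    and r: "homogeneous e r" "r \<in> ideal_gen F" "irreducible_by sh (r, x)" "r \<noteq> 0" and e: "enat e < D"
  shows "lookup (lm r) None = 0"
proof (rule ccontr)
  assume y: "lookup (lm r) None \<noteq> 0"
  have lmr: "mdeg (lm r) = e" using homogeneous_mdeg_lm[OF r(1,4)] .
  have "spec 0 r = 0"
  proof (rule poly_mapping_eqI, rule ccontr)
    fix u assume "lookup (spec 0 r) u \<noteq> lookup 0 u"
    then have u: "emb u \<in> keys r" by (simp add: lookup_spec0 in_keys_iff)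
    have "\<not> w < None" for w :: "'x option" by (cases w) auto
    then have "\<exists>v. lookup (emb u) v < lookup (lm r) v \<and> (\<forall>w<v. lookup (lm r) w = lookup (emb u) w)"
      using y by (intro exI[of _ None]) auto
    moreover have "mdeg (emb u) = mdeg (lm r)" using u r(1) lmr unfolding homogeneous_def by metis
    ultimately have "drl_less (lm r) (emb u)" unfolding drl_less_def by simp
    then show False using lm_max[OF r(4) u] by (metis drl_less_le_trans drl_less_irrefl)
  qed
  then obtain c where c: "r = yvar * c" "\<And>d. homogeneous (d + 1) r \<Longrightarrow> homogeneous d c"
    using divide_by_y[of r] by blast
  have "e \<noteq> 0" using y lmr mdeg_option[of "lm r"] by simp
  then have hc: "homogeneous (e - 1) c" using c(2)[of "e - 1"] r(1) by simp
  have "c \<noteq> 0" using c(1) r(4) by auto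
  have "enat (e - 1 + 1) < D" using e \<open>e \<noteq> 0\<close> by simp
  then have "c \<in> ideal_gen F" using y_nonzerodivisor[OF nosyz nonzero hc] r(2) c(1) by simp
  then obtain g where g: "g \<in> polys sh" "mdvd (lm g) (lm c)"
    using homogeneous_inv_groebner[OF inv avail, of c "e - 1"] hc \<open>c \<noteq> 0\<close> \<open>e \<noteq> 0\<close> by auto
  have "ypow 1 + lm c \<in> keys r" using lm_in_keys[OF \<open>c \<noteq> 0\<close>] unfolding c(1) by (simp add: in_keys_iff)
  moreover have "mdvd (lm g) (ypow 1 + lm c)" using g(2) mdvd_trans mdvd_add(2) by blast
  ultimately show False using r(3) g(1) unfolding irreducible_by_iff by auto
qed

lemma normal_step_remainder:
  assumes good: "good sh" and st: "normal_step sh (Process p rh) sh'" and b: "below D sh (Process p rh)"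
  shows "fst (last rh) \<noteq> 0 \<Longrightarrow> lookup (lm (fst (last rh))) None = 0"
    and "homogeneous (pair_deg sh p) (fst (last rh))" and "snd (last rh) = pair_deg sh p"
    and "spec a (fst (last rh)) = 0 \<longleftrightarrow> fst (last rh) = 0"
    and "fst (last rh) \<noteq> 0 \<Longrightarrow> pdeg (spec a (fst (last rh))) = pair_deg sh p"
proof -
  let ?r = "fst (last rh)" and ?e = "pair_deg sh p"
  have inv: "homogeneous_inv F sh" using good by (simp add: good_def)
  have sel: "normal_selectable sh p" and rs: "reduction_seq sh p rh" and irr: "irreducible_by sh (last rh)"
    using st by auto
  have p: "p \<in> avail sh" using sel by (simp add: normal_selectable_def)
  have "last rh \<in> set rh" using rs by (simp add: reduction_seq_def)
  then have r: "snd (last rh) = ?e" "homogeneous ?e ?r" "?r \<in> ideal_gen F"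
    using homogeneous_inv_reduction[OF inv p rs] by auto
  show "homogeneous ?e ?r" "snd (last rh) = ?e" by (fact r)+
  have avail: "?e \<le> pair_deg sh q" if "q \<in> avail sh" for q
    using sel that by (auto simp: normal_selectable_def pair_deg_def drl_le_mdeg)
  show free: "lookup (lm ?r) None = 0" if "?r \<noteq> 0"
    using remainder_y_free[OF inv avail r(2,3) _ that] irr b by (auto simp: below_def irreducible_by_iff)
  show "spec a ?r = 0 \<longleftrightarrow> ?r = 0" using lm_spec(3)[OF r(2) _ free, of a] by auto
  show "pdeg (spec a ?r) = ?e" if "?r \<noteq> 0" using lm_spec(4)[OF r(2) that free[OF that]] .
qed

lemma good_step:
  assumes good: "good sh" and st: "normal_step sh e sh'" and b: "below D sh e"
  shows "good sh'"
proof -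
  have inv: "homogeneous_inv F sh'"
    using homogeneous_inv_normal_step[OF _ st] good by (simp add: good_def)
  show ?thesis
  proof (cases e)
    case (Discard p)
    then have "basis sh' = basis sh" using st by (auto simp: discarded_def split: if_splits)
    with inv good show ?thesis by (simp add: good_def y_free_def)
  next
    case (Process p rh)
    note rem = normal_step_remainder[OF good st[unfolded Process] b[unfolded Process]]
    have "basis sh' = basis sh @ filter (\<lambda>q. fst q \<noteq> 0) [last rh]" using st Process by simp
    moreover have "enat (pair_deg sh p) < D" using b Process by (simp add: below_def)
    ultimately show ?thesis using inv good rem(1,3) unfolding good_def y_free_def by auto
  qed
qed

lemma spec_insert_results:
  assumes "fst x = spec a (fst r)" "snd x = snd r" "spec a (fst r) = 0 \<longleftrightarrow> fst r = 0"
  shows "insert_results (spec_state a sh) p [x] = spec_state a (insert_results sh p [r])"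
  using assms by (cases r; cases x) (auto simp: insert_results_def spec_state_def Let_def)

text \<open>
  The next state depends only on the last polynomial of the reduction sequence and its sugar degree,
  and nonzero remainders stay nonzero because their leading monomials avoid \<open>y\<close>.
\<close>

lemma specialized_step_unique:
  assumes good: "good sh" and sth: "normal_step sh eh sh'" and b: "below D sh eh"
    and st: "normal_step (spec_state a sh) e s'" and ev: "specialized_event a e eh"
  shows "s' = spec_state a sh'"
proof (cases eh)
  case (Discard p)
  then have "e = Discard p" using ev by (cases e) auto
  then have d: "discarded lm_redundant (spec_state a sh) p s'"
    and "discarded lm_redundant sh p sh'" using st sth Discard by auto
  then have "discarded lm_redundant (spec_state a sh) p (spec_state a sh')"
    using y_free_state.discarded_spec(1)[OF good_y_free_state[OF good]] by blast
  with d show ?thesis unfolding discarded_def by (auto split: if_splits)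
next
  case (Process p rh)
  then obtain rs where e: "e = Process p rs"
    and rs: "map fst rs = (if a = 0 then remdups_adj else id) (map (spec a \<circ> fst) rh)"
    using ev by (cases e) auto
  interpret y_free_state F sh using good by (rule good_y_free_state)
  have p: "p \<in> avail sh" "rh \<noteq> []" using sth Process by (auto simp: normal_selectable_def reduction_seq_def)
  note rem = normal_step_remainder[OF good sth[unfolded Process] b[unfolded Process]]
  have "reduction_seq (spec_state a sh) p rs" and s': "s' = insert_results (spec_state a sh) p [last rs]"
    using st e by auto
  then obtain rh2 where rh2: "reduction_seq sh p rh2" "rs = map (\<lambda>r. (spec a (fst r), snd r)) rh2"
    using reduction_seq_lift[OF p(1)] by blast
  have "last rh2 \<in> set rh2" using rh2(1) by (simp add: reduction_seq_def)
  then have "snd (last rs) = pair_deg sh p"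
    using homogeneous_inv_reduction[OF inv p(1) rh2(1)] rh2 by (simp add: last_map reduction_seq_def)
  moreover have "fst (last rs) = spec a (fst (last rh))" using last_specialized[OF rs p(2)] by simp
  ultimately have "insert_results (spec_state a sh) p [last rs] = spec_state a (insert_results sh p [last rh])"
    using rem(3,4) by (intro spec_insert_results) auto
  then show ?thesis using s' sth Process by simp
qed

lemma below_spec:
  assumes good: "good sh" and ev: "specialized_event a e eh"
    and p: "\<And>p rs. e = Process p rs \<Longrightarrow> p \<in> avail sh"
  shows "below D (spec_state a sh) e \<longleftrightarrow> below D sh eh"
proof (cases e)
  case (Process p rs)
  then obtain rh where eh: "eh = Process p rh" using ev by (cases eh) auto
  interpret y_free_state F sh using good by (rule good_y_free_state)
  have "pair_deg (spec_state a sh) p = pair_deg sh p"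
    using pair_deg_spec[of "fst p" "snd p" a] valid[of p] p[OF Process] by simp
  then show ?thesis using Process eh by (simp add: below_def)
qed (use ev in \<open>cases eh; auto simp: below_def\<close>)

lemma specialize_step:
  assumes good: "good sh" and sth: "normal_step sh eh sh'" and b: "below D sh eh" and a: "a = 0 \<or> a = 1"
  shows "\<exists>e. normal_step (spec_state a sh) e (spec_state a sh') \<and> specialized_event a e eh
    \<and> below D (spec_state a sh) e"
proof -
  interpret y_free_state F sh using good by (rule good_y_free_state)
  have "\<exists>e s'. normal_step (spec_state a sh) e s' \<and> specialized_event a e eh \<and>
      (\<forall>p rs. e = Process p rs \<longrightarrow> p \<in> avail sh)"
  proof (cases eh)
    case (Discard p)
    then show ?thesis using sth discarded_spec(1)[of p sh' a]
      by (intro exI[of _ "Discard p"] exI[of _ "spec_state a sh'"]) simp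
  next
    case (Process p rh)
    have sel: "normal_selectable sh p" and rh: "reduction_seq sh p rh" and irr: "irreducible_by sh (last rh)"
      using sth Process by auto
    have p: "p \<in> avail sh" "rh \<noteq> []" using sel rh by (auto simp: normal_selectable_def reduction_seq_def)
    note hr = homogeneous_inv_reduction[OF inv p(1) rh]
    obtain rs where rs: "reduction_seq (spec_state a sh) p rs"
      "map fst rs = (if a = 0 then remdups_adj else id) (map (spec a \<circ> fst) rh)"
    proof (cases "a = 0")
      case True
      then show thesis using reduction_seq_spec(1)[OF p(1) rh] by (intro that) (auto simp: o_def)
    next
      case False
      then show thesis using a reduction_seq_spec(2)[OF p(1) rh] by (intro that) (auto simp: o_def)
    qed
    have "irreducible_by sh (fst (last rh), snd (last rh))" using irr by simp
    then have "irreducible_by (spec_state a sh) (spec a (fst (last rh)), snd (last rs))"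
      using hr p(2) by (intro irreducible_spec[of "pair_deg sh p"]) auto
    then have "irreducible_by (spec_state a sh) (last rs)"
      using last_specialized(1)[OF rs(2) p(2)] by (metis prod.collapse)
    then have "normal_step (spec_state a sh) (Process p rs) (insert_results (spec_state a sh) p [last rs])"
      using sel rs normal_selectable_spec by simp
    then show ?thesis using rs Process p
      by (intro exI[of _ "Process p rs"] exI[of _ "insert_results (spec_state a sh) p [last rs]"]) simp
  qed
  then obtain e s' where "normal_step (spec_state a sh) e s'" "specialized_event a e eh"
    "\<forall>p rs. e = Process p rs \<longrightarrow> p \<in> avail sh" by blast
  then show ?thesis using specialized_step_unique[OF good sth b] below_spec[OF good, of a e eh] b by blast
qed

lemma lift_step:
  assumes good: "good sh" and st: "normal_step (spec_state a sh) e s'" and b: "below D (spec_state a sh) e"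
    and a: "a = 0 \<or> a = 1"
  shows "\<exists>eh sh'. normal_step sh eh sh' \<and> below D sh eh \<and> specialized_event a e eh \<and> s' = spec_state a sh'"
proof -
  interpret y_free_state F sh using good by (rule good_y_free_state)
  have "\<exists>eh sh'. normal_step sh eh sh' \<and> specialized_event a e eh \<and>
      (\<forall>p rs. e = Process p rs \<longrightarrow> p \<in> avail sh)"
  proof (cases e)
    case (Discard p)
    then show ?thesis using st discarded_spec(2)[of a p s'] by (auto intro!: exI[of _ "Discard p"])
  next
    case (Process p rs)
    have sel: "normal_selectable sh p" and rs: "reduction_seq (spec_state a sh) p rs"
      and irr: "irreducible_by (spec_state a sh) (last rs)"
      using st Process normal_selectable_spec by auto
    have p: "p \<in> avail sh" using sel by (auto simp: normal_selectable_def)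
    obtain rh where rh: "reduction_seq sh p rh" and rs_eq: "rs = map (\<lambda>r. (spec a (fst r), snd r)) rh"
      using reduction_seq_lift[OF p rs] by blast
    let ?e = "pair_deg sh p"
    note hr = homogeneous_inv_reduction[OF inv p rh]
    have ne: "rh \<noteq> []" using rh by (simp add: reduction_seq_def)
    have last: "last rs = (spec a (fst (last rh)), ?e)" using ne hr by (simp add: rs_eq last_map)
    have "\<exists>rh'. reduction_seq sh p rh' \<and> irreducible_by sh (last rh') \<and>
        map fst rs = (if a = 0 then remdups_adj else id) (map (spec a \<circ> fst) rh')"
    proof (cases "a = 0")
      case False
      then have "irreducible_by sh (fst (last rh), snd (last rh))"
        using irr a hr ne last by (intro irreducible_spec1[of ?e _ ?e]) auto
      then show ?thesis using rh False by (intro exI[of _ rh]) (simp add: rs_eq)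
    next
      case a0: True
      have B0: "0 \<notin> polys sh" using inv buchberger_invD(1) by (auto simp: homogeneous_inv_def)
      \<comment> \<open>The lift of an irreducible polynomial may still be reducible at monomials divisible by \<open>y\<close>;
        the steps that reduce it further are invisible at \<open>y = 0\<close>.\<close>
      obtain ns where ns: "ns \<noteq> []" "hd ns = last rh" "successively (sred (basis sh)) ns"
        "\<nexists>r'. sred (basis sh) (last ns) r'"
        using reduction_terminates[OF B0] by blast
      define rh' where "rh' = rh @ tl ns"
      have ns_eq: "ns = last rh # tl ns" using ns(1,2) by (metis list.collapse)
      have seq: "successively (sred (basis sh)) rh'"
        using rh ns(3) unfolding rh'_def reduction_seq_def successively_append_iff
        by (subst (asm) ns_eq) (auto simp: successively_Cons)
      have "last rh' = last ns" by (subst ns_eq) (use ne in \<open>simp add: rh'_def\<close>)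
      then have "irreducible_by sh (last rh')" using ns(4) by (simp add: irreducible_by_def)
      moreover have "reduction_seq sh p rh'" using rh seq ne by (simp add: reduction_seq_def rh'_def)
      moreover have "map fst rs = remdups_adj (map (spec a \<circ> fst) rh')"
      proof -
        have "\<forall>x\<in>set ns. snd x = ?e \<and> homogeneous ?e (fst x) \<and> fst x \<in> ideal_gen F \<and> spec a (fst x) = spec a (fst (last rh))"
        proof (rule successively_induct[OF ns(3,1)])
          show "snd (hd ns) = ?e \<and> homogeneous ?e (fst (hd ns)) \<and> fst (hd ns) \<in> ideal_gen F \<and>
              spec a (fst (hd ns)) = spec a (fst (last rh))"
            using ns(2) hr ne by simp
          fix x x' assume sr: "sred (basis sh) x x'"
            and x: "snd x = ?e \<and> homogeneous ?e (fst x) \<and> fst x \<in> ideal_gen F \<and> spec a (fst x) = spec a (fst (last rh))"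
          have x': "snd x' = ?e \<and> homogeneous ?e (fst x') \<and> fst x' \<in> ideal_gen F"
            using homogeneous_sred[OF homogeneous_inv_basis[OF inv] sr] x by blast
          have "\<not> sred (basis (spec_state a sh)) (spec a (fst x), ?e) (spec a (fst x'), ?e)"
            using irr last x by (auto simp: irreducible_by_def)
          then have "spec a (fst x') = spec a (fst x)"
            using sred_spec(1)[of "fst x" ?e "fst x'" a] sr x x' by (metis prod.collapse)
          then show "snd x' = ?e \<and> homogeneous ?e (fst x') \<and> fst x' \<in> ideal_gen F \<and>
              spec a (fst x') = spec a (fst (last rh))" using x x' by simp
        qed
        then have tl: "\<forall>y\<in>set (map (spec a \<circ> fst) (tl ns)). y = last (map fst rs)"
          using list.set_sel(2)[OF ns(1)] ne by (auto simp: rs_eq last_map)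
        have 0: "0 \<notin> fst ` set (basis (spec_state a sh))" using basis_elem(7) by force
        have "successively (sred (basis (spec_state a sh))) rs" using rs by (simp add: reduction_seq_def)
        then have "successively (\<lambda>r r'. fst r \<noteq> fst r') rs"
          by (rule successively_mono) (rule sred_changes[OF _ 0])
        then have "distinct_adj (map fst rs)" by (simp add: distinct_adj_def successively_map)
        then have "remdups_adj (map fst rs) = map fst rs" by (rule remdups_adj_distinct_adj)
        moreover have "map (spec a \<circ> fst) rh' = map fst rs @ map (spec a \<circ> fst) (tl ns)"
          by (simp add: rh'_def rs_eq)
        moreover have "dropWhile (\<lambda>y. y = last (map fst rs)) (map (spec a \<circ> fst) (tl ns)) = []"
          using tl by (simp only: dropWhile_eq_Nil_conv)
        ultimately show ?thesis
          using remdups_adj_append''[of "map fst rs" "map (spec a \<circ> fst) (tl ns)"] ne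
          by (simp add: rs_eq)
      qed
      ultimately show ?thesis using a0 by auto
    qed
    then obtain rh' where rh': "reduction_seq sh p rh'" "irreducible_by sh (last rh')"
      "map fst rs = (if a = 0 then remdups_adj else id) (map (spec a \<circ> fst) rh')" by blast
    then show ?thesis using Process sel p
      by (intro exI[of _ "Process p rh'"] exI[of _ "insert_results sh p [last rh']"]) simp
  qed
  then obtain eh sh' where "normal_step sh eh sh'" "specialized_event a e eh"
    "\<forall>p rs. e = Process p rs \<longrightarrow> p \<in> avail sh" by blast
  then show ?thesis
    using specialized_step_unique[OF good _ _ st] below_spec[OF good, of a e eh] b by blast
qed

lemma good_init: "good (init (map phom fs))"
proof -
  have 0: "0 \<notin> set (map phom fs)" using nonzero by (auto simp: phom_eq_0_iff)
  have f: "homogeneous (pdeg (phom f)) (phom f) \<and> lookup (lm (phom f)) None = 0" if "f \<in> set fs" for f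
  proof -
    have "f \<noteq> 0" using that nonzero by auto
    then show ?thesis using homogeneous_phom[of f] by (simp add: pdeg_phom lm_phom)
  qed
  have "homogeneous_inv F (init (map phom fs))"
    using buchberger_inv_init[OF 0] f by (auto simp: homogeneous_inv_def init_def image_image ideal_gen_base)
  then show ?thesis using f by (auto simp: good_def y_free_def init_def)
qed

lemma spec_state_init:
  "spec_state 0 (init (map phom fs)) = init (map ptop fs)" "spec_state 1 (init (map phom fs)) = init fs"
proof -
  have f: "f \<noteq> 0" if "f \<in> set fs" for f using that nonzero by auto
  show "spec_state 0 (init (map phom fs)) = init (map ptop fs)"
    using f by (auto simp: spec_state_def init_def spec0_phom pdeg_phom lm_ptop)
  show "spec_state 1 (init (map phom fs)) = init fs"
    using f by (auto simp: spec_state_def init_def spec1_phom pdeg_phom o_def)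
qed

lemma jointly_reachable_good:
  assumes "jointly_reachable D fs (st, sh, sa)"
  shows "good sh \<and> st = spec_state 0 sh \<and> sa = spec_state 1 sh"
proof -
  let ?R = "\<lambda>s s'. \<exists>e. joint_move D s e s'"
  let ?Q = "\<lambda>(st, sh, sa). good sh \<and> st = spec_state 0 sh \<and> sa = spec_state 1 sh"
  have "?R\<^sup>*\<^sup>* (init (map ptop fs), init (map phom fs), init fs) (st, sh, sa)"
    using assms by (simp add: jointly_reachable_def)
  then have "?Q (st, sh, sa)"
  proof (induction rule: rtranclp_induct)
    case base
    then show ?case using good_init by (simp add: spec_state_init)
  next
    case (step x y)
    obtain st sh sa where x: "x = (st, sh, sa)" by (cases x)
    obtain st' sh' sa' where y: "y = (st', sh', sa')" by (cases y)
    obtain et eh ea where e: "joint_move D x (et, eh, ea) y" using step(2) by auto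
    have g: "good sh" "st = spec_state 0 sh" "sa = spec_state 1 sh" using step(3) x by auto
    have m: "normal_step st et st'" "normal_step sh eh sh'" "normal_step sa ea sa'" "below D sh eh"
      "specialized_event 0 et eh" "specialized_event 1 ea eh"
      using e by (auto simp: joint_move_def x y corresponding_events_iff)
    then show ?case
      using good_step[OF g(1) m(2,4)] specialized_step_unique[OF g(1) m(2,4)] g(2,3) y by auto
  qed
  then show ?thesis by simp
qed

lemma good_corresponding_states:
  assumes "good sh" shows "corresponding_states (spec_state 0 sh) sh (spec_state 1 sh)"
proof -
  interpret y_free_state F sh using assms by (rule good_y_free_state)
  have "map (emb \<circ> lm \<circ> fst) (basis (spec_state a sh)) = map (lm \<circ> fst) (basis sh)" for a
    using basis_elem(5) by auto
  moreover have "map fst (basis (spec_state a sh)) = map (spec a \<circ> fst) (basis sh)" for a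
    by (simp add: case_prod_unfold o_def)
  ultimately show ?thesis
    by (simp add: corresponding_states_def del: map_map spec_state_simps(1))
qed

theorem correspondence:
  assumes "jointly_reachable D fs (st, sh, sa)"
  shows "corresponding_states st sh sa"
    and "normal_step st et st' \<Longrightarrow> below D st et \<Longrightarrow>
      \<exists>eh sh' ea sa'. joint_move D (st, sh, sa) (et, eh, ea) (st', sh', sa')"
    and "normal_step sh eh sh' \<Longrightarrow> below D sh eh \<Longrightarrow>
      \<exists>et st' ea sa'. joint_move D (st, sh, sa) (et, eh, ea) (st', sh', sa')"
    and "normal_step sa ea sa' \<Longrightarrow> below D sa ea \<Longrightarrow>
      \<exists>et st' eh sh'. joint_move D (st, sh, sa) (et, eh, ea) (st', sh', sa')"
proof -
  have g: "good sh" and s: "st = spec_state 0 sh" "sa = spec_state 1 sh"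
    using jointly_reachable_good[OF assms] by auto
  show "corresponding_states st sh sa" using good_corresponding_states[OF g] s by simp
  have move: "joint_move D (st, sh, sa) (et, eh, ea) (st', sh', sa')"
    if "normal_step st et st'" "normal_step sh eh sh'" "normal_step sa ea sa'"
      "below D st et" "below D sh eh" "below D sa ea" "specialized_event 0 et eh" "specialized_event 1 ea eh"
    for et eh ea st' sh' sa'
    using that by (simp add: joint_move_def corresponding_events_iff)
  show "\<exists>et st' ea sa'. joint_move D (st, sh, sa) (et, eh, ea) (st', sh', sa')"
    if "normal_step sh eh sh'" "below D sh eh"
    using specialize_step[OF g that, of 0] specialize_step[OF g that, of 1] that move
    unfolding s[symmetric] by blast
  show "\<exists>eh sh' ea sa'. joint_move D (st, sh, sa) (et, eh, ea) (st', sh', sa')"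
    if st: "normal_step st et st'" "below D st et"
  proof -
    obtain eh sh' where "normal_step sh eh sh'" "below D sh eh" "specialized_event 0 et eh"
      using lift_step[OF g, of 0 et st'] st s(1) by auto
    with specialize_step[OF g this(1,2), of 1] move[OF st(1)] st show ?thesis
      unfolding s(2)[symmetric] by blast
  qed
  show "\<exists>et st' eh sh'. joint_move D (st, sh, sa) (et, eh, ea) (st', sh', sa')"
    if sa: "normal_step sa ea sa'" "below D sa ea"
  proof -
    obtain eh sh' where "normal_step sh eh sh'" "below D sh eh" "specialized_event 1 ea eh"
      using lift_step[OF g, of 1 ea sa'] sa s(2) by auto
    with specialize_step[OF g this(1,2), of 0] move[OF _ _ sa(1)] sa show ?thesis
      unfolding s(1)[symmetric] by blast
  qed
qed

lemma affine_run_lift: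
  assumes "run normal_step u tr s" "\<forall>(v, e)\<in>set tr. below D v e" "u = spec_state 1 sh" "good sh"
  shows "(\<exists>trh sh'. run normal_step sh trh sh' \<and> good sh' \<and> s = spec_state 1 sh') \<and>
    (\<forall>(v, e)\<in>set tr. \<exists>shv v'. good shv \<and> v = spec_state 1 shv \<and> normal_step v e v')"
  using assms
proof (induction arbitrary: sh rule: run.induct)
  case (run_Nil s)
  then show ?case using run.run_Nil by fastforce
next
  case (run_Cons s e s' tr s'')
  have b: "below D (spec_state 1 sh) e" using run_Cons.prems by auto
  obtain eh sh' where sh': "normal_step sh eh sh'" "below D sh eh" "s' = spec_state 1 sh'"
    using lift_step[OF run_Cons.prems(3) _ b] run_Cons.hyps(1) run_Cons.prems(2) by blast
  have g: "good sh'" using good_step[OF run_Cons.prems(3) sh'(1,2)] .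
  have IH: "(\<exists>trh sh''. run normal_step sh' trh sh'' \<and> good sh'' \<and> s'' = spec_state 1 sh'') \<and>
      (\<forall>(v, e)\<in>set tr. \<exists>shv v'. good shv \<and> v = spec_state 1 shv \<and> normal_step v e v')"
    using run_Cons.IH[OF _ sh'(3) g] run_Cons.prems(1) by simp
  then obtain trh sh'' where r: "run normal_step sh' trh sh''" "good sh''" "s'' = spec_state 1 sh''" by blast
  have "run normal_step sh ((sh, eh) # trh) sh''" using sh'(1) r(1) by (rule run.run_Cons)
  moreover have "\<exists>shv v'. good shv \<and> s = spec_state 1 shv \<and> normal_step s e v'"
    using run_Cons by blast
  ultimately show ?case using r(2,3) IH by auto
qed

text \<open>
  The remainder is the value at \<open>y = 1\<close> of a homogeneous one of the step degree whose leading
  monomial avoids \<open>y\<close>.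
\<close>

lemma no_degree_fall:
  assumes run: "run normal_step (init fs) tr s" and b: "\<forall>(v, e)\<in>set tr. below D v e"
    and e: "(u, e) \<in> set tr"
  shows "\<not> degree_fall u e"
proof (cases e)
  case (Process p rs)
  obtain sh u' where sh: "good sh" "u = spec_state 1 sh" "normal_step u e u'"
    using affine_run_lift[OF run b spec_state_init(2)[symmetric] good_init] e by blast
  have "below D (spec_state 1 sh) e" using b e sh(2) by auto
  then obtain eh sh' where h: "normal_step sh eh sh'" "below D sh eh" "specialized_event 1 e eh"
    using lift_step[OF sh(1), of 1 e u'] sh(2,3) by auto
  then obtain rh where eh: "eh = Process p rh" and rs: "map fst rs = map (spec 1 \<circ> fst) rh"
    using Process by (cases eh) auto
  interpret y_free_state F sh using sh(1) by (rule good_y_free_state)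
  have p: "p \<in> avail sh" "rh \<noteq> []" using h(1) eh by (auto simp: normal_selectable_def reduction_seq_def)
  note rem = normal_step_remainder[OF sh(1) h(1)[unfolded eh] h(2)[unfolded eh]]
  have "fst (last rs) = spec 1 (fst (last rh))" using last_specialized(1)[of rs 1 rh] rs p(2) by simp
  moreover have "pair_deg u p = pair_deg sh p"
    using pair_deg_spec[of "fst p" "snd p" 1] valid[of p] p sh(2) by simp
  ultimately show ?thesis using rem(4,5)[where a = 1] Process
    by (cases "fst (last rh) = 0") (simp_all add: degree_fall_def)
qed (simp add: degree_fall_def)

end

section \<open>The sugar strategy at the degree of regularity\<close>

lemma joined_transfer:
  assumes "joined E V i j" and "\<And>k l. (k, l) \<in> E \<Longrightarrow> V k \<Longrightarrow> V l \<Longrightarrow> (k, l) \<in> E' \<and> V' k \<and> V' l"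
  shows "joined E' V' i j"
  using assms(1)
proof (induction rule: joined_induct)
  case refl
  show ?case by (rule joined_refl)
next
  case (step k l)
  have "joined E' V' k l"
    using step assms(2) joined_edge[of k l E' V'] joined_edge[of l k E' V', THEN joined_sym] by blast
  with step(5) show ?case by (rule joined_trans)
qed

lemma run_append: "run step s tr s' \<Longrightarrow> step s' e s'' \<Longrightarrow> run step s (tr @ [(s', e)]) s''"
proof (induction rule: run.induct)
  case (run_Nil s)
  then show ?case by (auto intro: run.intros)
next
  case (run_Cons s e s1 tr s2)
  then show ?case by (auto intro: run.intros)
qed

lemma y_less:
  fixes s t :: "'x::{finite,linorder} option mon"
  assumes "mdeg s = mdeg t" "lookup t None < lookup s None" shows "drl_less s t"
proof -
  have "\<not> w < None" for w :: "'x option" by (cases w) auto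
  then have "\<exists>v. lookup t v < lookup s v \<and> (\<forall>w<v. lookup s w = lookup t w)"
    using assms(2) by (intro exI[of _ None]) auto
  with assms(1) show ?thesis unfolding drl_less_def by simp
qed

lemma sugar_part_subset: "set (sugar_part rs) \<subseteq> set rs"
  unfolding sugar_part_def by (meson set_takeWhileD subsetI)

lemma sugar_part_props:
  assumes "rs \<noteq> []"
  shows "sugar_part rs \<noteq> []" "hd (sugar_part rs) = hd rs" "r \<in> set (sugar_part rs) \<Longrightarrow> snd r = snd (hd rs)"
proof -
  obtain x xs where rs: "rs = x # xs" using assms by (cases rs) auto
  show "sugar_part rs \<noteq> []" "hd (sugar_part rs) = hd rs" by (simp_all add: sugar_part_def rs)
  show "r \<in> set (sugar_part rs) \<Longrightarrow> snd r = snd (hd rs)"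
    unfolding sugar_part_def by (auto dest: set_takeWhileD)
qed

lemma successively_takeWhile: "successively P xs \<Longrightarrow> successively P (takeWhile Q xs)"
  by (induction P xs rule: successively.induct) auto

lemma successively_sugar_part: "successively P rs \<Longrightarrow> successively P (sugar_part rs)"
  unfolding sugar_part_def by (rule successively_takeWhile)

text \<open>Sugar degrees never decrease, so a sequence that leaves the initial sugar degree does not
  return to it.\<close>

lemma sugar_part_eq_self:
  assumes "successively (sred B) rs" "rs \<noteq> []" "snd (last rs) \<le> snd (hd rs)"
  shows "sugar_part rs = rs"
proof -
  have "(\<forall>r\<in>set rs. snd (hd rs) \<le> snd r \<and> snd r \<le> snd (last rs))"
    using assms(1,2)
  proof (induction rs rule: induct_list012)
    case (3 x y zs)
    then have "sred B x y" "\<forall>r\<in>set (y # zs). snd y \<le> snd r \<and> snd r \<le> snd (last (y # zs))" by auto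
    moreover from this(1) have "snd x \<le> snd y" by (auto elim: sredE)
    ultimately show ?case by (auto intro: order_trans)
  qed auto
  then have "\<forall>r\<in>set rs. snd r = snd (hd rs)" using assms(3) by (meson dual_order.antisym order_trans)
  then show ?thesis unfolding sugar_part_def by (simp add: takeWhile_eq_all_conv)
qed

locale sugar_phase = low_degree fs "enat d"
  for fs :: "('x::{finite,linorder}, 'k::field) mpoly list" and d :: nat +
  fixes s1 :: "('x, 'k) mpoly state" and sh1 :: "('x option, 'k) mpoly state"
  assumes good1: "good sh1" and s1: "s1 = spec_state 1 sh1"
    and avail1: "\<And>p. p \<in> avail s1 \<Longrightarrow> d \<le> pair_deg s1 p"
    and run1: "\<exists>trh. run normal_step (init (map phom fs)) trh sh1"
begin

abbreviation "n1 \<equiv> length (basis sh1)"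

sublocale old: y_free_state F sh1
  using good1 by (rule good_y_free_state)

text \<open>
  How the homogeneous computation follows the affine one.  The basis elements of sugar degree
  \<open>d\<close> correspond by lifting; those of larger sugar degree have no counterpart.  A new element is
  reduced by the earlier ones, and therefore only pairs of old elements have degree at most \<open>d\<close>;
  only these pairs are compared.
\<close>

definition tracks :: "('x, 'k) mpoly state \<Rightarrow> ('x option, 'k) mpoly state \<Rightarrow> bool" where
  "tracks u sh \<longleftrightarrow> homogeneous_inv F sh \<and> (\<exists>trh. run normal_step (init (map phom fs)) trh sh) \<and>
     (\<exists>xs. basis u = basis s1 @ xs \<and>
        basis sh = basis sh1 @ map (\<lambda>(g, s). (lift d g, d)) (filter (\<lambda>(g, s). s \<le> d) xs) \<and>
        (\<forall>(g, s)\<in>set xs. g \<noteq> 0 \<and> pdeg g \<le> d \<and> d \<le> s)) \<and>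
     (\<forall>i j. i < j \<longrightarrow> n1 \<le> j \<longrightarrow> j < length (basis u) \<longrightarrow> sugar_at u j \<le> d \<longrightarrow>
        \<not> (mdvd (lm (poly_at u i)) (lm (poly_at u j)) \<and>
           sugar_at u i + mdeg (lm (poly_at u j) - lm (poly_at u i)) \<le> d)) \<and>
     (\<forall>i j. i < j \<longrightarrow> n1 \<le> j \<longrightarrow> j < length (basis sh) \<longrightarrow>
        \<not> mdvd (lm (poly_at sh i)) (lm (poly_at sh j))) \<and>
     avail u \<union> treated u \<subseteq> {(i, j). i < j \<and> j < length (basis u)} \<and>
     (\<forall>i j. i < j \<longrightarrow> j < n1 \<longrightarrow> pair_deg sh1 (i, j) \<le> d \<longrightarrow>
        ((i, j) \<in> avail u \<longleftrightarrow> (i, j) \<in> avail sh) \<and> ((i, j) \<in> treated u \<longleftrightarrow> (i, j) \<in> treated sh))"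

lemma tracks_init: "tracks s1 sh1"
proof -
  have "homogeneous_inv F sh1" using good1 by (simp add: good_def)
  moreover have "avail sh1 \<union> treated sh1 \<subseteq> {(i, j). i < j \<and> j < n1}"
    using old.valid by fastforce
  ultimately show ?thesis using run1 unfolding tracks_def by (simp add: s1)
qed

context
  fixes u :: "('x, 'k) mpoly state" and sh :: "('x option, 'k) mpoly state"
  assumes tr: "tracks u sh"
begin

lemma tracks_inv: "homogeneous_inv F sh"
  using tr by (simp add: tracks_def)

lemma tracks_basis:
  obtains xs where "basis u = basis s1 @ xs"
    "basis sh = basis sh1 @ map (\<lambda>(g, s). (lift d g, d)) (filter (\<lambda>(g, s). s \<le> d) xs)"
    "\<forall>(g, s)\<in>set xs. g \<noteq> 0 \<and> pdeg g \<le> d \<and> d \<le> s"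
proof -
  have "\<exists>xs. basis u = basis s1 @ xs \<and>
      basis sh = basis sh1 @ map (\<lambda>(g, s). (lift d g, d)) (filter (\<lambda>(g, s). s \<le> d) xs) \<and>
      (\<forall>(g, s)\<in>set xs. g \<noteq> 0 \<and> pdeg g \<le> d \<and> d \<le> s)"
    using tr unfolding tracks_def by (elim conjE) assumption
  then show thesis by (elim exE conjE) (rule that)
qed

lemma tracks_valid:
  assumes "p \<in> avail u \<union> treated u" shows "fst p < snd p \<and> snd p < length (basis u)"
proof -
  have "avail u \<union> treated u \<subseteq> {(i, j). i < j \<and> j < length (basis u)}"
    using tr unfolding tracks_def by (elim conjE) assumption
  with assms show ?thesis by (cases p) auto
qed

lemma tracks_pairs:
  assumes "i < j" "j < n1" "pair_deg sh1 (i, j) \<le> d"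
  shows "((i, j) \<in> avail u \<longleftrightarrow> (i, j) \<in> avail sh) \<and> ((i, j) \<in> treated u \<longleftrightarrow> (i, j) \<in> treated sh)"
proof -
  have "\<forall>i j. i < j \<longrightarrow> j < n1 \<longrightarrow> pair_deg sh1 (i, j) \<le> d \<longrightarrow>
        ((i, j) \<in> avail u \<longleftrightarrow> (i, j) \<in> avail sh) \<and> ((i, j) \<in> treated u \<longleftrightarrow> (i, j) \<in> treated sh)"
    using tr unfolding tracks_def by (elim conjE) assumption
  with assms show ?thesis by blast
qed

lemma tracks_new_u:
  assumes "i < j" "n1 \<le> j" "j < length (basis u)" "sugar_at u j \<le> d"
    "mdvd (lm (poly_at u i)) (lm (poly_at u j))"
  shows "\<not> sugar_at u i + mdeg (lm (poly_at u j) - lm (poly_at u i)) \<le> d"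
proof -
  have "\<forall>i j. i < j \<longrightarrow> n1 \<le> j \<longrightarrow> j < length (basis u) \<longrightarrow> sugar_at u j \<le> d \<longrightarrow>
        \<not> (mdvd (lm (poly_at u i)) (lm (poly_at u j)) \<and>
           sugar_at u i + mdeg (lm (poly_at u j) - lm (poly_at u i)) \<le> d)"
    using tr unfolding tracks_def by (elim conjE) assumption
  with assms show ?thesis by blast
qed

lemma tracks_new_sh:
  assumes "i < j" "n1 \<le> j" "j < length (basis sh)"
  shows "\<not> mdvd (lm (poly_at sh i)) (lm (poly_at sh j))"
proof -
  have "\<forall>i j. i < j \<longrightarrow> n1 \<le> j \<longrightarrow> j < length (basis sh) \<longrightarrow>
        \<not> mdvd (lm (poly_at sh i)) (lm (poly_at sh j))"
    using tr unfolding tracks_def by (elim conjE) assumption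
  with assms show ?thesis by blast
qed

lemma tracks_run: "\<exists>trh. run normal_step (init (map phom fs)) trh sh"
  using tr unfolding tracks_def by (elim conjE) assumption

lemma basis_u:
  assumes "(g, s) \<in> set (basis u)" shows "g \<noteq> 0" "pdeg g \<le> s" "pdeg g = mdeg (lm g)"
proof -
  obtain xs where xs: "basis u = basis s1 @ xs"
    "\<forall>(g, s)\<in>set xs. g \<noteq> 0 \<and> pdeg g \<le> d \<and> d \<le> s" by (rule tracks_basis) (rule that; assumption)
  have "g \<noteq> 0 \<and> pdeg g \<le> s"
  proof (cases "(g, s) \<in> set (basis s1)")
    case True
    then obtain h where "(h, s) \<in> set (basis sh1)" "g = spec 1 h" by (auto simp: s1)
    then show ?thesis using old.basis_elem(7,8)[of h s 1] by simp
  next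
    case False
    then have "(g, s) \<in> set xs" using xs(1) assms by auto
    then show ?thesis using xs(2) by auto
  qed
  then show "g \<noteq> 0" "pdeg g \<le> s" "pdeg g = mdeg (lm g)" using pdeg_lm by auto
qed

lemma lift_in_sh:
  assumes "(g, s) \<in> set (basis u)" "s \<le> d" shows "(lift s g, s) \<in> set (basis sh)"
proof -
  obtain xs where xs: "basis u = basis s1 @ xs"
    "basis sh = basis sh1 @ map (\<lambda>(g, s). (lift d g, d)) (filter (\<lambda>(g, s). s \<le> d) xs)"
    "\<forall>(g, s)\<in>set xs. g \<noteq> 0 \<and> pdeg g \<le> d \<and> d \<le> s" by (rule tracks_basis) (rule that; assumption)
  show ?thesis
  proof (cases "(g, s) \<in> set (basis s1)")
    case True
    then obtain h where "(h, s) \<in> set (basis sh1)" "g = spec 1 h" by (auto simp: s1)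
    then show ?thesis using old.basis_elem(1)[of h s] lift_spec1[of s h] xs(2) by simp
  next
    case False
    then have "(g, s) \<in> set xs" using xs(1) assms by auto
    moreover from this have "s = d" using xs(3) assms(2) by force
    ultimately show ?thesis unfolding xs(2) by force
  qed
qed

lemma sh_is_lift:
  assumes "h \<in> polys sh" obtains g s where "(g, s) \<in> set (basis u)" "h = lift s g"
    "s \<le> d \<or> h \<in> F" "homogeneous s h"
proof -
  obtain xs where xs: "basis u = basis s1 @ xs"
    "basis sh = basis sh1 @ map (\<lambda>(g, s). (lift d g, d)) (filter (\<lambda>(g, s). s \<le> d) xs)"
    "\<forall>(g, s)\<in>set xs. g \<noteq> 0 \<and> pdeg g \<le> d \<and> d \<le> s" by (rule tracks_basis) (rule that; assumption)
  obtain k where hk: "(h, k) \<in> set (basis sh)" using assms by auto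
  show thesis
  proof (cases "(h, k) \<in> set (basis sh1)")
    case True
    note hom = old.basis_elem(1)[OF True]
    have "(spec 1 h, k) \<in> set (basis u)" using True xs(1) by (force simp: s1)
    moreover have "k \<le> d \<or> h \<in> F" using good1 True by (force simp: good_def)
    ultimately show thesis using that[of "spec 1 h" k] lift_spec1[OF hom] hom by simp
  next
    case False
    then obtain g s where "(g, s) \<in> set xs" "s \<le> d" "h = lift d g" using hk xs(2) by auto
    moreover from this have "s = d" "pdeg g \<le> d" using xs(3) by force+
    ultimately show thesis using that[of g s] xs(1) homogeneous_lift[of g d] by simp
  qed
qed

lemma length_u: "n1 \<le> length (basis u)" "n1 \<le> length (basis sh)"
proof -
  obtain xs where "basis u = basis s1 @ xs"
    "basis sh = basis sh1 @ map (\<lambda>(g, s). (lift d g, d)) (filter (\<lambda>(g, s). s \<le> d) xs)"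
    by (rule tracks_basis) (rule that; assumption)
  then show "n1 \<le> length (basis u)" "n1 \<le> length (basis sh)" by (simp_all add: s1)
qed

lemma old_at:
  assumes "i < n1"
  shows "poly_at u i = spec 1 (poly_at sh1 i)" "sugar_at u i = sugar_at sh1 i"
    "poly_at sh i = poly_at sh1 i" "sugar_at sh i = sugar_at sh1 i"
    "emb (lm (poly_at u i)) = lm (poly_at sh i)" "phom (poly_at u i) = poly_at sh i"
proof -
  obtain xs where xs: "basis u = basis s1 @ xs"
    "basis sh = basis sh1 @ map (\<lambda>(g, s). (lift d g, d)) (filter (\<lambda>(g, s). s \<le> d) xs)"
    by (rule tracks_basis) (rule that; assumption)
  show u: "poly_at u i = spec 1 (poly_at sh1 i)" "sugar_at u i = sugar_at sh1 i"
    using poly_at_append[OF xs(1), of i] sugar_at_append[OF xs(1), of i] assms old.spec_at[OF assms, of 1]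
    by (simp_all add: s1)
  show sh: "poly_at sh i = poly_at sh1 i" "sugar_at sh i = sugar_at sh1 i"
    using poly_at_append[OF xs(2) assms] sugar_at_append[OF xs(2) assms] .
  show "emb (lm (poly_at u i)) = lm (poly_at sh i)"
    using old.basis_elem(5)[OF old.nth_elem[OF assms], of 1] u sh by simp
  show "phom (poly_at u i) = poly_at sh i"
    using old.basis_elem(1)[OF old.nth_elem[OF assms]] u(1) sh(1)
      old.basis_elem(8)[OF old.nth_elem[OF assms], of 1]
    by (simp add: phom_eq_lift lift_spec1)
qed

lemma old_pair:
  assumes "i < j" "j < n1"
  shows "pair_lcm sh (i, j) = pair_lcm sh1 (i, j)" "emb (pair_lcm u (i, j)) = pair_lcm sh (i, j)"
    "pair_sugar u (i, j) = pair_deg sh1 (i, j)" "pair_deg u (i, j) = pair_deg sh1 (i, j)"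
    "pair_deg sh (i, j) = pair_deg sh1 (i, j)"
    "pair_coprime sh (i, j) \<longleftrightarrow> pair_coprime u (i, j)"
    "pair_spoly sh (i, j) = pair_spoly sh1 (i, j)" "pair_spoly u (i, j) = spec 1 (pair_spoly sh1 (i, j))"
proof -
  have i: "i < n1" using assms by simp
  note at = old_at[OF i] old_at[OF assms(2)]
  show lcm: "pair_lcm sh (i, j) = pair_lcm sh1 (i, j)" "pair_spoly sh (i, j) = pair_spoly sh1 (i, j)"
    using at by (simp_all add: pair_lcm_def pair_spoly_def)
  have s1u: "poly_at s1 k = poly_at u k" "sugar_at s1 k = sugar_at u k" if "k < n1" for k
    using old.spec_at[OF that, of 1] old_at[OF that] by (simp_all add: s1)
  then have "pair_lcm u (i, j) = pair_lcm s1 (i, j)" "pair_spoly u (i, j) = pair_spoly s1 (i, j)"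
    "pair_sugar u (i, j) = pair_sugar s1 (i, j)" "pair_coprime u (i, j) \<longleftrightarrow> pair_coprime s1 (i, j)"
    using assms i by (simp_all add: pair_lcm_def pair_spoly_def pair_sugar_def pair_coprime_def)
  note eq = this
  show "emb (pair_lcm u (i, j)) = pair_lcm sh (i, j)"
    using eq(1) lcm(1) old.emb_pair_lcm[OF assms, of 1] by (simp add: s1)
  show "pair_sugar u (i, j) = pair_deg sh1 (i, j)"
    using eq(3) old.pair_sugar_spec[OF assms, of 1] by (simp add: s1)
  show "pair_deg u (i, j) = pair_deg sh1 (i, j)"
    using eq(1) old.pair_deg_spec[OF assms, of 1] by (simp add: s1 pair_deg_def)
  show "pair_spoly u (i, j) = spec 1 (pair_spoly sh1 (i, j))"
    using eq(2) old.pair_spoly_spec[OF assms, of 1] by (simp add: s1)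
  have "pair_coprime sh (i, j) \<longleftrightarrow> pair_coprime sh1 (i, j)"
    using at(3,9) by (simp add: pair_coprime_def)
  then show "pair_coprime sh (i, j) \<longleftrightarrow> pair_coprime u (i, j)"
    using eq(4) old.pair_coprime_spec[OF assms, of 1] by (simp add: s1)
  show "pair_deg sh (i, j) = pair_deg sh1 (i, j)" using lcm by (simp add: pair_deg_def)
qed

lemma new_sugar:
  assumes "n1 \<le> j" "j < length (basis u)" shows "d \<le> sugar_at u j"
proof -
  obtain xs where xs: "basis u = basis s1 @ xs"
    "\<forall>(g, s)\<in>set xs. g \<noteq> 0 \<and> pdeg g \<le> d \<and> d \<le> s" by (rule tracks_basis) (rule that; assumption)
  have "basis u ! j \<in> set xs" using assms xs(1) by (simp add: nth_append s1)
  then show ?thesis using xs(2) by (auto simp: sugar_at_def)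
qed

text \<open>
  Equality with \<open>d\<close> would force the lcm to be the leading monomial of the new element \<open>j\<close>, which the
  element \<open>i\<close> would then reduce without raising the sugar degree.
\<close>

lemma new_pair_sugar:
  assumes "i < j" "n1 \<le> j" "j < length (basis u)" shows "d < pair_sugar u (i, j)"
proof (rule ccontr)
  assume "\<not> d < pair_sugar u (i, j)"
  then have le: "sugar_at u i + mdeg (pair_lcm u (i, j) - lm (poly_at u i)) \<le> d"
    "sugar_at u j + mdeg (pair_lcm u (i, j) - lm (poly_at u j)) \<le> d"
    by (simp_all add: pair_sugar_def)
  have dv: "mdvd (lm (poly_at u i)) (pair_lcm u (i, j))" "mdvd (lm (poly_at u j)) (pair_lcm u (i, j))"
    by (simp_all add: pair_lcm_def)
  have "mdeg (pair_lcm u (i, j) - lm (poly_at u j)) = 0" using le(2) new_sugar[OF assms(2,3)] by simp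
  then have "pair_lcm u (i, j) = lm (poly_at u j)"
    using mdvd_minus_add[OF dv(2)] by (simp add: mdeg_eq_0_iff)
  then show False using tracks_new_u[OF assms] le dv(1) by simp
qed

lemma new_pair_deg:
  assumes "i < j" "n1 \<le> j" "j < length (basis sh)" shows "d < pair_deg sh (i, j)"
proof (rule ccontr)
  assume "\<not> d < pair_deg sh (i, j)"
  moreover have dv: "mdvd (lm (poly_at sh j)) (pair_lcm sh (i, j))" "mdvd (lm (poly_at sh i)) (pair_lcm sh (i, j))"
    by (simp_all add: pair_lcm_def)
  moreover have "mdeg (lm (poly_at sh j)) = d"
  proof -
    obtain xs where xs: "basis sh = basis sh1 @ map (\<lambda>(g, s). (lift d g, d)) (filter (\<lambda>(g, s). s \<le> d) xs)"
      by (rule tracks_basis) (rule that; assumption)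
    define ys where "ys = map (\<lambda>(g, s). (lift d g, d)) (filter (\<lambda>(g, s). s \<le> d) xs)"
    have "basis sh = basis sh1 @ ys" using xs by (simp only: ys_def)
    then have "basis sh ! j \<in> set ys" using assms by (simp add: nth_append)
    then have "snd (basis sh ! j) = d" by (auto simp: ys_def)
    moreover have "(poly_at sh j, snd (basis sh ! j)) \<in> set (basis sh)"
      using assms(3) by (simp add: poly_at_def)
    ultimately show ?thesis using homogeneous_inv_basis[OF tracks_inv] homogeneous_mdeg_lm by metis
  qed
  ultimately have "lm (poly_at sh j) = pair_lcm sh (i, j)"
    by (intro mdvd_mdeg_eq) (simp_all add: pair_deg_def)
  then show False using tracks_new_sh[OF assms] dv(2) by simp
qed

text \<open>
  The condition on \<open>y\<close>-exponents confines the chain to elements found before sugar degree \<open>d\<close>: a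
  later element in it would have the lcm as its leading monomial and be reducible by \<open>i\<close>.  The links
  have sugar degree at most \<open>d\<close> and so are available or treated in both computations.
\<close>

lemma lift_redundant_imp_lm_redundant:
  assumes ij: "i < j" "j < n1" "pair_deg sh1 (i, j) \<le> d" and red: "lift_redundant u (i, j)"
  shows "lm_redundant sh (i, j)"
proof -
  let ?L = "pair_lcm u (i, j)"
  let ?V = "\<lambda>k. mdvd (lm (poly_at u k)) ?L \<and>
      sugar_at u k + mdeg (?L - lm (poly_at u k)) \<le> pair_sugar u (i, j)"
  have sug: "pair_sugar u (i, j) \<le> d" using old_pair(3)[OF ij(1,2)] ij(3) by simp
  have Lsug: "sugar_at u i + mdeg (?L - lm (poly_at u i)) \<le> d" using sug by (simp add: pair_sugar_def)
  have Li: "mdvd (lm (poly_at u i)) ?L" by (simp add: pair_lcm_def)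
  have k_old: "k < n1" if V: "?V k" and k: "k < length (basis u)" for k
  proof (rule ccontr)
    assume "\<not> k < n1"
    then have k1: "n1 \<le> k" by simp
    have "mdeg (?L - lm (poly_at u k)) = 0" "sugar_at u k \<le> d" using V sug new_sugar[OF k1 k] by auto
    then have "?L = lm (poly_at u k)"
      using mdvd_minus_add[of "lm (poly_at u k)" ?L] V by (simp add: mdeg_eq_0_iff)
    moreover have "i < k" using ij k1 by simp
    ultimately show False using tracks_new_u[of i k] k1 k \<open>sugar_at u k \<le> d\<close> Li Lsug by simp
  qed
  have V: "mdvd (lm (poly_at sh k)) (pair_lcm sh (i, j))" if "?V k" "k < n1" for k
    using that old_at(5)[OF that(2)] old_pair(2)[OF ij(1,2)] mdvd_emb by metis
  have edge: "(k, l) \<in> avail sh \<union> treated sh - {(i, j)} \<and>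
      mdvd (lm (poly_at sh k)) (pair_lcm sh (i, j)) \<and> mdvd (lm (poly_at sh l)) (pair_lcm sh (i, j))"
    if kl: "(k, l) \<in> avail u \<union> treated u - {(i, j)}" "?V k" "?V l" for k l
  proof -
    have kl': "k < l" "l < length (basis u)" using tracks_valid[of "(k, l)"] kl(1) by auto
    then have n: "k < n1" "l < n1" using k_old kl by auto
    have "mdvd (pair_lcm u (k, l)) ?L" using kl by (simp add: pair_lcm_def mlcm_mdvd_iff)
    then have "pair_deg u (k, l) \<le> pair_deg u (i, j)" unfolding pair_deg_def by (rule mdvd_mdeg)
    then have "pair_deg sh1 (k, l) \<le> d"
      using old_pair(4)[OF kl'(1) n(2)] old_pair(4)[OF ij(1,2)] ij(3) by simp
    then show ?thesis using tracks_pairs[OF kl'(1) n(2)] kl V n by blast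
  qed
  have "joined (avail u \<union> treated u - {(i, j)}) ?V i j" using red by (simp add: lift_redundant_def)
  then have "joined (avail sh \<union> treated sh - {(i, j)})
      (\<lambda>k. mdvd (lm (poly_at sh k)) (pair_lcm sh (i, j))) i j"
    by (rule joined_transfer) (use edge in blast)
  then show ?thesis by (simp add: lm_redundant_def)
qed

lemma tracks_same_basis:
  assumes "basis u' = basis u" "basis sh' = basis sh" "homogeneous_inv F sh'"
    "\<exists>trh. run normal_step (init (map phom fs)) trh sh'"
    "avail u' \<union> treated u' \<subseteq> avail u \<union> treated u"
    "\<And>i j. i < j \<Longrightarrow> j < n1 \<Longrightarrow> pair_deg sh1 (i, j) \<le> d \<Longrightarrow>
      ((i, j) \<in> avail u' \<longleftrightarrow> (i, j) \<in> avail sh') \<and> ((i, j) \<in> treated u' \<longleftrightarrow> (i, j) \<in> treated sh')"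
  shows "tracks u' sh'"
  using tr assms(3-6) unfolding tracks_def assms(1,2) pair_lcm_cong[OF assms(1)] pair_lcm_cong[OF assms(2)]
  by (intro conjI) (blast+)

lemma tracks_discard:
  assumes d: "discarded lift_redundant u p u'"
  shows "\<exists>sh'. tracks u' sh'"
proof -
  obtain i j where p: "p = (i, j)" by (cases p)
  have pa: "p \<in> avail u" using d by (simp add: discarded_def)
  then have ij: "i < j" using tracks_valid[of p] p by simp
  have b: "basis u' = basis u" and av: "avail u' = avail u - {p}"
    and tu: "treated u' = (if pair_coprime u p then insert p (treated u) else treated u)"
    using d by (auto simp: discarded_def split: if_splits)
  have sub: "avail u' \<union> treated u' \<subseteq> avail u \<union> treated u" using av tu pa by auto
  show ?thesis
  proof (cases "j < n1 \<and> pair_deg sh1 (i, j) \<le> d")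
    case False
    have "tracks u' sh"
    proof (rule tracks_same_basis[OF b refl tracks_inv _ sub])
      show "\<exists>trh. run normal_step (init (map phom fs)) trh sh" by (rule tracks_run)
      fix k l assume kl: "k < l" "l < n1" "pair_deg sh1 (k, l) \<le> d"
      then have "(k, l) \<noteq> p" using False p by auto
      then show "((k, l) \<in> avail u' \<longleftrightarrow> (k, l) \<in> avail sh) \<and> ((k, l) \<in> treated u' \<longleftrightarrow> (k, l) \<in> treated sh)"
        using tracks_pairs[OF kl] av tu by auto
    qed
    then show ?thesis ..
  next
    case True
    have psh: "p \<in> avail sh" using tracks_pairs[OF ij] True pa p by simp
    define sh' where "sh' = State (basis sh) (avail sh - {p})
        (if pair_coprime u p then insert p (treated sh) else treated sh)"
    have "pair_coprime u p \<or> lm_redundant sh p"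
      using lift_redundant_imp_lm_redundant[OF ij] True d p by (auto simp: discarded_def split: if_splits)
    then have st: "normal_step sh (Discard p) sh'"
      using psh old_pair(6)[OF ij] True p by (auto simp: discarded_def sh'_def)
    have "tracks u' sh'"
    proof (rule tracks_same_basis[OF b _ _ _ sub])
      show "basis sh' = basis sh" by (simp add: sh'_def)
      show "homogeneous_inv F sh'" using homogeneous_inv_normal_step[OF tracks_inv st] .
      show "\<exists>trh. run normal_step (init (map phom fs)) trh sh'"
        using tracks_run run_append[where step = normal_step, OF _ st] by blast
      fix k l assume kl: "k < l" "l < n1" "pair_deg sh1 (k, l) \<le> d"
      then show "((k, l) \<in> avail u' \<longleftrightarrow> (k, l) \<in> avail sh') \<and> ((k, l) \<in> treated u' \<longleftrightarrow> (k, l) \<in> treated sh')"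
        using tracks_pairs[OF kl] av tu by (auto simp: sh'_def)
    qed
    then show ?thesis ..
  qed
qed

text \<open>
  The exponent of \<open>y\<close> in a lifted leading monomial is the gap between sugar degree and degree, so
  comparing these exponents amounts to asking whether the step would raise the sugar degree.
\<close>

lemma sugar_divides_iff:
  assumes h: "(h, s) \<in> set (basis u)" and t: "mdeg t \<le> d" and "s \<le> d"
  shows "mdvd (lm (lift s h)) (hz d t) \<longleftrightarrow> mdvd (lm h) t \<and> s + mdeg (t - lm h) \<le> d"
proof -
  note hs = basis_u[OF h]
  have "lm (lift s h) = hz s (lm h)" using lm_lift(1)[OF hs(2,1)] .
  then show ?thesis using t hs mdeg_minus[of "lm h" t] mdvd_mdeg[of "lm h" t] assms(3)
    by (auto simp: mdvd_option)
qed

lemma sred_lift: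
  assumes sr: "sred (basis u) r r'" and sug: "snd r = d" "snd r' = d" and pd: "pdeg (fst r) \<le> d"
  shows "sred (basis sh) (lift d (fst r), d) (lift d (fst r'), d)"
proof -
  obtain h s t where h: "(h, s) \<in> set (basis u)" and red: "red_at t h (fst r) (fst r')"
    and sg: "snd r' = max (snd r) (s + mdeg (t - lm h))" using sr by (rule sredE)
  note hs = basis_u[OF h]
  have t: "t \<in> keys (fst r)" "mdvd (lm h) t" using red by (auto simp: red_at_def)
  have td: "mdeg t \<le> d" using pdeg_ge[OF t(1)] pd by simp
  have le: "s + mdeg (t - lm h) \<le> d" using sg sug by simp
  then have "s \<le> d" by simp
  note lmh = lm_lift[OF hs(2,1)]
  have dv: "mdvd (lm (lift s h)) (hz d t)" using sugar_divides_iff[OF h td \<open>s \<le> d\<close>] t(2) le by simp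
  have m: "hz d t - hz s (lm h) = hz (d - s) (t - lm h)"
    using mdeg_minus[OF t(2)] mdvd_mdeg[OF t(2)] hs le
    by (intro option_mon_eqI) (auto simp: lookup_minus hz_def lookup_add)
  let ?c = "lookup (fst r) t / lc h"
  have c: "lookup (lift d (fst r)) (hz d t) / lc (lift s h) = ?c"
    using td by (simp add: lookup_lift[OF pd] lmh)
  have pm: "pdeg (single (t - lm h) ?c * h) \<le> d"
    using pdeg_monom_mult_le[OF hs(2), of "t - lm h" ?c] le by simp
  have "lift d (fst r') = lift d (fst r) - lift d (single (t - lm h) ?c * h)"
    using red lift_minus[OF pd pm] by (simp add: red_at_def)
  also have "lift d (single (t - lm h) ?c * h) = single (hz (d - s) (t - lm h)) ?c * lift s h"
    using le by (intro lift_monom_mult[OF hs(2)]) simp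
  finally have "red_at (hz d t) (lift s h) (lift d (fst r)) (lift d (fst r'))"
    unfolding red_at_def c using dv t(1) keys_lift[OF pd] by (simp add: lmh m)
  moreover have "max d (s + mdeg (hz d t - lm (lift s h))) = d"
    unfolding lmh m using mdeg_hz[of "t - lm h" "d - s"] le by simp
  ultimately show ?thesis unfolding sred_def using lift_in_sh[OF h \<open>s \<le> d\<close>] by force
qed

text \<open>
  A reducer of the lift has degree at most \<open>d\<close>, hence is itself the lift of an affine element that
  would reduce \<open>r\<close> without raising the sugar degree.
\<close>

lemma sugar_exhausted_irreducible:
  assumes pd: "pdeg r \<le> d" and ex: "\<nexists>r'. sred (basis u) (r, d) r' \<and> snd r' = d"
  shows "irreducible_by sh (lift d r, x)"
    and "\<lbrakk>(h, s) \<in> set (basis u); t \<in> keys r; mdvd (lm h) t\<rbrakk> \<Longrightarrow> \<not> s + mdeg (t - lm h) \<le> d"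
proof -
  show no: "\<not> s + mdeg (t - lm h) \<le> d"
    if "(h, s) \<in> set (basis u)" "t \<in> keys r" "mdvd (lm h) t" for h s t
  proof
    assume "s + mdeg (t - lm h) \<le> d"
    then have "sred (basis u) (r, d) (r - single (t - lm h) (lookup r t / lc h) * h, d)"
      unfolding sred_def red_at_def using that by force
    then show False using ex by auto
  qed
  show "irreducible_by sh (lift d r, x)" unfolding irreducible_by_iff
  proof (intro ballI notI, simp only: fst_conv)
    fix t' h' assume t': "t' \<in> keys (lift d r)" and "h' \<in> polys sh" and dv: "mdvd (lm h') t'"
    obtain t where t: "t' = hz d t" "t \<in> keys r" using t' keys_lift[OF pd] by auto
    have td: "mdeg t \<le> d" using pdeg_ge[OF t(2)] pd by simp
    obtain h s where h: "(h, s) \<in> set (basis u)" "h' = lift s h" "homogeneous s h'"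
      using sh_is_lift[OF \<open>h' \<in> polys sh\<close>] by metis
    have "h' \<noteq> 0" using h basis_u[OF h(1)] lift_eq_0_iff by metis
    then have "s \<le> d" using mdvd_mdeg[OF dv] homogeneous_mdeg_lm[OF h(3)] t(1) td by simp
    then show False using no[OF h(1) t(2)] sugar_divides_iff[OF h(1) td] dv t(1) h(2) by simp
  qed
qed

lemma sugar_reduction:
  assumes p: "fst p < snd p" "snd p < n1" and sug: "pair_sugar u p = d" and rs: "reduction_seq u p rs"
  shows "\<forall>r\<in>set rs. pdeg (fst r) \<le> d"
    and "reduction_seq sh p (map (\<lambda>r. (lift d (fst r), d)) (sugar_part rs))"
proof -
  obtain i j where ij: "p = (i, j)" by (cases p)
  have rs': "rs \<noteq> []" "hd rs = (pair_spoly u p, d)" "successively (sred (basis u)) rs"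
    using rs sug by (simp_all add: reduction_seq_def)
  have deg: "pair_deg sh1 p = d" using old_pair(3)[of i j] p sug ij by simp
  have hom: "homogeneous d (pair_spoly sh1 p)"
    using homogeneous_inv_pair(2)[OF old.inv, of i j] p ij deg by simp
  have sp: "pair_spoly u p = spec 1 (pair_spoly sh1 p)" "pair_spoly sh p = pair_spoly sh1 p"
    using old_pair(7,8)[of i j] p ij by simp_all
  show pd: "\<forall>r\<in>set rs. pdeg (fst r) \<le> d"
  proof (rule successively_induct[OF rs'(3,1)])
    show "pdeg (fst (hd rs)) \<le> d" using rs'(2) sp(1) pdeg_spec_le[OF hom, of 1] by simp
    fix r r' assume "sred (basis u) r r'" "pdeg (fst r) \<le> d"
    then show "pdeg (fst r') \<le> d" by (metis sredE red_at_pdeg basis_u(1))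
  qed
  have "successively (\<lambda>r r'. sred (basis sh) (lift d (fst r), d) (lift d (fst r'), d)) (sugar_part rs)"
  proof (rule successively_mono[OF successively_sugar_part[OF rs'(3)]])
    fix r r' assume "r \<in> set (sugar_part rs)" "r' \<in> set (sugar_part rs)" "sred (basis u) r r'"
    moreover from this have "snd r = d" "snd r' = d" using sugar_part_props(3)[OF rs'(1)] rs'(2) by auto
    moreover have "pdeg (fst r) \<le> d" using pd calculation(1) sugar_part_subset by blast
    ultimately show "sred (basis sh) (lift d (fst r), d) (lift d (fst r'), d)" by (intro sred_lift)
  qed
  moreover have "lift d (pair_spoly u p) = pair_spoly sh p" using sp lift_spec1[OF hom] by simp
  moreover have "pair_sugar sh p = d"
    using homogeneous_inv_pair(1)[OF tracks_inv, of i j] old_pair(5)[of i j] p deg ij length_u(2) by simp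
  ultimately show "reduction_seq sh p (map (\<lambda>r. (lift d (fst r), d)) (sugar_part rs))"
    using sugar_part_props(1,2)[OF rs'(1)] rs'(2) unfolding reduction_seq_def
    by (simp add: successively_map hd_map)
qed

text \<open>
  Among the pairs of degree \<open>d\<close> the sugar strategy compares lcms as the normal strategy does; all
  other homogeneous pairs have larger degree.
\<close>

lemma sugar_selectable_normal:
  assumes sel: "sugar_selectable u p" and sug: "pair_sugar u p = d"
  shows "snd p < n1" "fst p < snd p" "normal_selectable sh p" "pair_deg sh1 p = d"
proof -
  obtain i j where p: "p = (i, j)" by (cases p)
  have pa: "p \<in> avail u" using sel by (simp add: sugar_selectable_def)
  then have ij: "i < j" "j < length (basis u)" using tracks_valid[of p] p by auto
  have j: "j < n1" using new_pair_sugar[of i j] ij sug p by fastforce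
  then show "snd p < n1" "fst p < snd p" using p ij by simp_all
  show deg: "pair_deg sh1 p = d" using old_pair(3)[OF ij(1) j] sug p by simp
  have "p \<in> avail sh" using tracks_pairs[OF ij(1) j] deg pa p by simp
  moreover have "\<not> pair_coprime sh p" using sel old_pair(6)[OF ij(1) j] p by (simp add: sugar_selectable_def)
  moreover have "drl_le (pair_lcm sh p) (pair_lcm sh q)" if q: "q \<in> avail sh" for q
  proof -
    obtain k l where kl: "q = (k, l)" by (cases q)
    have kl': "k < l" "l < length (basis sh)" using homogeneous_inv_avail[OF tracks_inv, of q] q kl by auto
    have pd: "mdeg (pair_lcm sh p) = d" using old_pair(5)[OF ij(1) j] deg p by (simp add: pair_deg_def)
    show ?thesis
    proof (cases "l < n1 \<and> pair_deg sh1 q \<le> d")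
      case True
      then have "q \<in> avail u" using tracks_pairs[OF kl'(1)] q kl by simp
      then have "pair_sugar u p < pair_sugar u q \<or>
          pair_sugar u p = pair_sugar u q \<and> drl_le (pair_lcm u p) (pair_lcm u q)"
        using sel by (simp add: sugar_selectable_def)
      then have "drl_le (pair_lcm u p) (pair_lcm u q)"
        using old_pair(3)[OF kl'(1)] True sug kl by simp
      then have "drl_le (emb (pair_lcm u p)) (emb (pair_lcm u q))" by simp
      then show ?thesis using old_pair(2)[OF ij(1) j] old_pair(2)[OF kl'(1)] True p kl by simp
    next
      case False
      have "d < pair_deg sh q"
      proof (cases "l < n1")
        case True
        then show ?thesis using False old_pair(5)[OF kl'(1) True] kl by simp
      next
        case False
        then show ?thesis using new_pair_deg[OF kl'(1) _ kl'(2)] kl by simp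
      qed
      then show ?thesis using pd by (simp add: drl_le_def drl_less_def pair_deg_def)
    qed
  qed
  ultimately show "normal_selectable sh p" by (simp add: normal_selectable_def)
qed

text \<open>
  Of the two polynomials that may enter the affine basis, only the sugar-preserving remainder has a
  counterpart; the final one has larger sugar degree if it is different.
\<close>

lemma tracks_process:
  assumes st: "sugar_step u (Process p rs) u'" and sug: "pair_sugar u p = d"
  shows "\<exists>sh'. normal_step sh (Process p (map (\<lambda>r. (lift d (fst r), d)) (sugar_part rs))) sh' \<and> tracks u' sh'"
proof -
  have sel: "sugar_selectable u p" and rs: "reduction_seq u p rs" and ex: "sugar_exhausted u rs"
    and fin: "irreducible_by u (last rs) \<or> sugar_part rs = rs"
    and u': "u' = insert_results u p (remdups [last (sugar_part rs), last rs])" using st by auto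
  note selp = sugar_selectable_normal[OF sel sug]
  have pa: "p \<in> avail u" using sel by (simp add: sugar_selectable_def)
  have ne: "rs \<noteq> []" "hd rs = (pair_spoly u p, d)" "successively (sred (basis u)) rs"
    using rs sug by (simp_all add: reduction_seq_def)
  note sp = sugar_part_props[OF ne(1)]
  note red = sugar_reduction[OF selp(2,1) sug rs]
  define r where "r = fst (last (sugar_part rs))"
  have last_in: "last (sugar_part rs) \<in> set (sugar_part rs)" using sp(1) by simp
  have last: "last (sugar_part rs) = (r, d)" using sp(3)[OF last_in] ne(2) by (simp add: r_def prod_eq_iff)
  have pr: "pdeg r \<le> d" using red(1) last_in sugar_part_subset last by fastforce
  have no: "\<nexists>r'. sred (basis u) (r, d) r' \<and> snd r' = d" using ex last by (simp add: sugar_exhausted_def)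
  note irr = sugar_exhausted_irreducible[OF pr no]
  let ?rh = "map (\<lambda>r. (lift d (fst r), d)) (sugar_part rs)"
  have lrh: "last ?rh = (lift d r, d)" using sp(1) last by (simp add: last_map)
  define sh' where "sh' = insert_results sh p [(lift d r, d)]"
  have step: "normal_step sh (Process p ?rh) sh'"
    using selp(3) red(2) irr(1) lrh by (simp add: sh'_def)
  define l where "l = last rs"
  have pl: "pdeg (fst l) \<le> d" using red(1) ne(1) by (simp add: l_def)
  \<comment> \<open>A last polynomial of sugar degree \<open>d\<close> ends the sugar-preserving part.\<close>
  have l_cases: "l = (r, d) \<or> d < snd l"
  proof (rule disjCI)
    assume "\<not> d < snd l"
    then have "sugar_part rs = rs" using sugar_part_eq_self[OF ne(3,1)] ne(2) by (simp add: l_def)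
    then show "l = (r, d)" using last by (simp add: l_def)
  qed
  let ?new = "filter (\<lambda>q. fst q \<noteq> 0) (remdups [(r, d), l])"
  have bu': "basis u' = basis u @ ?new" by (simp add: u' last flip: l_def)
  have bsh': "basis sh' = basis sh @ filter (\<lambda>q. fst q \<noteq> 0) [(lift d r, d)]" by (simp add: sh'_def)
  have new: "map (\<lambda>(g, s). (lift d g, d)) (filter (\<lambda>(g, s). s \<le> d) ?new)
      = filter (\<lambda>q. fst q \<noteq> 0) [(lift d r, d)]"
    using l_cases lift_eq_0_iff[OF pr] by (cases l) auto
  have "tracks u' sh'" unfolding tracks_def
  proof (intro conjI)
    show "homogeneous_inv F sh'" using homogeneous_inv_normal_step[OF tracks_inv step] .
    show "\<exists>trh. run normal_step (init (map phom fs)) trh sh'"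
      using tracks_run run_append[where step = normal_step, OF _ step] by blast
    obtain xs where xs: "basis u = basis s1 @ xs"
      "basis sh = basis sh1 @ map (\<lambda>(g, s). (lift d g, d)) (filter (\<lambda>(g, s). s \<le> d) xs)"
      "\<forall>(g, s)\<in>set xs. g \<noteq> 0 \<and> pdeg g \<le> d \<and> d \<le> s" by (rule tracks_basis) (rule that; assumption)
    have "\<forall>(g, s)\<in>set (xs @ ?new). g \<noteq> 0 \<and> pdeg g \<le> d \<and> d \<le> s"
      using xs(3) pr pl l_cases by auto
    moreover have "basis u' = basis s1 @ (xs @ ?new)" using bu' xs(1) by simp
    moreover have "basis sh' = basis sh1 @ map (\<lambda>(g, s). (lift d g, d)) (filter (\<lambda>(g, s). s \<le> d) (xs @ ?new))"
      using bsh' xs(2) new by (simp only: filter_append map_append append_assoc)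
    ultimately show "\<exists>xs. basis u' = basis s1 @ xs \<and>
        basis sh' = basis sh1 @ map (\<lambda>(g, s). (lift d g, d)) (filter (\<lambda>(g, s). s \<le> d) xs) \<and>
        (\<forall>(g, s)\<in>set xs. g \<noteq> 0 \<and> pdeg g \<le> d \<and> d \<le> s)" by blast
    show "\<forall>i j. i < j \<longrightarrow> n1 \<le> j \<longrightarrow> j < length (basis u') \<longrightarrow> sugar_at u' j \<le> d \<longrightarrow>
        \<not> (mdvd (lm (poly_at u' i)) (lm (poly_at u' j)) \<and>
           sugar_at u' i + mdeg (lm (poly_at u' j) - lm (poly_at u' i)) \<le> d)"
    proof (intro allI impI notI)
      fix i j assume ij: "i < j" "n1 \<le> j" "j < length (basis u')" "sugar_at u' j \<le> d"
        and dv: "mdvd (lm (poly_at u' i)) (lm (poly_at u' j)) \<and>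
           sugar_at u' i + mdeg (lm (poly_at u' j) - lm (poly_at u' i)) \<le> d"
      note at = poly_at_append[OF bu'] sugar_at_append[OF bu']
      show False
      proof (cases "j < length (basis u)")
        case True
        then show False using tracks_new_u[OF ij(1,2) True] ij dv at by simp
      next
        case False
        let ?k = "j - length (basis u)"
        have k: "?k < length ?new" "basis u' ! j = ?new ! ?k" using False ij(3) by (auto simp: bu' nth_append)
        then have mem: "basis u' ! j \<in> set ?new" by (metis nth_mem)
        then have mem': "basis u' ! j = (r, d) \<or> basis u' ! j = l" "fst (basis u' ! j) \<noteq> 0"
          by (auto split: if_splits)
        have sj: "snd (basis u' ! j) \<le> d" using ij(4) by (simp add: sugar_at_def)
        have jr: "basis u' ! j = (r, d)" using mem'(1) sj l_cases by auto
        then have "r \<noteq> 0" using mem'(2) by simp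
        then have form: "?new = (r, d) # (if l = (r, d) \<or> fst l = 0 then [] else [l])" by auto
        have "j - length (basis u) = 0"
          using k jr unfolding form by (cases "j - length (basis u)") (auto split: if_splits)
        then have i: "i < length (basis u)" using ij(1) False by simp
        have "(poly_at u i, sugar_at u i) \<in> set (basis u)" using i by (simp add: poly_at_def sugar_at_def)
        then show False
          using irr(2)[of "poly_at u i" "sugar_at u i" "lm r"] lm_in_keys[OF \<open>r \<noteq> 0\<close>] dv at[OF i] jr
          by (simp add: poly_at_def[of u' j])
      qed
    qed
    show "\<forall>i j. i < j \<longrightarrow> n1 \<le> j \<longrightarrow> j < length (basis sh') \<longrightarrow>
        \<not> mdvd (lm (poly_at sh' i)) (lm (poly_at sh' j))"
    proof (intro allI impI notI)
      fix i j assume ij: "i < j" "n1 \<le> j" "j < length (basis sh')"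
        and dv: "mdvd (lm (poly_at sh' i)) (lm (poly_at sh' j))"
      note at = poly_at_append[OF bsh']
      show False
      proof (cases "j < length (basis sh)")
        case True
        then show False using tracks_new_sh[OF ij(1,2) True] ij dv at by simp
      next
        case False
        then have j: "j = length (basis sh)" "lift d r \<noteq> 0" using ij(3) by (auto simp: bsh' split: if_splits)
        then have "poly_at sh' j = lift d r" by (simp add: poly_at_def bsh')
        moreover have "poly_at sh i \<in> polys sh" using ij(1) j by (simp add: poly_at_in_polys)
        moreover from this have "\<not> mdvd (lm (poly_at sh i)) (lm (lift d r))"
          using irr(1)[of 0, unfolded irreducible_by_iff fst_conv] lm_in_keys[OF j(2)] by blast
        ultimately show False using dv at[of i] ij(1) j(1) by simp
      qed
    qed
    obtain qs where qs: "u' = insert_results u p qs" using u' by blast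
    show "avail u' \<union> treated u' \<subseteq> {(i, j). i < j \<and> j < length (basis u')}"
    proof
      fix q assume q: "q \<in> avail u' \<union> treated u'"
      have "q \<in> avail u \<union> treated u \<or> (fst q < snd q \<and> snd q < length (basis u'))"
        using q pa by (auto simp: qs)
      moreover have "length (basis u) \<le> length (basis u')" unfolding qs by simp
      ultimately show "q \<in> {(i, j). i < j \<and> j < length (basis u')}"
        using tracks_valid[of q] by (cases q) auto
    qed
    show "\<forall>i j. i < j \<longrightarrow> j < n1 \<longrightarrow> pair_deg sh1 (i, j) \<le> d \<longrightarrow>
        ((i, j) \<in> avail u' \<longleftrightarrow> (i, j) \<in> avail sh') \<and> ((i, j) \<in> treated u' \<longleftrightarrow> (i, j) \<in> treated sh')"
    proof (intro allI impI)
      fix i j assume ij: "i < j" "j < n1" "pair_deg sh1 (i, j) \<le> d"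
      have "j < length (basis u)" "j < length (basis sh)" using ij(2) length_u by simp_all
      then show "((i, j) \<in> avail u' \<longleftrightarrow> (i, j) \<in> avail sh') \<and> ((i, j) \<in> treated u' \<longleftrightarrow> (i, j) \<in> treated sh')"
        using tracks_pairs[OF ij] by (simp add: u' sh'_def)
    qed
  qed
  with step show ?thesis by blast
qed

lemma tracks_polys:
  "polys sh = {lift s g | g s. (g, s) \<in> set (basis u) \<and> s \<le> d} \<union> F"
proof
  show "polys sh \<subseteq> {lift s g | g s. (g, s) \<in> set (basis u) \<and> s \<le> d} \<union> F"
  proof
    fix h assume "h \<in> polys sh"
    then obtain g s where "(g, s) \<in> set (basis u)" "h = lift s g" "s \<le> d \<or> h \<in> F"
      by (rule sh_is_lift)
    then show "h \<in> {lift s g | g s. (g, s) \<in> set (basis u) \<and> s \<le> d} \<union> F" by blast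
  qed
  have "F \<subseteq> polys sh" using tracks_inv by (simp add: homogeneous_inv_def)
  moreover have "lift s g \<in> polys sh" if "(g, s) \<in> set (basis u)" "s \<le> d" for g s
    using lift_in_sh[OF that] by (auto intro: rev_image_eqI)
  ultimately show "{lift s g | g s. (g, s) \<in> set (basis u) \<and> s \<le> d} \<union> F \<subseteq> polys sh"
    by blast
qed

text \<open>
  Once the pairs of degree \<open>d\<close> are treated, the homogeneous basis is a Groebner basis up to
  degree \<open>d\<close>.  A monomial \<open>t\<close> of degree \<open>d\<close> lies in the ideal of the top parts, hence is the
  value at \<open>y = 0\<close> of an element of the homogeneous ideal, whose leading monomial is then \<open>t\<close>.
\<close>

lemma all_monomials_covered:
  assumes dreg: "\<And>p. homogeneous d p \<Longrightarrow> p \<in> ideal_gen (ptop ` set fs)"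
    and avail: "\<forall>p\<in>avail u. d < pair_sugar u p" and t: "mdeg t = d"
  shows "\<exists>g\<in>polys u. mdvd (lm g) t"
proof -
  have deg: "d + 1 \<le> pair_deg sh q" if q: "q \<in> avail sh" for q
  proof -
    obtain k l where kl: "q = (k, l)" by (cases q)
    have kl': "k < l" "l < length (basis sh)" using homogeneous_inv_avail[OF tracks_inv, of q] q kl by auto
    show ?thesis
    proof (cases "l < n1")
      case True
      show ?thesis
      proof (rule ccontr)
        assume "\<not> d + 1 \<le> pair_deg sh q"
        then have "pair_deg sh1 q \<le> d" using old_pair(5)[OF kl'(1) True] kl by simp
        moreover from this have "q \<in> avail u" using tracks_pairs[OF kl'(1) True] q kl by simp
        ultimately show False using avail old_pair(3)[OF kl'(1) True] kl by force
      qed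
    next
      case False
      then show ?thesis using new_pair_deg[OF kl'(1) _ kl'(2)] kl by simp
    qed
  qed
  have "homogeneous d (single t (1::'k))" using homogeneous_single[of t] t by simp
  then obtain Q where Q: "Q \<in> ideal_gen F" "homogeneous d Q" "spec 0 Q = single t 1"
    using ideal_gen_ptop_lift dreg by metis
  have tQ: "emb t \<in> keys Q" using lookup_spec0[of Q t] Q(3) by (simp add: in_keys_iff)
  then have "Q \<noteq> 0" by auto
  have dQ: "mdeg (lm Q) = d" using homogeneous_mdeg_lm[OF Q(2) \<open>Q \<noteq> 0\<close>] .
  have "lookup (lm Q) None = 0"
  proof (rule ccontr)
    assume "lookup (lm Q) None \<noteq> 0"
    then have "drl_less (lm Q) (emb t)" using dQ t by (intro y_less) simp_all
    then show False using lm_max[OF \<open>Q \<noteq> 0\<close> tQ] by (metis drl_less_le_trans drl_less_irrefl)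
  qed
  then have "emb (unemb (lm Q)) = lm Q" by (rule emb_unemb)
  moreover from this have "lookup (single t (1::'k)) (unemb (lm Q)) \<noteq> 0"
    using lm_in_keys[OF \<open>Q \<noteq> 0\<close>] lookup_spec0[of Q "unemb (lm Q)"] Q(3) by (simp add: in_keys_iff)
  ultimately have lmQ: "lm Q = emb t" by (auto simp: lookup_single when_def split: if_splits)
  obtain h where h: "h \<in> polys sh" "mdvd (lm h) (lm Q)"
    using homogeneous_inv_groebner[OF tracks_inv deg Q(1,2) \<open>Q \<noteq> 0\<close>] by auto
  obtain g s where g: "(g, s) \<in> set (basis u)" "h = lift s g" using sh_is_lift[OF h(1)] by metis
  have "lm h = hz s (lm g)" using lm_lift(1)[OF basis_u(2,1)[OF g(1)]] g(2) by simp
  then have "mdvd (lm g) t" using h(2) lmQ by (simp add: mdvd_option)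
  then show ?thesis using g(1) by force
qed

end

lemma sugar_run_tracks:
  assumes "run sugar_step u tr s2" "tracks u sh" "\<forall>(v, p)\<in>processed tr. pair_sugar v p = d"
  shows "(\<exists>sh2. tracks s2 sh2) \<and> (\<forall>v p rs. (v, Process p rs) \<in> set tr \<longrightarrow>
    (\<exists>shv v'. tracks v shv \<and> sugar_step v (Process p rs) v'))"
  using assms
proof (induction arbitrary: sh rule: run.induct)
  case (run_Nil s)
  then show ?case by auto
next
  case (run_Cons u e u' tr s2)
  have "\<exists>sh'. tracks u' sh'"
  proof (cases e)
    case (Discard p)
    then show ?thesis using tracks_discard[OF run_Cons.prems(1)] run_Cons.hyps(1) by simp
  next
    case (Process p rs)
    then have "(u, p) \<in> processed ((u, e) # tr)" by (auto simp: processed_def)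
    then have "pair_sugar u p = d" using run_Cons.prems(2) by blast
    then show ?thesis using tracks_process[OF run_Cons.prems(1)] run_Cons.hyps(1) Process by blast
  qed
  then obtain sh' where "tracks u' sh'" ..
  moreover have "\<forall>(v, p)\<in>processed tr. pair_sugar v p = d" using run_Cons.prems(2) by (auto simp: processed_def)
  ultimately have "(\<exists>sh2. tracks s2 sh2) \<and> (\<forall>v p rs. (v, Process p rs) \<in> set tr \<longrightarrow>
    (\<exists>shv v'. tracks v shv \<and> sugar_step v (Process p rs) v'))" by (rule run_Cons.IH)
  then show ?case using run_Cons.hyps(1) run_Cons.prems(1) by auto
qed

end

section \<open>Solving degrees\<close>

definition covers :: "nat \<Rightarrow> ('v::linorder, 'k::zero) mpoly set \<Rightarrow> bool" where
  "covers d G \<longleftrightarrow> (\<forall>t. mdeg t = d \<longrightarrow> (\<exists>g\<in>G. mdvd (lm g) t))"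

lemma exists_divisor_of_degree:
  assumes "d \<le> mdeg (t :: 'v::finite mon)" shows "\<exists>s. mdvd s t \<and> mdeg s = d"
  using assms
proof (induction "mdeg t - d" arbitrary: t)
  case 0
  then show ?case by (intro exI[of _ t]) simp
next
  case (Suc n)
  then have "t \<noteq> 0" by auto
  then obtain v where v: "lookup t v \<noteq> 0" by (metis lookup_zero poly_mapping_eqI)
  then have dv: "mdvd (single v 1) t" by (auto simp: mdvd_def lookup_single when_def)
  let ?t = "t - single v 1"
  have "mdeg ?t = mdeg t - 1" using mdeg_minus[OF dv] by simp
  then have "n = mdeg ?t - d" "d \<le> mdeg ?t" using Suc.hyps(2) by linarith+
  then obtain s where "mdvd s ?t" "mdeg s = d" using Suc.hyps(1)[of ?t] by blast
  moreover have "mdvd ?t t" using mdvd_minus_add[OF dv] mdvd_add(1) by metis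
  ultimately show ?case using mdvd_trans by blast
qed

lemma covers_le:
  fixes G :: "('v::{finite,linorder}, 'k::zero) mpoly set"
  assumes "covers d G" "d \<le> mdeg t"
  obtains g s where "g \<in> G" "mdvd (lm g) s" "mdvd s t" "mdeg s = d"
proof -
  obtain s where s: "mdvd s t" "mdeg s = d" using exists_divisor_of_degree[OF assms(2)] by blast
  then obtain g where "g \<in> G" "mdvd (lm g) s" using assms(1) unfolding covers_def by blast
  with s show thesis by (intro that)
qed

lemma covers_irreducible_mdeg:
  fixes G :: "('v::{finite,linorder}, 'k::zero) mpoly set"
  assumes "covers d G" "\<forall>t\<in>keys r. \<forall>g\<in>G. \<not> mdvd (lm g) t" "t \<in> keys r" shows "mdeg t < d"
proof (rule ccontr)
  assume "\<not> mdeg t < d"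
  then have "d \<le> mdeg t" by simp
  with assms(1) obtain g s where "g \<in> G" "mdvd (lm g) s" "mdvd s t" "mdeg s = d"
    by (rule covers_le)
  then show False using assms(2,3) mdvd_trans by blast
qed

definition valid_state :: "('v::linorder, 'k::zero) mpoly state \<Rightarrow> bool" where
  "valid_state s \<longleftrightarrow> 0 \<notin> polys s \<and> avail s \<subseteq> {(i, j). i < j \<and> j < length (basis s)}"

lemma valid_pair_lcm:
  assumes "valid_state s" "p \<in> avail s"
  obtains g1 g2 where "g1 \<in> polys s" "g2 \<in> polys s" "g1 \<noteq> 0" "g2 \<noteq> 0"
    "pair_lcm s p = mlcm (lm g1) (lm g2)" "pair_coprime s p \<longleftrightarrow> mcoprime (lm g1) (lm g2)"
    "g1 = poly_at s (fst p)" "g2 = poly_at s (snd p)"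
proof -
  have "fst p < length (basis s)" "snd p < length (basis s)" using assms by (auto simp: valid_state_def)
  then have "poly_at s (fst p) \<in> polys s" "poly_at s (snd p) \<in> polys s" by (auto intro: poly_at_in_polys)
  then show thesis using that[of "poly_at s (fst p)" "poly_at s (snd p)"] assms(1)
    by (simp add: valid_state_def pair_lcm_def pair_coprime_def) metis
qed

text \<open>After degree \<open>d\<close> every remainder has degree below \<open>d\<close>, since all monomials of degree at
  least \<open>d\<close> are reducible.\<close>

definition saturated :: "nat \<Rightarrow> ('v::linorder, 'k::zero) mpoly state \<Rightarrow> bool" where
  "saturated d s \<longleftrightarrow> valid_state s \<and> covers d (polys s) \<and> (\<forall>g\<in>polys s. mdeg (lm g) \<le> d)"

lemma final_step:
  fixes s :: "('v::{finite,linorder}, 'k::field) mpoly state"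
  assumes sat: "saturated d s" and st: "normal_step s e s' \<or> late_sugar_step s e s'"
  shows "saturated d s'"
    and "g \<in> polys s' \<Longrightarrow> g \<in> polys s \<or> (g \<noteq> 0 \<and> mdeg (lm g) < d)"
    and "e = Process p rs \<Longrightarrow> p \<in> avail s \<and> \<not> pair_coprime s p"
proof -
  show "e = Process p rs \<Longrightarrow> p \<in> avail s \<and> \<not> pair_coprime s p"
    using st by (auto simp: normal_selectable_def sugar_selectable_def)
  have new: "(\<forall>g\<in>polys s'. g \<in> polys s \<or> (g \<noteq> 0 \<and> mdeg (lm g) < d)) \<and> polys s \<subseteq> polys s' \<and> valid_state s'"
  proof (cases e)
    case (Discard p)
    have "basis s' = basis s \<and> avail s' = avail s - {p}"
      using st Discard by (auto simp: discarded_def split: if_splits)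
    then show ?thesis using sat by (auto simp: saturated_def valid_state_def)
  next
    case (Process p rs)
    have s': "s' = insert_results s p [last rs]" and irr: "irreducible_by s (last rs)"
      using st Process by auto
    have "mdeg (lm (fst (last rs))) < d" if "fst (last rs) \<noteq> 0"
      using covers_irreducible_mdeg[of d "polys s" "fst (last rs)"] irr sat lm_in_keys[OF that]
      by (simp add: saturated_def irreducible_by_iff)
    moreover have "polys s' = polys s \<union> ({fst (last rs)} - {0})" unfolding s' by auto
    moreover have "avail s' \<subseteq> {(i, j). i < j \<and> j < length (basis s')}"
    proof -
      have "avail s' \<subseteq> avail s \<union> {(k, l). k < l \<and> l < length (basis s')}" unfolding s' by auto
      moreover have "length (basis s) \<le> length (basis s')" unfolding s' by simp
      moreover have "avail s \<subseteq> {(i, j). i < j \<and> j < length (basis s)}"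
        using sat by (simp add: saturated_def valid_state_def)
      ultimately show ?thesis by auto
    qed
    ultimately show ?thesis using sat by (auto simp: saturated_def valid_state_def)
  qed
  then show "g \<in> polys s' \<Longrightarrow> g \<in> polys s \<or> (g \<noteq> 0 \<and> mdeg (lm g) < d)" by blast
  have "covers d (polys s')" using new sat unfolding saturated_def covers_def by blast
  moreover have "\<forall>g\<in>polys s'. mdeg (lm g) \<le> d" using new sat unfolding saturated_def by fastforce
  ultimately show "saturated d s'" using new by (simp add: saturated_def)
qed

lemma run_invariant:
  assumes "run step s tr s'" "P s" "\<And>s e s'. P s \<Longrightarrow> step s e s' \<Longrightarrow> P s'" "(u, e) \<in> set tr"
  shows "P u \<and> (\<exists>u'. step u e u')"
  using assms
proof (induction rule: run.induct)
  case (run_Cons s e' s1 tr s2)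
  then show ?case by (cases "(u, e) = (s, e')") auto
qed simp

lemma late_pair_deg:
  fixes s :: "('v::{finite,linorder}, 'k::field) mpoly state"
  assumes run: "run late_sugar_step s tr s'" and sat: "saturated d s" and p: "(u, p) \<in> processed tr"
  shows "pair_deg u p \<le> 2 * d - 1"
proof -
  obtain rs where "(u, Process p rs) \<in> set tr" using p by (auto simp: processed_def)
  then obtain u' where u: "saturated d u" "late_sugar_step u (Process p rs) u'"
    using run_invariant[of late_sugar_step s tr s' "saturated d" u "Process p rs"] run sat final_step(1)
    by metis
  have "p \<in> avail u \<and> \<not> pair_coprime u p" by (rule final_step(3)[OF u(1)]) (use u(2) in auto)
  moreover have "valid_state u" using u(1) by (simp add: saturated_def)
  ultimately obtain g1 g2 where g: "g1 \<in> polys u" "g2 \<in> polys u" "pair_lcm u p = mlcm (lm g1) (lm g2)"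
    "\<not> mcoprime (lm g1) (lm g2)" using valid_pair_lcm[of u p] by metis
  have "mdeg (lm g1) \<le> d" "mdeg (lm g2) \<le> d" using u(1) g by (auto simp: saturated_def)
  then show ?thesis using mdeg_mlcm_not_coprime[OF g(4)] g(3) by (simp add: pair_deg_def)
qed

text \<open>
  When the leading monomials cover degree \<open>d\<close>, inter-reduced polynomials have no second term of that
  degree, since it would be reducible.  For two such polynomials the terms of degree \<open>2 d - 1\<close> of the S-polynomial cancel.
\<close>

definition top_monomial :: "nat \<Rightarrow> ('v::linorder, 'k::zero) mpoly \<Rightarrow> bool" where
  "top_monomial d g \<longleftrightarrow> (mdeg (lm g) = d \<longrightarrow> (\<forall>t\<in>keys g - {lm g}. mdeg t < d))"

lemma pdeg_spoly_top_monomial: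
  fixes g1 g2 :: "('v::{finite,linorder}, 'k::field) mpoly"
  assumes nz: "g1 \<noteq> 0" "g2 \<noteq> 0" and le: "mdeg (lm g1) \<le> d" "mdeg (lm g2) \<le> d"
    and top: "top_monomial d g1" "top_monomial d g2" and cop: "\<not> mcoprime (lm g1) (lm g2)"
  shows "pdeg (spoly g1 g2) \<le> 2 * d - 2"
proof (cases "mdeg (lm g1) = d \<and> mdeg (lm g2) = d")
  case False
  then have "mdeg (mlcm (lm g1) (lm g2)) \<le> 2 * d - 2" using mdeg_mlcm_not_coprime[OF cop] le by linarith
  then show ?thesis using pdeg_spoly_le[OF nz] by simp
next
  case True
  let ?L = "mlcm (lm g1) (lm g2)"
  have "mdeg t \<le> 2 * d - 2" if "t \<in> keys (spoly g1 g2)" for t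
  proof -
    have L: "mdeg ?L \<le> 2 * d - 1" using mdeg_mlcm_not_coprime[OF cop] True by simp
    have bound: "mdeg ((?L - lm g) + s) < mdeg ?L"
      if "g \<in> {g1, g2}" "s \<in> keys g - {lm g}" for g s
    proof -
      have dv: "mdvd (lm g) ?L" using that(1) by auto
      have "mdeg s < d" "mdeg (lm g) = d" using that True top by (auto simp: top_monomial_def)
      then show ?thesis using mdeg_minus[OF dv] mdvd_mdeg[OF dv] by simp
    qed
    from nz that have "mdeg t < mdeg ?L" by (cases rule: keys_spoly) (use bound in auto)
    with L show ?thesis by simp
  qed
  then show ?thesis by (simp add: pdeg_le_iff)
qed

lemma strict_pair_pdeg:
  fixes s :: "('v::{finite,linorder}, 'k::field) mpoly state"
  assumes run: "run normal_step s tr s'" and sat: "saturated d s" and top: "\<forall>g\<in>polys s. top_monomial d g"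
    and p: "(u, p) \<in> processed tr"
  shows "pdeg (pair_spoly u p) \<le> 2 * d - 2"
proof -
  let ?P = "\<lambda>s :: ('v, 'k) mpoly state. saturated d s \<and> (\<forall>g\<in>polys s. top_monomial d g)"
  obtain rs where "(u, Process p rs) \<in> set tr" using p by (auto simp: processed_def)
  moreover have "?P v'" if "?P v" "normal_step v e v'" for v e v'
  proof -
    note fs = final_step(1,2)[of d v e v'] that
    then have "saturated d v'" by blast
    moreover have "top_monomial d g" if "g \<in> polys v'" for g
      using fs that unfolding top_monomial_def by (metis less_irrefl)
    ultimately show ?thesis by blast
  qed
  ultimately obtain u' where u: "?P u" "normal_step u (Process p rs) u'"
    using run_invariant[of normal_step s tr s' ?P u "Process p rs"] run sat top by metis
  have "p \<in> avail u \<and> \<not> pair_coprime u p" using u(2) by (auto simp: normal_selectable_def)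
  moreover have "valid_state u" using u(1) by (simp add: saturated_def)
  ultimately obtain g1 g2 where g: "g1 \<in> polys u" "g2 \<in> polys u" "g1 \<noteq> 0" "g2 \<noteq> 0"
    "\<not> mcoprime (lm g1) (lm g2)" "g1 = poly_at u (fst p)" "g2 = poly_at u (snd p)"
    using valid_pair_lcm[of u p] by metis
  have "mdeg (lm g1) \<le> d" "mdeg (lm g2) \<le> d" "top_monomial d g1" "top_monomial d g2"
    using u(1) g(1,2) unfolding saturated_def by blast+
  then show ?thesis unfolding pair_spoly_def g(6,7)[symmetric]
    by (rule pdeg_spoly_top_monomial[OF g(3,4) _ _ _ _ g(5)])
qed

text \<open>
  The step happens below the leading monomial and only changes smaller terms.
\<close>

lemma red_at_lm:
  fixes h :: "('v::{finite,linorder}, 'k::field) mpoly"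
  assumes red: "red_at t h g g'" and "h \<noteq> 0" "g \<noteq> 0" "t \<noteq> lm g"
  shows "g' \<noteq> 0 \<and> lm g' = lm g"
proof -
  have t: "t \<in> keys g" "mdvd (lm h) t" using red by (auto simp: red_at_def)
  then have less: "drl_less t (lm g)" using lm_max[OF \<open>g \<noteq> 0\<close>] assms(4) by (auto simp: drl_le_def)
  have "lm g \<notin> keys (single (t - lm h) (lookup g t / lc h) * h)"
  proof
    assume "lm g \<in> keys (single (t - lm h) (lookup g t / lc h) * h)"
    then obtain u where u: "lm g = (t - lm h) + u" "u \<in> keys h" by (rule keys_monom_mult)
    have "drl_le ((t - lm h) + u) ((t - lm h) + lm h)" using lm_max[OF \<open>h \<noteq> 0\<close> u(2)] by simp
    then have "drl_le (lm g) t" using u(1) mdvd_minus_add[OF t(2)] by simp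
    with less show False by (metis drl_less_le_trans drl_less_irrefl)
  qed
  then have in_g': "lm g \<in> keys g'"
    using red lm_in_keys[OF \<open>g \<noteq> 0\<close>] by (simp add: red_at_def in_keys_iff lookup_minus)
  moreover have "drl_le s (lm g)" if "s \<in> keys g'" for s
    using red_at_keys[OF red \<open>h \<noteq> 0\<close> that] lm_max[OF \<open>g \<noteq> 0\<close>] less drl_less_trans
    by (auto simp: drl_le_def)
  ultimately have "lm g' = lm g" by (intro lm_eqI)
  with in_g' show ?thesis by auto
qed

text \<open>
  If the leading term of an element is reduced, its leading monomial was a multiple of another one;
  otherwise it stays.
\<close>

lemma interreduce_step_covers:
  fixes gs :: "('v::{finite,linorder}, 'k::field) mpoly list"
  assumes st: "interreduce_step gs hs" and nz: "0 \<notin> set gs" and cov: "covers d (set gs)"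
  shows "0 \<notin> set hs \<and> covers d (set hs)"
proof -
  obtain i j t g where ij: "i < length gs" "j < length gs" "i \<noteq> j" and red: "red_at t (gs ! j) (gs ! i) g"
    and hs: "hs = (if g = 0 then take i gs @ drop (Suc i) gs else gs[i := g])"
    using st unfolding interreduce_step_def by blast
  have nzi: "gs ! i \<noteq> 0" "gs ! j \<noteq> 0" using nz ij nth_mem by metis+
  have others: "gs ! k \<in> set hs" if "k < length gs" "k \<noteq> i" for k
  proof (cases "g = 0")
    case False
    then show ?thesis using hs that by (metis length_list_update nth_list_update_neq nth_mem)
  next
    case True
    have "gs ! k \<in> set (take i gs) \<union> set (drop (Suc i) gs)"
    proof (cases "k < i")
      case True
      then have "take i gs ! k = gs ! k" "k < length (take i gs)" using ij by auto
      then show ?thesis by (metis UnI1 nth_mem)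
    next
      case False
      then have "drop (Suc i) gs ! (k - Suc i) = gs ! k" "k - Suc i < length (drop (Suc i) gs)"
        using that by auto
      then show ?thesis by (metis UnI2 nth_mem)
    qed
    then show ?thesis using hs True by simp
  qed
  have "0 \<notin> set hs"
    using hs nz set_take_subset[of i gs] set_drop_subset[of "Suc i" gs] set_update_subset_insert[of gs i g]
    by (auto split: if_splits)
  moreover have "\<exists>h\<in>set hs. mdvd (lm h) (lm (gs ! i))"
  proof (cases "t = lm (gs ! i)")
    case True
    then have "mdvd (lm (gs ! j)) (lm (gs ! i))" using red by (simp add: red_at_def)
    then show ?thesis using others[of j] ij by auto
  next
    case False
    then have "g \<noteq> 0" "lm g = lm (gs ! i)" using red_at_lm[OF red nzi(2,1)] by auto
    moreover from this have "g \<in> set hs" using hs ij(1) by (simp add: set_update_memI)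
    ultimately show ?thesis by (intro bexI[of _ g]) simp_all
  qed
  moreover have "\<exists>h\<in>set hs. mdvd (lm h) t'" if t': "mdeg t' = d" for t'
  proof -
    obtain f where f: "f \<in> set gs" "mdvd (lm f) t'" using cov t' unfolding covers_def by blast
    then obtain k where "k < length gs" "mdvd (lm (gs ! k)) t'" by (auto simp: in_set_conv_nth)
    then show ?thesis using others[of k] calculation(2) mdvd_trans by (cases "k = i") blast+
  qed
  ultimately show ?thesis by (simp add: covers_def)
qed

text \<open>
  A term of degree at least \<open>d\<close> is divisible by the leading monomial of some element through a
  divisor of degree \<open>d\<close>; after inter-reduction this can only be the element itself.
\<close>

lemma interreduction_top_monomial:
  fixes gs :: "('v::{finite,linorder}, 'k::field) mpoly list"
  assumes ir: "interreduction gs hs" and nz: "0 \<notin> set gs" and cov: "covers d (set gs)"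
  shows "0 \<notin> set hs" "covers d (set hs)"
    and "g \<in> set hs \<Longrightarrow> mdeg (lm g) \<le> d \<and> top_monomial d g"
proof -
  have "interreduce_step\<^sup>*\<^sup>* gs hs" using ir by (simp add: interreduction_def)
  then have "0 \<notin> set hs \<and> covers d (set hs)"
    by (induction rule: rtranclp_induct) (use nz cov interreduce_step_covers in blast)+
  then show nzh: "0 \<notin> set hs" and covh: "covers d (set hs)" by auto
  assume "g \<in> set hs"
  then obtain i where i: "i < length hs" "g = hs ! i" by (metis in_set_conv_nth)
  have "g \<noteq> 0" using \<open>g \<in> set hs\<close> nzh by auto
  \<comment> \<open>No other element reduces a term of \<open>g\<close>.\<close>
  have irr: "j = i" if "t \<in> keys g" "j < length hs" "mdvd (lm (hs ! j)) t" for t j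
  proof (rule ccontr)
    assume "j \<noteq> i"
    have "red_at t (hs ! j) (hs ! i) (hs ! i - single (t - lm (hs ! j)) (lookup (hs ! i) t / lc (hs ! j)) * hs ! j)"
      using that i by (simp add: red_at_def)
    then have "\<exists>hs'. interreduce_step hs hs'" unfolding interreduce_step_def using i that(2) \<open>j \<noteq> i\<close> by blast
    then show False using ir by (simp add: interreduction_def)
  qed
  have key: "mdeg (lm g) \<le> d \<and> (mdeg (lm g) = d \<longrightarrow> t = lm g)" if t: "t \<in> keys g" "d \<le> mdeg t" for t
  proof -
    obtain h s where h: "h \<in> set hs" "mdvd (lm h) s" "mdvd s t" "mdeg s = d"
      by (rule covers_le[OF covh t(2)])
    then obtain j where j: "j < length hs" "h = hs ! j" by (metis in_set_conv_nth)
    then have "h = g" using irr[OF t(1) j(1)] h mdvd_trans i by blast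
    then have gs: "mdvd (lm g) s" "mdeg (lm g) \<le> d" using h mdvd_mdeg[OF h(2)] by auto
    moreover have "t = lm g" if "mdeg (lm g) = d"
    proof -
      have "mdeg t \<le> mdeg (lm g)" using lm_max[OF \<open>g \<noteq> 0\<close> t(1)] by (rule drl_le_mdeg)
      then show ?thesis using mdvd_mdeg_eq[OF gs(1)] mdvd_mdeg_eq[OF h(3)] that h(4) by simp
    qed
    ultimately show ?thesis by blast
  qed
  have "mdeg (lm g) \<le> d" using key[OF lm_in_keys[OF \<open>g \<noteq> 0\<close>]] by linarith
  moreover have "top_monomial d g" unfolding top_monomial_def
  proof (intro impI ballI, rule ccontr)
    fix t assume "mdeg (lm g) = d" "t \<in> keys g - {lm g}" "\<not> mdeg t < d"
    then show False using key[of t] by auto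
  qed
  ultimately show "mdeg (lm g) \<le> d \<and> top_monomial d g" by blast
qed

lemma finite_processed: "finite (processed tr)"
proof -
  have "processed tr \<subseteq> (\<lambda>(s, e). (s, case e of Process p rs \<Rightarrow> p | Discard p \<Rightarrow> p)) ` set tr"
  proof
    fix x assume "x \<in> processed tr"
    then obtain s p rs where "x = (s, p)" "(s, Process p rs) \<in> set tr" by (auto simp: processed_def)
    then show "x \<in> (\<lambda>(s, e). (s, case e of Process p rs \<Rightarrow> p | Discard p \<Rightarrow> p)) ` set tr"
      by (intro rev_image_eqI[of "(s, Process p rs)"]) simp_all
  qed
  then show ?thesis by (rule finite_subset) simp
qed

lemma alg_solving_degree_le:
  assumes "\<And>f. f \<in> set fs \<Longrightarrow> pdeg f \<le> b" "\<And>s p. (s, p) \<in> processed tr \<Longrightarrow> pair_deg s p \<le> b"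
  shows "alg_solving_degree fs tr \<le> b"
  unfolding alg_solving_degree_def using assms finite_processed[of tr] by (subst Max_le_iff) auto

lemma strict_solving_degree_le:
  assumes "\<And>s p. (s, p) \<in> processed tr \<Longrightarrow> pdeg (pair_spoly s p) \<le> b"
  shows "strict_solving_degree tr \<le> b"
proof -
  have "{pdeg (pair_spoly s p) | s p. (s, p) \<in> processed tr \<and> pair_spoly s p \<noteq> 0}
      \<subseteq> (\<lambda>(s, p). pdeg (pair_spoly s p)) ` processed tr" by (auto intro: rev_image_eqI)
  then have "finite {pdeg (pair_spoly s p) | s p. (s, p) \<in> processed tr \<and> pair_spoly s p \<noteq> 0}"
    by (rule finite_subset) (simp add: finite_processed)
  then show ?thesis unfolding strict_solving_degree_def using assms by (subst Max_le_iff) auto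
qed

lemma processed_append: "processed (tr @ tr') = processed tr \<union> processed tr'"
  by (auto simp: processed_def)

lemma (in low_degree) affine_processed_pdeg:
  assumes run: "run normal_step (init fs) tr s" and b: "\<forall>(v, e)\<in>set tr. below (enat d) v e"
    and D: "D = enat d" and p: "(u, p) \<in> processed tr"
  shows "pair_deg u p < d" "pdeg (pair_spoly u p) \<le> pair_deg u p"
proof -
  obtain rs where e: "(u, Process p rs) \<in> set tr" using p by (auto simp: processed_def)
  then show "pair_deg u p < d" using b by (fastforce simp: below_def)
  obtain sh u' where sh: "good sh" "u = spec_state 1 sh" "normal_step u (Process p rs) u'"
    using affine_run_lift[OF run _ spec_state_init(2)[symmetric] good_init] b D e by blast
  interpret y_free_state F sh using sh(1) by (rule good_y_free_state)
  have "p \<in> avail sh" using sh by (auto simp: normal_selectable_def)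
  then have v: "fst p < length (basis sh)" "snd p < length (basis sh)" using valid by auto
  have "poly_at u k \<noteq> 0" if "k < length (basis sh)" for k
    using basis_elem(7)[OF nth_elem[OF that], of 1] spec_at(1)[OF that, of 1] sh(2) by simp
  then show "pdeg (pair_spoly u p) \<le> pair_deg u p"
    unfolding pair_spoly_def pair_deg_def pair_lcm_def using v by (intro pdeg_spoly_le) auto
qed

context sugar_phase
begin

lemma sugar_processed_pdeg:
  assumes "run sugar_step s1 tr s2" "\<forall>(v, p)\<in>processed tr. pair_sugar v p = d" "(u, p) \<in> processed tr"
  shows "pair_deg u p = d" "pdeg (pair_spoly u p) \<le> d"
proof -
  obtain rs where rs: "(u, Process p rs) \<in> set tr" using assms(3) by (auto simp: processed_def)
  then obtain sh u' where u: "tracks u sh" "sugar_step u (Process p rs) u'"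
    using sugar_run_tracks[OF assms(1) tracks_init assms(2)] by blast
  have sug: "pair_sugar u p = d" using assms(2,3) by auto
  have sel: "sugar_selectable u p" using u(2) by simp
  note n = sugar_selectable_normal[OF u(1) sel sug]
  have ij: "fst p < snd p" "snd p < length (basis sh1)" by (fact n)+
  show deg: "pair_deg u p = d" using old_pair(4)[OF u(1) ij] n(4) by simp
  have "k < length (basis sh1) \<Longrightarrow> poly_at u k \<noteq> 0" for k
    using old.basis_elem(7)[OF old.nth_elem, of k 1] old_at(1)[OF u(1)] by simp
  then have "pdeg (pair_spoly u p) \<le> pair_deg u p"
    unfolding pair_spoly_def pair_deg_def pair_lcm_def using ij by (intro pdeg_spoly_le) auto
  with deg show "pdeg (pair_spoly u p) \<le> d" by simp
qed

lemma lifted_reduction: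
  assumes "run sugar_step s1 tr s2" "\<forall>(v, p)\<in>processed tr. pair_sugar v p = d"
    and e: "(u, Process (i, j) rs) \<in> set tr"
  shows "\<exists>trh sh sh'. run normal_step (init (map phom fs)) trh sh \<and>
     fst ` set (basis sh) = {lift s g | g s. (g, s) \<in> set (basis u) \<and> s \<le> d} \<union> phom ` set fs \<and>
     poly_at sh i = phom (poly_at u i) \<and> poly_at sh j = phom (poly_at u j) \<and>
     normal_step sh (Process (i, j) (map (\<lambda>r. (lift d (fst r), d)) (sugar_part rs))) sh'"
proof -
  obtain sh u' where u: "tracks u sh" "sugar_step u (Process (i, j) rs) u'"
    using sugar_run_tracks[OF assms(1) tracks_init assms(2)] e by blast
  have sug: "pair_sugar u (i, j) = d" using assms(2) e by (auto simp: processed_def)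
  have sel: "sugar_selectable u (i, j)" using u(2) by simp
  have "i < n1" "j < n1" using sugar_selectable_normal(1,2)[OF u(1) sel sug] by simp_all
  then have "poly_at sh i = phom (poly_at u i)" "poly_at sh j = phom (poly_at u j)"
    using old_at(6)[OF u(1)] by simp_all
  then show ?thesis using tracks_run[OF u(1)] tracks_polys[OF u(1)] tracks_process[OF u sug] by blast
qed

lemma end_of_phase:
  assumes "run sugar_step s1 tr s2" "\<forall>(v, p)\<in>processed tr. pair_sugar v p = d"
    and "\<forall>p\<in>avail s2. d < pair_sugar s2 p"
    and "\<forall>p. homogeneous d p \<longrightarrow> p \<in> ideal_gen (ptop ` set fs)"
  shows "covers d (polys s2)" "0 \<notin> polys s2"
    and "(\<forall>f\<in>set fs. pdeg f \<le> d) \<Longrightarrow> saturated d s2"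
proof -
  obtain sh where t: "tracks s2 sh" using sugar_run_tracks[OF assms(1) tracks_init assms(2)] by blast
  show cov: "covers d (polys s2)"
    unfolding covers_def using all_monomials_covered[OF t _ assms(3)] assms(4) by blast
  show nz: "0 \<notin> polys s2" using basis_u(1)[OF t] by force
  assume f: "\<forall>f\<in>set fs. pdeg f \<le> d"
  have "mdeg (lm g) \<le> d" if "(g, s) \<in> set (basis s2)" for g s
  proof -
    obtain xs where xs: "basis s2 = basis s1 @ xs"
      "\<forall>(g, s)\<in>set xs. g \<noteq> 0 \<and> pdeg g \<le> d \<and> d \<le> s" by (rule tracks_basis[OF t]) (rule that; assumption)
    show ?thesis
    proof (cases "(g, s) \<in> set (basis s1)")
      case True
      then obtain h where h: "(h, s) \<in> set (basis sh1)" "g = spec 1 h" by (auto simp: s1)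
      have "s \<le> d"
      proof (cases "h \<in> F")
        case True
        then obtain f' where f': "h = phom f'" "f' \<in> set fs" by auto
        then have "f' \<noteq> 0" using nonzero by auto
        then have "s = pdeg f'"
          using homogeneous_pdeg[OF old.basis_elem(1,2)[OF h(1)]] f'(1) pdeg_phom by metis
        then show ?thesis using f f'(2) by simp
      next
        case False
        then have "enat s < enat d" using good1 h(1) by (auto simp: good_def)
        then show ?thesis by simp
      qed
      then show ?thesis using basis_u(2,3)[OF t that] by simp
    next
      case False
      then have "(g, s) \<in> set xs" using that xs(1) by simp
      then show ?thesis using xs(2) basis_u(3)[OF t that] by auto
    qed
  qed
  then have "\<forall>g\<in>polys s2. mdeg (lm g) \<le> d" by force
  moreover have "avail s2 \<subseteq> {(i, j). i < j \<and> j < length (basis s2)}" using tracks_valid[OF t] by fastforce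
  ultimately show "saturated d s2" using cov nz by (simp add: saturated_def valid_state_def)
qed

end

text \<open>
  The infimum of a nonempty set of extended naturals is a member.
\<close>

lemma dreg_attained:
  assumes "dreg I = enat d" "homogeneous d p" shows "p \<in> I"
proof -
  let ?A = "enat ` {d. \<forall>p. homogeneous d p \<longrightarrow> p \<in> I}"
  have "?A \<noteq> {}"
  proof
    assume "?A = {}"
    then have "dreg I = \<infinity>" unfolding dreg_def by (simp add: Inf_enat_def)
    with assms(1) show False by simp
  qed
  then obtain k where "k \<in> ?A" by blast
  then have "Inf ?A \<in> ?A" by (rule wellorder_InfI)
  then have "enat d \<in> ?A" using assms(1) by (simp add: dreg_def)
  with assms(2) show ?thesis by auto
qed

lemma monomial_in_ideal:
  assumes "mdvd s t" "s \<in> L" shows "(single t 1 :: ('v, 'k::comm_ring_1) mpoly) \<in> ideal_gen ((\<lambda>s. single s 1) ` L)"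
proof -
  have "single (t - s) 1 * single s 1 \<in> ideal_gen ((\<lambda>s. single s (1::'k)) ` L)"
    using assms(2) by (intro ideal_gen_mult ideal_gen_base) auto
  then show ?thesis by (simp add: mult_single mdvd_minus_add[OF assms(1)])
qed

theorem theorem2:
  fixes fs :: "('x::{finite, linorder}, 'k::field) mpoly list" and D :: enat
  assumes nonzero: "0 \<notin> set fs"
    and semiregular: "crypto_semiregular (map ptop fs)"
    and D: "D = dreg (ideal_gen (set (map ptop fs)))"
    and D_pos: "0 < D"
  shows
    \<comment> \<open>below step degree \<open>D\<close>\<close>
    "(\<forall>st sh sa. jointly_reachable D fs (st, sh, sa) \<longrightarrow>
        corresponding_states st sh sa \<and>
        (\<forall>et st'. normal_step st et st' \<and> below D st et \<longrightarrow>
          (\<exists>eh sh' ea sa'. joint_move D (st, sh, sa) (et, eh, ea) (st', sh', sa'))) \<and>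
        (\<forall>eh sh'. normal_step sh eh sh' \<and> below D sh eh \<longrightarrow>
          (\<exists>et st' ea sa'. joint_move D (st, sh, sa) (et, eh, ea) (st', sh', sa'))) \<and>
        (\<forall>ea sa'. normal_step sa ea sa' \<and> below D sa ea \<longrightarrow>
          (\<exists>et st' eh sh'. joint_move D (st, sh, sa) (et, eh, ea) (st', sh', sa')))) \<and>
     (\<forall>tr s. run normal_step (init fs) tr s \<and> (\<forall>(u, e)\<in>set tr. below D u e) \<longrightarrow>
        (\<forall>(u, e)\<in>set tr. \<not> degree_fall u e)) \<and>
     \<comment> \<open>from step degree \<open>D\<close> on: \<open>tr1\<close> leads to the first stage at which the step degree reaches
        \<open>d\<close>, and \<open>tr2\<close> is a part of the processing of sugar degree \<open>d\<close>\<close>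
     (\<forall>d tr1 s1 tr2 s2.
        D = enat d \<and>
        run normal_step (init fs) tr1 s1 \<and> (\<forall>(u, e)\<in>set tr1. below D u e) \<and>
        (\<forall>p\<in>avail s1. d \<le> pair_deg s1 p) \<and>
        run sugar_step s1 tr2 s2 \<and> (\<forall>(u, p)\<in>processed tr2. pair_sugar u p = d) \<longrightarrow>
        (\<forall>u i j rs. (u, Process (i, j) rs) \<in> set tr2 \<longrightarrow>
          (\<exists>trh sh sh'.
            run normal_step (init (map phom fs)) trh sh \<and>
            fst ` set (basis sh) =
              {lift s g | g s. (g, s) \<in> set (basis u) \<and> s \<le> d} \<union> phom ` set fs \<and>
            poly_at sh i = phom (poly_at u i) \<and> poly_at sh j = phom (poly_at u j) \<and>
            normal_step sh
              (Process (i, j) (map (\<lambda>r. (lift d (fst r), d)) (sugar_part rs))) sh')) \<and>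
        \<comment> \<open>the end of sugar degree \<open>d\<close>\<close>
        ((\<forall>p\<in>avail s2. d < pair_sugar s2 p) \<longrightarrow>
          (\<forall>t. mdeg t = d \<longrightarrow>
            (single t 1 :: ('x, 'k) mpoly) \<in>
              ideal_gen {single (lm g) 1 | g. g \<in> fst ` set (basis s2)}) \<and>
          ((\<forall>f\<in>set fs. pdeg f \<le> d) \<longrightarrow>
            (\<forall>tr3 s3. run late_sugar_step s2 tr3 s3 \<longrightarrow>
              alg_solving_degree fs (tr1 @ tr2 @ tr3) \<le> 2 * d - 1)) \<and>
          (\<forall>hs s3 tr3 s4.
            interreduction (map fst (basis s2)) hs \<and> continues_with hs s3 \<and>
            run normal_step s3 tr3 s4 \<longrightarrow>
            strict_solving_degree tr3 \<le> 2 * d - 2 \<and>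
            (2 \<le> d \<longrightarrow> strict_solving_degree (tr1 @ tr2 @ tr3) \<le> 2 * d - 2))))"
proof -
  note nosyz = semiregular_no_syzygies(1)[OF nonzero semiregular D D_pos]
  interpret low_degree fs D using nosyz nonzero by unfold_locales
  have part1: "\<forall>st sh sa. jointly_reachable D fs (st, sh, sa) \<longrightarrow>
        corresponding_states st sh sa \<and>
        (\<forall>et st'. normal_step st et st' \<and> below D st et \<longrightarrow>
          (\<exists>eh sh' ea sa'. joint_move D (st, sh, sa) (et, eh, ea) (st', sh', sa'))) \<and>
        (\<forall>eh sh'. normal_step sh eh sh' \<and> below D sh eh \<longrightarrow>
          (\<exists>et st' ea sa'. joint_move D (st, sh, sa) (et, eh, ea) (st', sh', sa'))) \<and>
        (\<forall>ea sa'. normal_step sa ea sa' \<and> below D sa ea \<longrightarrow>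
          (\<exists>et st' eh sh'. joint_move D (st, sh, sa) (et, eh, ea) (st', sh', sa')))"
  proof (intro allI impI)
    fix st sh sa assume r: "jointly_reachable D fs (st, sh, sa)"
    show "corresponding_states st sh sa \<and>
        (\<forall>et st'. normal_step st et st' \<and> below D st et \<longrightarrow>
          (\<exists>eh sh' ea sa'. joint_move D (st, sh, sa) (et, eh, ea) (st', sh', sa'))) \<and>
        (\<forall>eh sh'. normal_step sh eh sh' \<and> below D sh eh \<longrightarrow>
          (\<exists>et st' ea sa'. joint_move D (st, sh, sa) (et, eh, ea) (st', sh', sa'))) \<and>
        (\<forall>ea sa'. normal_step sa ea sa' \<and> below D sa ea \<longrightarrow>
          (\<exists>et st' eh sh'. joint_move D (st, sh, sa) (et, eh, ea) (st', sh', sa')))"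
      by (intro conjI allI impI; (elim conjE)?; rule correspondence[OF r]; assumption)
  qed
  have part1': "\<forall>tr s. run normal_step (init fs) tr s \<and> (\<forall>(u, e)\<in>set tr. below D u e) \<longrightarrow>
        (\<forall>(u, e)\<in>set tr. \<not> degree_fall u e)"
    using no_degree_fall by blast
  have part2: "(\<forall>u i j rs. (u, Process (i, j) rs) \<in> set tr2 \<longrightarrow>
          (\<exists>trh sh sh'.
            run normal_step (init (map phom fs)) trh sh \<and>
            fst ` set (basis sh) =
              {lift s g | g s. (g, s) \<in> set (basis u) \<and> s \<le> d} \<union> phom ` set fs \<and>
            poly_at sh i = phom (poly_at u i) \<and> poly_at sh j = phom (poly_at u j) \<and>
            normal_step sh
              (Process (i, j) (map (\<lambda>r. (lift d (fst r), d)) (sugar_part rs))) sh')) \<and>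
        ((\<forall>p\<in>avail s2. d < pair_sugar s2 p) \<longrightarrow>
          (\<forall>t. mdeg t = d \<longrightarrow>
            (single t 1 :: ('x, 'k) mpoly) \<in>
              ideal_gen {single (lm g) 1 | g. g \<in> fst ` set (basis s2)}) \<and>
          ((\<forall>f\<in>set fs. pdeg f \<le> d) \<longrightarrow>
            (\<forall>tr3 s3. run late_sugar_step s2 tr3 s3 \<longrightarrow>
              alg_solving_degree fs (tr1 @ tr2 @ tr3) \<le> 2 * d - 1)) \<and>
          (\<forall>hs s3 tr3 s4.
            interreduction (map fst (basis s2)) hs \<and> continues_with hs s3 \<and>
            run normal_step s3 tr3 s4 \<longrightarrow>
            strict_solving_degree tr3 \<le> 2 * d - 2 \<and>
            (2 \<le> d \<longrightarrow> strict_solving_degree (tr1 @ tr2 @ tr3) \<le> 2 * d - 2)))"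
    if Dd: "D = enat d" and run1: "run normal_step (init fs) tr1 s1"
      and below1: "\<forall>(u, e)\<in>set tr1. below D u e" and avail1: "\<forall>p\<in>avail s1. d \<le> pair_deg s1 p"
      and run2: "run sugar_step s1 tr2 s2" and sug2: "\<forall>(u, p)\<in>processed tr2. pair_sugar u p = d"
    for d tr1 s1 tr2 s2
  proof -
    have d: "1 \<le> d" using D_pos Dd by (simp add: enat_0_iff zero_enat_def) 
    obtain trh sh1 where sh1: "run normal_step (init (map phom fs)) trh sh1" "good sh1" "s1 = spec_state 1 sh1"
      using affine_run_lift[OF run1 below1 spec_state_init(2)[symmetric] good_init] by blast
    have ld: "low_degree fs (enat d)" using low_degree_axioms Dd by simp
    interpret sp: sugar_phase fs d s1 sh1
    proof (intro sugar_phase.intro sugar_phase_axioms.intro ld)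
      show "low_degree.good fs (enat d) sh1" using sh1(2) Dd by simp
    qed (use sh1 avail1 in auto)
    have dreg: "\<forall>p. homogeneous d p \<longrightarrow> p \<in> ideal_gen (ptop ` set fs)"
      using dreg_attained[of "ideal_gen (set (map ptop fs))" d] D Dd by simp
    note below1' = below1[unfolded Dd]
    note deg1 = affine_processed_pdeg[OF run1 below1' Dd]
    note deg2 = sp.sugar_processed_pdeg[OF run2 sug2]
    show ?thesis
    proof (intro conjI impI allI)
      fix u i j rs assume "(u, Process (i, j) rs) \<in> set tr2"
      then show "\<exists>trh sh sh'. run normal_step (init (map phom fs)) trh sh \<and>
            fst ` set (basis sh) =
              {lift s g | g s. (g, s) \<in> set (basis u) \<and> s \<le> d} \<union> phom ` set fs \<and>
            poly_at sh i = phom (poly_at u i) \<and> poly_at sh j = phom (poly_at u j) \<and>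
            normal_step sh
              (Process (i, j) (map (\<lambda>r. (lift d (fst r), d)) (sugar_part rs))) sh'"
        by (rule sp.lifted_reduction[OF run2 sug2])
    next
      assume fin: "\<forall>p\<in>avail s2. d < pair_sugar s2 p"
      note eop = sp.end_of_phase[OF run2 sug2 fin dreg]
      show "(single t 1 :: ('x, 'k) mpoly) \<in> ideal_gen {single (lm g) 1 | g. g \<in> fst ` set (basis s2)}"
        if t: "mdeg t = d" for t
      proof -
        obtain g where "g \<in> polys s2" "mdvd (lm g) t" using eop(1) t unfolding covers_def by blast
        then have "single t 1 \<in> ideal_gen ((\<lambda>s. single s (1::'k)) ` (lm ` polys s2))"
          by (intro monomial_in_ideal[of "lm g"]) auto
        moreover have "(\<lambda>s. single s (1::'k)) ` (lm ` polys s2) = {single (lm g) 1 | g. g \<in> fst ` set (basis s2)}"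
          by auto
        ultimately show ?thesis by simp
      qed
      show "alg_solving_degree fs (tr1 @ tr2 @ tr3) \<le> 2 * d - 1"
        if f: "\<forall>f\<in>set fs. pdeg f \<le> d" and run3: "run late_sugar_step s2 tr3 s3" for tr3 s3
      proof (rule alg_solving_degree_le)
        show "pdeg f \<le> 2 * d - 1" if "f \<in> set fs" for f using f that d by fastforce
        fix u p assume "(u, p) \<in> processed (tr1 @ tr2 @ tr3)"
        then consider "(u, p) \<in> processed tr1" | "(u, p) \<in> processed tr2" | "(u, p) \<in> processed tr3"
          by (auto simp: processed_append)
        then show "pair_deg u p \<le> 2 * d - 1"
        proof cases
          case 1
          then show ?thesis using deg1(1) by fastforce
        next
          case 2
          then show ?thesis using deg2(1) d by fastforce
        next
          case 3
          then show ?thesis using late_pair_deg[OF run3 eop(3)[OF f]] by blast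
        qed
      qed
      fix hs s3 tr3 s4
      assume *: "interreduction (map fst (basis s2)) hs \<and> continues_with hs s3 \<and> run normal_step s3 tr3 s4"
      then have ir: "interreduction (map fst (basis s2)) hs" and c: "continues_with hs s3"
        and run3: "run normal_step s3 tr3 s4" by auto
      have nz2: "0 \<notin> set (map fst (basis s2))" and cov2: "covers d (set (map fst (basis s2)))"
        using eop(1,2) by simp_all
      note irf = interreduction_top_monomial[OF ir nz2 cov2]
      have ps3: "polys s3 = set hs" using c unfolding continues_with_def by (metis set_map)
      have "length (basis s3) = length hs" using c unfolding continues_with_def by (metis length_map)
      then have sat: "saturated d s3" "\<forall>g\<in>polys s3. top_monomial d g"
        using irf c unfolding saturated_def valid_state_def ps3 by (auto simp: continues_with_def)
      note deg3 = strict_pair_pdeg[OF run3 sat]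
      show "strict_solving_degree tr3 \<le> 2 * d - 2"
        by (rule strict_solving_degree_le) (rule deg3)
      assume d2: "2 \<le> d"
      show "strict_solving_degree (tr1 @ tr2 @ tr3) \<le> 2 * d - 2"
      proof (rule strict_solving_degree_le)
        fix u p assume "(u, p) \<in> processed (tr1 @ tr2 @ tr3)"
        then consider "(u, p) \<in> processed tr1" | "(u, p) \<in> processed tr2" | "(u, p) \<in> processed tr3"
          by (auto simp: processed_append)
        then show "pdeg (pair_spoly u p) \<le> 2 * d - 2"
        proof cases
          case 1
          then show ?thesis using deg1 d2 by fastforce
        next
          case 2
          then show ?thesis using deg2(2) d2 by fastforce
        next
          case 3
          then show ?thesis by (rule deg3)
        qed
      qed
    qed
  qed
  show ?thesis
    by (rule conjI[OF part1 conjI[OF part1']], intro allI impI, elim conjE, rule part2) assumption+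
qed

end
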